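(* Let $\mathbb{G}$ be a homogeneous group of homogeneous dimension $Q\geq 3$, let $|\cdot|$ be any homogeneous quasi-norm on $\mathbb{G}$, and let $R>0$. Then for each $f\in C_{0}^{\infty}(B(0,R)\setminus\{0\})$, $$\left(\int_{B(0,R)}\frac{1}{|x|^{2}}\left|f(x)-f\left(R\frac{x}{|x|}\right)\right|^{2}dx\right)^{\frac12}\leq\frac{2}{Q-2}\left(\int_{B(0,R)}|\mathcal{R}f|^{2}dx\right)^{\frac12},$$ and $$\left(\int_{B(0,R)}\frac{1}{|x|^{2}}|f(x)|^{2}dx\right)^{\frac12}\leq\left(\frac{Q}{Q-2}\right)^{\frac12}\frac{1}{R}\left(\int_{B(0,R)}|f(x)|^{2}dx\right)^{\frac12}+\frac{2}{Q-2}\left(1+\left(\frac{Q}{Q-2}\right)^{\frac12}\right)\left(\int_{B(0,R)}|\mathcal{R}f|^{2}dx\right)^{\frac12}.$$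
   Context: A homogeneous group $\mathbb{G}$ is a connected simply connected Lie group whose Lie algebra $\mathfrak{g}$ is equipped with a family of dilations $D_{\lambda}=\mathrm{Exp}(A\ln\lambda)=\sum_{k\ge 0}\frac{1}{k!}(\ln(\lambda)A)^{k}$, $\lambda>0$, where $A$ is a diagonalisable linear operator on $\mathfrak{g}$ with positive eigenvalues and each $D_{\lambda}$ is a Lie algebra morphism. Such a group is nilpotent, the exponential map $\mathfrak{g}\to\mathbb{G}$ is a global diffeomorphism, and the dilations are transported to $\mathbb{G}$ via it; write $\lambda x:=D_{\lambda}x$ for $x\in\mathbb{G}$. The unit element of $\mathbb{G}$ is denoted $0$. The homogeneous dimension is $Q=\mathrm{Tr}\,A$, and $dx$ denotes Haar measure. A homogeneous quasi-norm is a continuous function $|\cdot|:\mathbb{G}\to[0,\infty)$ with $|x^{-1}|=|x|$, $|\lambda x|=\lambda|x|$ for all $x\in\mathbb{G}$, $\lambda>0$, and $|x|=0$ if and only if $x=0$. $B(0,R)=\{x\in\mathbb{G}:|x|<R\}$ is the quasi-ball with respect to $|\cdot|$. For $x\neq 0$, $R\frac{x}{|x|}$ denotes $D_{R/|x|}x$. The radial operator $\mathcal{R}=\frac{d}{d|x|}$ is defined by $\mathcal{R}f(x)=\frac{d}{dr}f(D_{r}y)\big|_{r=|x|}$, where $y=D_{1/|x|}x$ (so $|y|=1$). Functions are complex-valued; functions in $C_0^\infty(B(0,R)\setminus\{0\})$ (smooth, compactly supported in $B(0,R)\setminus\{0\}$) are regarded as functions on $\mathbb{G}$ via extension by zero.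 *)

theory Defs
  imports "HOL-Analysis.Analysis"
begin

section \<open>Smooth maps between open subsets of normed spaces\<close>

text \<open>For open \<open>S\<close>: all iterated directional derivatives up to order \<open>k\<close> exist and are continuous.\<close>

primrec Ck_on :: "nat \<Rightarrow> 'a::real_normed_vector set \<Rightarrow> ('a \<Rightarrow> 'b::real_normed_vector) \<Rightarrow> bool" where
  "Ck_on 0 S f \<longleftrightarrow> continuous_on S f"
| "Ck_on (Suc k) S f \<longleftrightarrow>
     (\<forall>x\<in>S. f differentiable at x) \<and> (\<forall>v. Ck_on k S (\<lambda>x. frechet_derivative f (at x) v))"

definition smooth_on :: "'a::real_normed_vector set \<Rightarrow> ('a \<Rightarrow> 'b::real_normed_vector) \<Rightarrow> bool" where
  "smooth_on S f \<longleftrightarrow> (\<forall>k. Ck_on k S f)"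


section \<open>Lie groups\<close>

text \<open>
  The manifold is a whole type \<open>'g\<close>; a chart is a pair of its domain and its coordinate map, which
  is meaningful on the domain only.
\<close>

type_synonym ('g, 'a) chart = "'g set \<times> ('g \<Rightarrow> 'a)"

definition smooth_atlas :: "('g::topological_space, 'a::euclidean_space) chart set \<Rightarrow> bool" where
  "smooth_atlas \<A> \<longleftrightarrow>
     (\<Union>(U, \<phi>)\<in>\<A>. U) = UNIV \<and>
     (\<forall>(U, \<phi>)\<in>\<A>. open U \<and> open (\<phi> ` U) \<and> homeomorphism U (\<phi> ` U) \<phi> (inv_into U \<phi>)) \<and>
     (\<forall>(U, \<phi>)\<in>\<A>. \<forall>(V, \<psi>)\<in>\<A>. smooth_on (\<phi> ` (U \<inter> V)) (\<lambda>p. \<psi> (inv_into U \<phi> p)))"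

definition smooth_function ::
    "('g::topological_space, 'a::euclidean_space) chart set \<Rightarrow> ('g \<Rightarrow> 'b::real_normed_vector) \<Rightarrow> bool" where
  "smooth_function \<A> f \<longleftrightarrow> (\<forall>(U, \<phi>)\<in>\<A>. smooth_on (\<phi> ` U) (\<lambda>p. f (inv_into U \<phi> p)))"

text \<open>
  The group law is written additively (the class \<open>topological_group_add\<close> does not assume
  commutativity): \<open>x + y\<close> is the product \<open>xy\<close>, \<open>- x\<close> is the inverse of \<open>x\<close>, and \<open>0\<close> is the unit.
\<close>

definition lie_group ::
    "('g::{topological_group_add, t2_space, second_countable_topology}, 'a::euclidean_space) chart set
      \<Rightarrow> bool" where
  "lie_group \<A> \<longleftrightarrow>
     smooth_atlas \<A> \<and>
     (\<forall>(U, \<phi>)\<in>\<A>. \<forall>(V, \<psi>)\<in>\<A>. \<forall>(W, \<omega>)\<in>\<A>.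
        smooth_on {(p, q). p \<in> \<phi> ` U \<and> q \<in> \<psi> ` V \<and> inv_into U \<phi> p + inv_into V \<psi> q \<in> W}
          (\<lambda>(p, q). \<omega> (inv_into U \<phi> p + inv_into V \<psi> q))) \<and>
     (\<forall>(U, \<phi>)\<in>\<A>. \<forall>(W, \<omega>)\<in>\<A>.
        smooth_on {p. p \<in> \<phi> ` U \<and> - inv_into U \<phi> p \<in> W} (\<lambda>p. \<omega> (- inv_into U \<phi> p)))"


section \<open>The Lie algebra and the exponential map\<close>

text \<open>
  The Lie algebra is the tangent space at the unit, identified with \<open>'a\<close> by means of a chart
  \<open>(U, \<phi>)\<close> around the unit. \<open>left_field U \<phi> v\<close> is the coordinate expression of the left-invariant
  vector field extending \<open>v\<close>; it is meaningful at all points \<open>p\<close> of \<open>\<phi> ` U\<close>.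
\<close>

definition left_field ::
    "'g::group_add set \<Rightarrow> ('g \<Rightarrow> 'a::euclidean_space) \<Rightarrow> 'a \<Rightarrow> 'a \<Rightarrow> 'a" where
  "left_field U \<phi> v p =
     frechet_derivative (\<lambda>q. \<phi> (inv_into U \<phi> p + inv_into U \<phi> q)) (at (\<phi> 0)) v"

text \<open>
  The value at the unit of the commutator \<open>XY - YX\<close> of the left-invariant vector fields \<open>X\<close>, \<open>Y\<close>
  extending \<open>v\<close>, \<open>w\<close>. In coordinates, the commutator of vector fields is \<open>(DY) X - (DX) Y\<close>, and here
  \<open>X\<close>, \<open>Y\<close> take the values \<open>v\<close>, \<open>w\<close> at the unit.
\<close>

definition lie_bracket ::
    "'g::group_add set \<Rightarrow> ('g \<Rightarrow> 'a::euclidean_space) \<Rightarrow> 'a \<Rightarrow> 'a \<Rightarrow> 'a" where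
  "lie_bracket U \<phi> v w =
     frechet_derivative (left_field U \<phi> w) (at (\<phi> 0)) v -
     frechet_derivative (left_field U \<phi> v) (at (\<phi> 0)) w"

text \<open>\<open>\<gamma>\<close> is the one-parameter subgroup with initial velocity \<open>v\<close>.\<close>

definition one_parameter_subgroup ::
    "('g::{topological_space, group_add} \<Rightarrow> 'a::euclidean_space) \<Rightarrow> 'a \<Rightarrow> (real \<Rightarrow> 'g) \<Rightarrow> bool" where
  "one_parameter_subgroup \<phi> v \<gamma> \<longleftrightarrow>
     continuous_on UNIV \<gamma> \<and> (\<forall>s t. \<gamma> (s + t) = \<gamma> s + \<gamma> t) \<and>
     ((\<lambda>t. \<phi> (\<gamma> t)) has_vector_derivative v) (at 0)"

text \<open>
  \<open>E\<close> is the exponential map of the group: \<open>E v = \<gamma> 1\<close> for the one-parameter subgroup \<open>\<gamma>\<close> with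
  initial velocity \<open>v\<close>. This condition determines \<open>E\<close>, and on a Lie group such an \<open>E\<close> exists.
\<close>

definition exponential_map ::
    "('g::{topological_space, group_add} \<Rightarrow> 'a::euclidean_space) \<Rightarrow> ('a \<Rightarrow> 'g) \<Rightarrow> bool" where
  "exponential_map \<phi> E \<longleftrightarrow> (\<forall>v. one_parameter_subgroup \<phi> v (\<lambda>t. E (t *\<^sub>R v)))"


section \<open>Homogeneous groups\<close>

definition diagonalisable_pos :: "('a::euclidean_space \<Rightarrow> 'a) \<Rightarrow> bool" where
  "diagonalisable_pos A \<longleftrightarrow>
     (\<exists>B. independent B \<and> span B = UNIV \<and> (\<forall>b\<in>B. \<exists>\<nu>>0. A b = \<nu> *\<^sub>R b))"

definition alg_dilation :: "('a::euclidean_space \<Rightarrow> 'a) \<Rightarrow> real \<Rightarrow> 'a \<Rightarrow> 'a" where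
  "alg_dilation A l v = (\<Sum>k. (1 / fact k) *\<^sub>R (((\<lambda>w. ln l *\<^sub>R A w) ^^ k) v))"

locale homogeneous_group =
  fixes \<A> :: "('g::{topological_group_add, t2_space, second_countable_topology},
               'a::euclidean_space) chart set"
    and U :: "'g set" and \<phi> :: "'g \<Rightarrow> 'a"
    and E :: "'a \<Rightarrow> 'g"
    and A :: "'a \<Rightarrow> 'a"
  assumes lie_group: "lie_group \<A>"
    and connected: "connected (UNIV :: 'g set)"
    and simply_connected: "simply_connected (UNIV :: 'g set)"
    and unit_chart: "(U, \<phi>) \<in> \<A>" "0 \<in> U"
    and exponential_map: "exponential_map \<phi> E"
    and linear: "linear A"
    and diagonalisable: "diagonalisable_pos A"
    and dilation_morphism:
      "\<And>l v w. l > 0 \<Longrightarrow>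
         alg_dilation A l (lie_bracket U \<phi> v w)
           = lie_bracket U \<phi> (alg_dilation A l v) (alg_dilation A l w)"

definition dilation :: "('a::euclidean_space \<Rightarrow> 'g) \<Rightarrow> ('a \<Rightarrow> 'a) \<Rightarrow> real \<Rightarrow> 'g \<Rightarrow> 'g" where
  "dilation E A l x = E (alg_dilation A l (inv E x))"

definition homogeneous_dimension :: "('a::euclidean_space \<Rightarrow> 'a) \<Rightarrow> real" where
  "homogeneous_dimension A = (\<Sum>b\<in>Basis. A b \<bullet> b)"

definition homogeneous_quasi_norm ::
    "('a::euclidean_space \<Rightarrow> 'g::topological_group_add) \<Rightarrow> ('a \<Rightarrow> 'a) \<Rightarrow> ('g \<Rightarrow> real) \<Rightarrow> bool" where
  "homogeneous_quasi_norm E A N \<longleftrightarrow>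
     continuous_on UNIV N \<and>
     (\<forall>x. N x \<ge> 0) \<and>
     (\<forall>x. N (- x) = N x) \<and>
     (\<forall>x. \<forall>l>0. N (dilation E A l x) = l * N x) \<and>
     (\<forall>x. N x = 0 \<longleftrightarrow> x = 0)"

definition quasi_ball :: "('g \<Rightarrow> real) \<Rightarrow> real \<Rightarrow> 'g set" where
  "quasi_ball N R = {x. N x < R}"

definition radial_derivative ::
    "('a::euclidean_space \<Rightarrow> 'g) \<Rightarrow> ('a \<Rightarrow> 'a) \<Rightarrow> ('g \<Rightarrow> real) \<Rightarrow> ('g \<Rightarrow> complex) \<Rightarrow> 'g \<Rightarrow> complex" where
  "radial_derivative E A N f x =
     vector_derivative (\<lambda>r. f (dilation E A r (dilation E A (1 / N x) x))) (at (N x))"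

definition haar_measure :: "'g::topological_group_add measure \<Rightarrow> bool" where
  "haar_measure \<mu> \<longleftrightarrow>
     sets \<mu> = sets borel \<and>
     (\<forall>x. distr \<mu> borel (\<lambda>y. x + y) = \<mu>) \<and>
     (\<forall>K. compact K \<longrightarrow> emeasure \<mu> K < \<infinity>) \<and>
     (\<forall>V. open V \<and> V \<noteq> {} \<longrightarrow> emeasure \<mu> V > 0)"

definition test_functions ::
    "('g::topological_space, 'a::euclidean_space) chart set \<Rightarrow> 'g set \<Rightarrow> ('g \<Rightarrow> complex) set" where
  "test_functions \<A> \<Omega> =
     {f. smooth_function \<A> f \<and> compact (closure {x. f x \<noteq> 0}) \<and> closure {x. f x \<noteq> 0} \<subseteq> \<Omega>}"

end

theory Submission
  imports Defs
begin

text \<open>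
  Both inequalities follow from Hardy's inequality
  \<open>\<integral> |f|\<^sup>2 / |x|\<^sup>2 \<le> (2 / (Q - 2))\<^sup>2 \<integral> |\<R> f|\<^sup>2\<close>, because \<open>R x / |x|\<close> lies on the sphere of radius \<open>R\<close>, where \<open>f\<close>
  vanishes. Hardy's inequality needs no polar coordinates: since Haar measure satisfies
  \<open>\<mu> (\<delta>\<^sub>l S) = l\<^sup>Q \<mu> S\<close>, the integral of \<open>|f (\<delta>\<^sub>l x)|\<^sup>2 / |x|\<^sup>2\<close> equals \<open>l\<^bsup>2-Q\<^esup>\<close> times its value at \<open>l = 1\<close>; differentiate
  at \<open>l = 1\<close> and apply the inequality of the arithmetic and geometric means.

  The group dilations \<open>\<delta>\<^sub>l\<close> are obtained without smoothness of the exponential map and without the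
  Baker-Campbell-Hausdorff formula. Let \<open>e\<^sub>i\<close> be an eigenbasis of \<open>A\<close>. The coordinates of the second kind
  \<open>Psi t = E (t\<^sub>1 e\<^sub>1) + \<dots> + E (t\<^sub>n e\<^sub>n)\<close> are continuously differentiable because each factor is a one-parameter
  subgroup, and their logarithmic derivative is expressed by the adjoint representation. As the dilations of
  the Lie algebra intertwine \<open>Ad (E (t e\<^sub>i))\<close>, the map \<open>Psi t \<mapsto> Psi (D\<^sub>l t)\<close> pulls the Maurer-Cartan form back to its
  \<open>D\<^sub>l\<close>-image, hence is a local homomorphism near the unit, and simple connectedness extends it to the group.
  Contraction by \<open>\<delta>\<^sub>l\<close> then makes \<open>Psi\<close> a global homeomorphism, and the Jacobians of left and right translations
  in these coordinates, being dilation invariant and continuous at the unit, equal 1. So Lebesgue measure in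
  these coordinates is a Haar measure, which gives the scaling law by uniqueness.
\<close>

section \<open>Extending local homomorphisms to simply connected groups\<close>

text \<open>\<open>E\<close> is given only along lines, and nothing is assumed about its dependence
  on the direction; products of one-parameter subgroups are differentiable by the product rule
  alone. The statement, however, dilates by \<open>E \<circ> alg_dilation A l \<circ> inv E\<close>.
  This agrees with the automorphism \<open>gdil l\<close> because an automorphism with derivative
  \<open>alg_dilation A l\<close> at the unit maps one-parameter subgroups to one-parameter
  subgroups, and because \<open>inv E\<close> is a right inverse once \<open>E\<close> is onto,
  which the existence of a quasi-norm yields.

  The given Haar measure is left invariant. Its comparison with Lebesgue measure in the coordinates
  uses right invariance of the latter, that is, unimodularity: \<open>Ad (Psi t)\<close> has
  determinant 1.

  The radial operator enters as the Euler field: away from the unit,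
  \<open>euler_deriv f x = N x * radial_derivative E A N f x\<close>. The constant comes from
  \<open>2 * a * b \<le> t * a^2 + b^2 / t\<close> with \<open>t = (Q - 2) / 2\<close>, the value
  that makes \<open>t * (Q - 2 - t)\<close> largest.\<close>

lemmas group_simps = add.assoc minus_add diff_conv_add_uminus

lemma idempotent_zero:
  fixes a :: "'g::group_add"
  assumes "a = a + a"
  shows "a = 0"
proof -
  have "- a + a = - a + (a + a)" using assms by simp
  then show ?thesis by (simp only: minus_add_cancel left_minus)
qed

text \<open>A set stable under right translation by \<open>V\<close> is open. The complement of
  \<open>S\<close> is stable too, since \<open>x = (x + v) + - v\<close>; so \<open>S\<close> is
  open and closed.\<close>

lemma connected_group_generated:
  fixes S :: "'g::topological_group_add set"
  assumes conn: "connected (UNIV :: 'g set)" and V: "open V" "0 \<in> V" "V \<subseteq> S"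
    and add: "\<And>x y. x \<in> S \<Longrightarrow> y \<in> S \<Longrightarrow> x + y \<in> S" and minus: "\<And>x. x \<in> S \<Longrightarrow> - x \<in> S"
  shows "S = UNIV"
proof -
  have "open T" if T: "\<And>x v. x \<in> T \<Longrightarrow> v \<in> V \<Longrightarrow> x + v \<in> T" for T :: "'g set"
  proof (subst open_subopen, intro ballI exI conjI)
    fix x assume x: "x \<in> T"
    show "open ((\<lambda>y. - x + y) -` V)" by (intro open_vimage V continuous_intros)
    show "x \<in> (\<lambda>y. - x + y) -` V" using V by simp
    show "(\<lambda>y. - x + y) -` V \<subseteq> T"
    proof
      fix y assume "y \<in> (\<lambda>y. - x + y) -` V"
      then have "x + (- x + y) \<in> T" using x T by blast
      then show "y \<in> T" by (simp add: add.assoc[symmetric])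
    qed
  qed
  moreover have "x + v \<in> - S" if "x \<in> - S" "v \<in> V" for x v
  proof
    assume "x + v \<in> S"
    then have "x + v + - v \<in> S" using that(2) V add minus by blast
    then show False using that(1) by (simp add: add.assoc)
  qed
  ultimately have "open S" "open (- S)" using V add by blast+
  moreover have "S \<noteq> {}" using V by auto
  ultimately show ?thesis
    using conn unfolding connected_def by (metis Compl_disjoint Compl_partition Int_UNIV_right Un_UNIV_left compl_bot_eq double_compl inf_top_left subset_UNIV)
qed

lemma nhds_zero_diff:
  fixes V :: "'g::topological_group_add set"
  assumes "open V" "0 \<in> V"
  obtains V' where "open V'" "0 \<in> V'" "\<And>x y. x \<in> V' \<Longrightarrow> y \<in> V' \<Longrightarrow> - x + y \<in> V"
proof -
  have "open ((\<lambda>p::'g\<times>'g. - fst p + snd p) -` V)"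
    by (intro open_vimage assms continuous_intros)
  moreover have "(0,0) \<in> (\<lambda>p::'g\<times>'g. - fst p + snd p) -` V" using assms by simp
  ultimately obtain A B where "open A" "open B" "(0,0) \<in> A \<times> B" "A \<times> B \<subseteq> (\<lambda>p::'g\<times>'g. - fst p + snd p) -` V"
    by (rule open_prod_elim)
  then show thesis by (intro that[of "A \<inter> B"]) auto
qed

text \<open>The target carries no metric, so closeness is measured by the left difference. The
  radius is a Lebesgue number for balls on which \<open>F\<close> stays within \<open>V'\<close> of
  its value at the centre; the differences from a common centre then combine.\<close>

lemma group_uniformly_continuous:
  fixes F :: "'m::heine_borel \<Rightarrow> 'g::topological_group_add"
  assumes K: "compact K" and F: "continuous_on K F" and V: "open V" "0 \<in> V"
  obtains e where "e > 0" "\<And>x y. x \<in> K \<Longrightarrow> y \<in> K \<Longrightarrow> dist x y < e \<Longrightarrow> - F x + F y \<in> V"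
proof -
  obtain V' where V': "open V'" "0 \<in> V'" "\<And>x y. x \<in> V' \<Longrightarrow> y \<in> V' \<Longrightarrow> - x + y \<in> V"
    using nhds_zero_diff[OF V] by blast
  have "\<exists>d>0. \<forall>q\<in>K. dist q p < d \<longrightarrow> - F p + F q \<in> V'" if p: "p \<in> K" for p
  proof -
    have lim: "((\<lambda>q. - F p + F q) \<longlongrightarrow> - F p + F p) (at p within K)"
      using F p unfolding continuous_on_def by (intro tendsto_intros) auto
    have "eventually (\<lambda>q. - F p + F q \<in> V') (at p within K)"
      using topological_tendstoD[OF lim V'(1)] V'(2) by simp
    then show ?thesis
      unfolding eventually_at using V'(2) by (metis left_minus)
  qed
  then obtain d where d: "\<And>p. p \<in> K \<Longrightarrow> d p > 0"
    "\<And>p q. p \<in> K \<Longrightarrow> q \<in> K \<Longrightarrow> dist q p < d p \<Longrightarrow> - F p + F q \<in> V'" by metis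
  obtain e where e: "e > 0" "\<forall>x\<in>K. \<exists>G\<in>(\<lambda>p. ball p (d p)) ` K. ball x e \<subseteq> G"
  proof (rule Heine_Borel_lemma[OF K, of "(\<lambda>p. ball p (d p)) ` K"])
    show "K \<subseteq> \<Union> ((\<lambda>p. ball p (d p)) ` K)" using d(1) centre_in_ball by blast
  qed auto
  show thesis
  proof (rule that[OF e(1)])
    fix x y assume xy: "x \<in> K" "y \<in> K" "dist x y < e"
    then obtain p where p: "p \<in> K" "ball x e \<subseteq> ball p (d p)" using e(2) by blast
    have "x \<in> ball x e" "y \<in> ball x e" using xy(3) e(1) by auto
    then have "x \<in> ball p (d p)" "y \<in> ball p (d p)" using p(2) by blast+
    then have "- F p + F x \<in> V'" "- F p + F y \<in> V'"
      using p(1) xy(1,2) by (auto intro!: d(2) simp: dist_commute)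
    from V'(3)[OF this] show "- F x + F y \<in> V"
      by (simp add: group_simps del: add_uminus_conv_diff)
  qed
qed

text \<open>A discrete path-ordered product: the images under \<open>h\<close> of the increments of
  \<open>g\<close> over the first \<open>k\<close> of \<open>n\<close> equal time steps. For a local
  homomorphism \<open>h\<close> it continues \<open>h\<close> along the path
  \<open>g\<close>.\<close>

primrec develop :: "('g::group_add \<Rightarrow> 'h::group_add) \<Rightarrow> (real \<Rightarrow> 'g) \<Rightarrow> nat \<Rightarrow> nat \<Rightarrow> 'h" where
  "develop h g n 0 = 0"
| "develop h g n (Suc k) = develop h g n k + h (- g (real k / real n) + g (real (Suc k) / real n))"

text \<open>The diagonal from \<open>a (i / n)\<close> to \<open>b ((i + 1) / n)\<close> cuts each
  cell between the two paths into two triangles. Local additivity on both of them moves the rung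
  between the paths one step further.\<close>

lemma develop_square:
  assumes hom: "\<And>x y. x \<in> V \<Longrightarrow> y \<in> V \<Longrightarrow> x + y \<in> V \<Longrightarrow> h (x + y) = h x + h y"
    and a: "\<And>i. i < k \<Longrightarrow> - a (real i / n) + a (real (Suc i) / n) \<in> V"
    and b: "\<And>i. i < k \<Longrightarrow> - b (real i / n) + b (real (Suc i) / n) \<in> V"
    and ab: "\<And>i. i \<le> k \<Longrightarrow> - a (real i / n) + b (real i / n) \<in> V"
    and ab': "\<And>i. i < k \<Longrightarrow> - a (real i / n) + b (real (Suc i) / n) \<in> V"
  shows "develop h a n k + h (- a (real k / n) + b (real k / n)) = h (- a 0 + b 0) + develop h b n k"
  using a b ab ab'
proof (induction k)
  case 0
  then show ?case by simp
next
  case (Suc k)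
  have IH: "develop h a n k + h (- a (real k / n) + b (real k / n)) = h (- a 0 + b 0) + develop h b n k"
    by (rule Suc.IH) (use Suc.prems in auto)
  let ?a = "a (real k / n)" let ?a' = "a (real (Suc k) / n)"
  let ?b = "b (real k / n)" let ?b' = "b (real (Suc k) / n)"
  have 1: "h (- ?a + ?b') = h (- ?a + ?a') + h (- ?a' + ?b')"
    using hom[of "- ?a + ?a'" "- ?a' + ?b'"] Suc.prems by (simp add: add.assoc del: of_nat_Suc)
  have 2: "h (- ?a + ?b') = h (- ?a + ?b) + h (- ?b + ?b')"
    using hom[of "- ?a + ?b" "- ?b + ?b'"] Suc.prems by (simp add: add.assoc del: of_nat_Suc)
  have "develop h a n (Suc k) + h (- ?a' + ?b') = develop h a n k + h (- ?a + ?b')"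
    using 1 by (simp add: add.assoc)
  also have "\<dots> = h (- a 0 + b 0) + develop h b n (Suc k)"
    using IH 2 by (simp add: add.assoc[symmetric])
  finally show ?case .
qed

lemma develop_translate: "develop h (\<lambda>t. x + g t) n k = develop h g n k"
  by (induction k) (simp_all add: minus_add add.assoc del: add_uminus_conv_diff of_nat_Suc)

lemma develop_const: "h 0 = 0 \<Longrightarrow> develop h (\<lambda>t. x) n k = 0"
  by (induction k) simp_all

lemma develop_single:
  assumes hom: "\<And>x y. x \<in> V \<Longrightarrow> y \<in> V \<Longrightarrow> x + y \<in> V \<Longrightarrow> h (x + y) = h x + h y"
    and c: "\<And>s t. s \<in> {0..1} \<Longrightarrow> t \<in> {0..1} \<Longrightarrow> - c s + c t \<in> V"
    and k: "k \<le> n" and n: "n > 0"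
  shows "develop h c n k = h (- c 0 + c (real k / n))"
  using k
proof (induction k)
  case 0
  have "0 \<in> V" using c[of 0 0] by simp
  then have "h 0 = 0" using idempotent_zero[of "h 0"] hom[of 0 0] by simp
  then show ?case by simp
next
  case (Suc k)
  have I: "0 \<in> {0..1::real}" "real k / n \<in> {0..1}" "real (Suc k) / n \<in> {0..1}"
    using Suc.prems n by (auto simp: field_simps)
  let ?x = "c (real k / n)" let ?y = "c (real (Suc k) / n)"
  have "h (- c 0 + ?y) = h (- c 0 + ?x) + h (- ?x + ?y)"
    using hom[of "- c 0 + ?x" "- ?x + ?y"] c[OF I(1,2)] c[OF I(2,3)] c[OF I(1,3)]
    by (simp add: add.assoc del: of_nat_Suc)
  then show ?case using Suc by simp
qed

text \<open>\<open>+++\<close> runs each path at double speed, so a partition into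
  \<open>2 * n\<close> steps restricts to one into \<open>n\<close> steps on each half.\<close>

lemma develop_join:
  assumes n: "n > 0" and g: "g1 1 = g2 0"
  shows "develop h (g1 +++ g2) (2 * n) (2 * n) = develop h g1 n n + develop h g2 n n"
proof -
  have L: "(g1 +++ g2) (real k / real (2 * n)) = g1 (real k / n)" if "k \<le> n" for k
    using that n by (auto simp: joinpaths_def field_simps)
  have R: "(g1 +++ g2) (real (n + k) / real (2 * n)) = g2 (real k / n)" for k
    using n g by (auto simp: joinpaths_def field_simps)
  have "develop h (g1 +++ g2) (2 * n) k = develop h g1 n k" if "k \<le> n" for k
    using that
  proof (induction k)
    case (Suc k)
    then show ?case using L[of k] L[of "Suc k"] by (simp del: of_nat_Suc)
  qed simp
  then have 1: "develop h (g1 +++ g2) (2 * n) n = develop h g1 n n" by simp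
  have "develop h (g1 +++ g2) (2 * n) (n + k) = develop h g1 n n + develop h g2 n k" for k
  proof (induction k)
    case (Suc k)
    then show ?case using R[of k] R[of "Suc k"] by (simp add: add.assoc del: of_nat_Suc)
  qed (simp add: 1)
  from this[of n] show ?thesis by (simp add: mult_2)
qed

text \<open>Along a homotopy of loops, developments change by conjugation; those of the constant loop vanish.\<close>

lemma develop_loop:
  fixes h :: "'g::topological_group_add \<Rightarrow> 'h::group_add"
  assumes sc: "simply_connected (UNIV :: 'g set)" and V: "open V" "0 \<in> V"
    and hom: "\<And>x y. x \<in> V \<Longrightarrow> y \<in> V \<Longrightarrow> x + y \<in> V \<Longrightarrow> h (x + y) = h x + h y"
    and g: "path g" "g 0 = g 1"
  shows "\<exists>n0>0. \<forall>n\<ge>n0. develop h g n n = 0"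
proof -
  have "homotopic_loops UNIV g (\<lambda>t. 0)"
    using sc g unfolding simply_connected_def by (auto simp: pathfinish_def pathstart_def path_def)
  then obtain F where F: "continuous_on ({0..1::real} \<times> {0..1::real}) F"
    "\<And>x. x \<in> {0..1} \<Longrightarrow> F (0, x) = g x" "\<And>x. x \<in> {0..1} \<Longrightarrow> F (1, x) = 0"
    "\<And>t. t \<in> {0..1} \<Longrightarrow> F (t, 1) = F (t, 0)"
    unfolding homotopic_loops by (force simp: pathfinish_def pathstart_def)
  obtain e where e: "e > 0"
    "\<And>x y. x \<in> {0..1} \<times> {0..1} \<Longrightarrow> y \<in> {0..1} \<times> {0..1} \<Longrightarrow> dist x y < e \<Longrightarrow> - F x + F y \<in> V"
    using group_uniformly_continuous[OF _ F(1) V] by (metis compact_Icc compact_Times)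
  have h0: "h 0 = 0" using idempotent_zero[of "h 0"] hom[of 0 0] V by simp
  obtain n0 :: nat where n0: "2 / e < real n0" using reals_Archimedean2 by blast
  have n0_pos: "n0 > 0" using n0 e(1) by (cases "n0 = 0") (auto simp: field_simps)
  have "develop h g n n = 0" if n: "n \<ge> n0" for n
  proof -
    have n_pos: "n > 0" using n n0_pos by simp
    have "2 / e < real n" using n0 n by linarith
    \<comment> \<open>Parameters that differ by at most \<open>1 / n\<close> in each coordinate are
      closer than \<open>e\<close>, so grid neighbours and cell diagonals all have increments in
      \<open>V\<close>.\<close>
    then have small: "2 / real n < e" using e(1) n_pos by (simp add: field_simps)
    have small_step: "- F (s, t) + F (s', t') \<in> V"
      if "s \<in> {0..1}" "t \<in> {0..1}" "s' \<in> {0..1}" "t' \<in> {0..1}" "\<bar>s - s'\<bar> \<le> 1 / n" "\<bar>t - t'\<bar> \<le> 1 / n" for s t s' t'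
    proof (rule e(2))
      have "dist (s, t) (s', t') \<le> \<bar>s - s'\<bar> + \<bar>t - t'\<bar>"
        by (simp add: dist_prod_def dist_real_def sqrt_sum_squares_le_sum_abs[THEN order_trans])
      also have "\<dots> \<le> 1 / n + 1 / n" using that by linarith
      also have "\<dots> = 2 / n" by simp
      finally show "dist (s, t) (s', t') < e" using small by simp
    qed (use that in auto)
    have I: "real i / n \<in> {0..1}" if "i \<le> n" for i
      using that n_pos by auto
    have D: "\<bar>real i / n - real (Suc i) / n\<bar> \<le> 1 / n" for i
      by (simp add: diff_divide_distrib[symmetric])
    let ?g = "\<lambda>j t. F (real j / n, t)"
    have "develop h (?g j) n n = 0" if "j \<le> n" for j
      using that
    \<comment> \<open>The induction descends from the row \<open>j = n\<close>, where the homotopy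
      has reached the constant loop, to the row \<open>j = 0\<close>, which is
      \<open>g\<close>.\<close>
    proof (induction j rule: inc_induct)
      case base
      have "?g n t = 0" if "t \<in> {0..1}" for t using F(3)[OF that] n_pos by simp
      then have "develop h (?g n) n k = 0" if "k \<le> n" for k
        using that
      proof (induction k)
        case (Suc k)
        then show ?case using I[of k] I[of "Suc k"] n_pos h0 by (simp del: of_nat_Suc)
      qed simp
      then show ?case by simp
    next
      case (step j)
      have "develop h (?g j) n n + h (- ?g j (real n / n) + ?g (Suc j) (real n / n))
          = h (- ?g j 0 + ?g (Suc j) 0) + develop h (?g (Suc j)) n n"
        using step.hyps by (intro develop_square[of V h, OF hom] small_step I D) auto
      \<comment> \<open>Every stage of the homotopy is a loop, so the rungs at the two ends of the
        row are the same element and cancel once the next row is known to vanish.\<close>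
      moreover have "?g j (real n / n) = ?g j 0" "?g (Suc j) (real n / n) = ?g (Suc j) 0"
        using F(4) I[of j] I[of "Suc j"] step.hyps n_pos by auto
      ultimately have "develop h (?g j) n n + h (- ?g j 0 + ?g (Suc j) 0)
          = 0 + h (- ?g j 0 + ?g (Suc j) 0)"
        using step.IH by (simp del: of_nat_Suc)
      then show ?case by (simp only: add_right_cancel)
    qed
    from this[of 0] have "develop h (?g 0) n n = 0" by simp
    moreover have "develop h (?g 0) n k = develop h g n k" if "k \<le> n" for k
      using that
    proof (induction k)
      case (Suc k)
      then show ?case using I[of k] I[of "Suc k"] F(2) by (simp del: of_nat_Suc)
    qed simp
    ultimately show ?thesis by simp
  qed
  then show ?thesis using n0_pos by blast
qed

text \<open>All pairs of a word in \<open>W\<close> and the corresponding product of values of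
  \<open>h\<close>. That it is single valued is the point at which simple connectedness enters, so
  the extension starts as a relation.\<close>

inductive_set hom_graph :: "'g set \<Rightarrow> ('g::group_add \<Rightarrow> 'h::group_add) \<Rightarrow> ('g \<times> 'h) set"
  for W h where
  zero: "(0, 0) \<in> hom_graph W h"
| step: "(x, y) \<in> hom_graph W h \<Longrightarrow> w \<in> W \<Longrightarrow> (x + w, y + h w) \<in> hom_graph W h"

lemma hom_graph_add:
  assumes "(x', y') \<in> hom_graph W h" "(x, y) \<in> hom_graph W h"
  shows "(x + x', y + y') \<in> hom_graph W h"
  using assms
proof (induction rule: hom_graph.induct)
  case (step x' y' w)
  then show ?case using hom_graph.step[of "x + x'" "y + y'"] by (simp add: add.assoc)
qed simp

text \<open>A word is realised by joining translated short paths, and its value is recovered by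
  developing along them. The partition sizes are powers of two because every appended letter doubles
  the number of steps.\<close>

lemma hom_graph_path:
  fixes h :: "'g::topological_group_add \<Rightarrow> 'h::group_add"
  assumes hom: "\<And>x y. x \<in> V \<Longrightarrow> y \<in> V \<Longrightarrow> x + y \<in> V \<Longrightarrow> h (x + y) = h x + h y"
    and V0: "0 \<in> V"
    and paths: "\<And>x. x \<in> W \<Longrightarrow> \<exists>c. path c \<and> c 0 = 0 \<and> c 1 = x \<and>
                  (\<forall>s\<in>{0..1}. \<forall>t\<in>{0..1}. - c s + c t \<in> V)"
    and xy: "(x, y) \<in> hom_graph W h"
  shows "\<exists>g. path g \<and> g 0 = 0 \<and> g 1 = x \<and> (\<exists>k0. \<forall>k\<ge>k0. develop h g (2 ^ k) (2 ^ k) = y)"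
  using xy
proof (induction rule: hom_graph.induct)
  case zero
  have "h 0 = 0" using idempotent_zero[of "h 0"] hom[of 0 0] V0 by simp
  then have "develop h (\<lambda>t. 0) n k = 0" for n k by (rule develop_const)
  then show ?case by (intro exI[of _ "\<lambda>t. 0"]) (auto simp: path_def)
next
  case (step x y w)
  obtain g k0 where g: "path g" "g 0 = 0" "g 1 = x" "\<And>k. k \<ge> k0 \<Longrightarrow> develop h g (2 ^ k) (2 ^ k) = y"
    using step.IH by blast
  obtain c where c: "path c" "c 0 = 0" "c 1 = w"
    "\<And>s t. s \<in> {0..1} \<Longrightarrow> t \<in> {0..1} \<Longrightarrow> - c s + c t \<in> V"
    using paths[OF step.hyps(2)] by blast
  let ?c = "\<lambda>t. x + c t"
  have "path ?c" using c(1) unfolding path_def by (intro continuous_intros)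
  then have "path (g +++ ?c)"
    using g c by (intro path_join_imp) (auto simp: pathfinish_def pathstart_def)
  moreover have "develop h (g +++ ?c) (2 ^ k) (2 ^ k) = y + h w" if k: "k \<ge> Suc k0" for k
  proof -
    obtain j where j: "k = Suc j" "j \<ge> k0" using k by (cases k) auto
    have "develop h c (2 ^ j) (2 ^ j) = h w"
      using develop_single[of V h c "2 ^ j" "2 ^ j", OF hom c(4)] c by simp
    then show ?thesis
      using develop_join[of "2 ^ j" g ?c h] g c j by (simp add: develop_translate)
  qed
  ultimately show ?case using g(2) c(3) by (intro exI[of _ "g +++ ?c"]) (auto simp: joinpaths_def)
qed

text \<open>Two words for one element differ by a word for the unit, whose path is a loop. The
  development of this loop is the value of the word and, by simple connectedness, also
  \<open>0\<close>; so the relation generated by \<open>h\<close> on \<open>W\<close> is a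
  function.\<close>

theorem local_hom_extends:
  fixes h :: "'g::topological_group_add \<Rightarrow> 'h::group_add"
  assumes sc: "simply_connected (UNIV :: 'g set)" and conn: "connected (UNIV :: 'g set)"
    and V: "open V" "0 \<in> V"
    and hom: "\<And>x y. x \<in> V \<Longrightarrow> y \<in> V \<Longrightarrow> x + y \<in> V \<Longrightarrow> h (x + y) = h x + h y"
    and W: "open W" "0 \<in> W"
    and paths: "\<And>x. x \<in> W \<Longrightarrow> \<exists>c. path c \<and> c 0 = 0 \<and> c 1 = x \<and>
                  (\<forall>s\<in>{0..1}. \<forall>t\<in>{0..1}. - c s + c t \<in> V)"
  obtains H where "\<And>x y. H (x + y) = H x + H y" "\<And>x. x \<in> W \<Longrightarrow> H x = h x"
proof -
  let ?G = "hom_graph W h"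
  have WG: "(w, h w) \<in> ?G" if "w \<in> W" for w
    using hom_graph.step[OF hom_graph.zero that] by simp
  \<comment> \<open>Asking for \<open>- x\<close> as well makes \<open>S\<close> symmetric although
    \<open>W\<close> need not be.\<close>
  define S where "S = {x. \<exists>y y'. (x, y) \<in> ?G \<and> (- x, y') \<in> ?G}"
  have "S = UNIV"
  proof (rule connected_group_generated[OF conn])
    show "open (W \<inter> uminus -` W)" by (intro open_Int open_vimage W continuous_intros)
    show "W \<inter> uminus -` W \<subseteq> S" using WG unfolding S_def by auto
    show "x + x' \<in> S" if "x \<in> S" "x' \<in> S" for x x'
      using that hom_graph_add unfolding S_def by (fastforce simp: minus_add)
  qed (use W in \<open>auto simp: S_def\<close>)
  then have ex: "\<exists>y. (x, y) \<in> ?G" for x unfolding S_def by blast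
  have zero: "y = 0" if y: "(0, y) \<in> ?G" for y
  proof -
    obtain g k0 where g: "path g" "g 0 = 0" "g 1 = 0" "\<And>k. k \<ge> k0 \<Longrightarrow> develop h g (2 ^ k) (2 ^ k) = y"
      using hom_graph_path[of V h W 0 y, OF hom V(2) paths y] by blast
    obtain n0 where n0: "\<And>n. n \<ge> n0 \<Longrightarrow> develop h g n n = 0"
      using develop_loop[of V h g, OF sc V hom g(1)] g(2,3) by auto
    \<comment> \<open>One exponent serves both thresholds: the partition size is a power of two with
      exponent at least \<open>k0\<close>, and it is at least \<open>n0\<close>.\<close>
    have "n0 \<le> 2 ^ max k0 n0"
      by (meson less_imp_le_nat less_exp max.cobounded2 order_trans)
    then show ?thesis using g(4)[of "max k0 n0"] n0[of "2 ^ max k0 n0"] by simp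
  qed
  have uniq: "y = y'" if y: "(x, y) \<in> ?G" "(x, y') \<in> ?G" for x y y'
  proof -
    obtain z where z: "(- x, z) \<in> ?G" using ex by blast
    have "y + z = 0" "y' + z = 0"
      using hom_graph_add[OF z y(1)] hom_graph_add[OF z y(2)] zero by auto
    then show ?thesis by (metis add_right_cancel)
  qed
  define H where "H x = (THE y. (x, y) \<in> ?G)" for x
  have H: "(x, H x) \<in> ?G" for x
    unfolding H_def using ex uniq by (metis theI)
  show thesis
  proof (rule that[of H])
    show "H (x + y) = H x + H y" for x y
      by (rule uniq[OF H hom_graph_add[OF H H]])
    show "H x = h x" if "x \<in> W" for x
      by (rule uniq[OF H WG[OF that]])
  qed
qed

section \<open>Invariant measures\<close>

lemma borel_measurable_pair_continuous:
  fixes F :: "'a::second_countable_topology \<times> 'b::second_countable_topology \<Rightarrow> 'c::topological_space"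
  assumes "sets M = sets borel" "sets N = sets borel" "continuous_on UNIV F" "g \<in> borel_measurable borel"
  shows "(\<lambda>p. g (F p)) \<in> borel_measurable (M \<Otimes>\<^sub>M N)"
proof -
  have "sets (M \<Otimes>\<^sub>M N) = sets (borel :: ('a \<times> 'b) measure)"
    unfolding borel_prod[symmetric] by (rule sets_pair_measure_cong[OF assms(1,2)])
  moreover have "(\<lambda>p. g (F p)) \<in> borel_measurable borel"
    by (rule measurable_compose[OF borel_measurable_continuous_onI[OF assms(3)] assms(4)])
  ultimately show ?thesis by (simp cong: measurable_cong_sets)
qed

lemma nn_integral_distr_invariant:
  assumes "distr M borel T = M" "T \<in> borel_measurable M" "g \<in> borel_measurable borel"
  shows "(\<integral>\<^sup>+x. g (T x) \<partial>M) = (\<integral>\<^sup>+x. g x \<partial>M)"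
proof -
  have "(\<integral>\<^sup>+x. g x \<partial>distr M borel T) = (\<integral>\<^sup>+x. g (T x) \<partial>M)"
    using assms(2,3) by (intro nn_integral_distr) simp_all
  then show ?thesis using assms(1) by simp
qed

text \<open>Weil's uniqueness argument: \<open>g x * h (y + x)\<close> is integrated in both orders.
  Right invariance of \<open>L\<close> inserts \<open>x\<close>, left invariance of \<open>M\<close>
  replaces \<open>x\<close> by \<open>- y + x\<close>, and left invariance of \<open>L\<close>
  replaces \<open>y\<close> by \<open>x + y\<close>. With a fixed \<open>h\<close> of
  \<open>L\<close>-integral 1, integrals against \<open>M\<close> are expressed by \<open>L\<close>,
  up to an inversion.\<close>

lemma left_invariant_proportional:
  fixes M L :: "'g::{topological_group_add, t2_space, second_countable_topology} measure"
  assumes sM: "sets M = sets borel" and sL: "sets L = sets borel"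
    and sfM: "sigma_finite_measure M" and sfL: "sigma_finite_measure L"
    and lM: "\<And>x. distr M borel (\<lambda>y. x + y) = M"
    and lL: "\<And>x. distr L borel (\<lambda>y. x + y) = L" and rL: "\<And>x. distr L borel (\<lambda>y. y + x) = L"
    and g: "g \<in> borel_measurable borel" and h: "h \<in> borel_measurable borel"
  shows "(\<integral>\<^sup>+x. g x \<partial>M) * (\<integral>\<^sup>+y. h y \<partial>L) = (\<integral>\<^sup>+x. h x \<partial>M) * (\<integral>\<^sup>+y. g (- y) \<partial>L)"
proof -
  interpret sigma_finite_measure M by (rule sfM)
  interpret sigma_finite_measure L by (rule sfL)
  interpret pair_sigma_finite M L ..
  note cts = continuous_intros continuous_on_fst continuous_on_snd continuous_on_id
  have meas: "k \<in> borel_measurable M" "k \<in> borel_measurable L"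
    if "k \<in> borel_measurable borel" for k :: "'g \<Rightarrow> ennreal"
    using that sM sL by (simp_all cong: measurable_cong_sets)
  have "continuous_on UNIV (uminus :: 'g \<Rightarrow> 'g)"
    using continuous_on_minus[OF continuous_on_id[of UNIV]] by simp
  then have tr: "(\<lambda>y. x + y) \<in> borel_measurable borel" "(\<lambda>y. y + x) \<in> borel_measurable borel"
    "(\<lambda>y::'g. - y) \<in> borel_measurable borel" for x :: 'g
    by (intro borel_measurable_continuous_onI continuous_intros)+
  have m1: "(\<lambda>p. g (fst p) * h (snd p + fst p)) \<in> borel_measurable (M \<Otimes>\<^sub>M L)"
    by (intro borel_measurable_times_ennreal borel_measurable_pair_continuous[OF sM sL _ g]
        borel_measurable_pair_continuous[OF sM sL _ h] continuous_intros)
  have m2: "(\<lambda>p. g (- snd p + fst p) * h (fst p)) \<in> borel_measurable (M \<Otimes>\<^sub>M L)"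
    by (intro borel_measurable_times_ennreal borel_measurable_pair_continuous[OF sM sL _ g]
        borel_measurable_pair_continuous[OF sM sL _ h] continuous_intros)
  have measurable_borel: "T \<in> borel_measurable M" "T \<in> borel_measurable L"
    if "T \<in> borel_measurable borel" for T :: "'g \<Rightarrow> 'g"
    using that sM sL by (simp_all cong: measurable_cong_sets)
  have comp: "(\<lambda>y. g (T y)) \<in> borel_measurable borel" "(\<lambda>y. h (T y)) \<in> borel_measurable borel"
    if "continuous_on UNIV T" for T :: "'g \<Rightarrow> 'g"
    using measurable_compose[OF borel_measurable_continuous_onI[OF that]] g h by auto
  have hx: "(\<lambda>y. h (y + x)) \<in> borel_measurable borel" "(\<lambda>y. g (- y + x)) \<in> borel_measurable borel"
     "(\<lambda>y. g (- y)) \<in> borel_measurable borel" "(\<lambda>y. g (- x + y)) \<in> borel_measurable borel" for x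
    by (intro comp continuous_intros)+
  have "(\<integral>\<^sup>+x. g x \<partial>M) * (\<integral>\<^sup>+y. h y \<partial>L) = (\<integral>\<^sup>+x. g x * (\<integral>\<^sup>+y. h y \<partial>L) \<partial>M)"
    by (rule nn_integral_multc[OF meas(1)[OF g], symmetric])
  also have "\<dots> = (\<integral>\<^sup>+x. g x * (\<integral>\<^sup>+y. h (y + x) \<partial>L) \<partial>M)"
    by (subst nn_integral_distr_invariant[OF rL measurable_borel(2)[OF tr(2)] h]) (rule refl)
  also have "\<dots> = (\<integral>\<^sup>+x. (\<integral>\<^sup>+y. g x * h (y + x) \<partial>L) \<partial>M)"
    by (intro nn_integral_cong nn_integral_cmult[symmetric] meas hx)
  also have "\<dots> = (\<integral>\<^sup>+y. (\<integral>\<^sup>+x. g x * h (y + x) \<partial>M) \<partial>L)"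
    using Fubini[OF m1] by (simp only: fst_conv snd_conv)
  also have "\<dots> = (\<integral>\<^sup>+y. (\<integral>\<^sup>+x. g (- y + x) * h x \<partial>M) \<partial>L)"
  proof (rule nn_integral_cong)
    fix y
    have "(\<integral>\<^sup>+x. g (- y + x) * h x \<partial>M) = (\<integral>\<^sup>+x. (\<lambda>x. g (- y + x) * h x) (y + x) \<partial>M)"
      by (rule nn_integral_distr_invariant[OF lM measurable_borel(1)[OF tr(1)], symmetric])
        (intro borel_measurable_times_ennreal hx h)
    then show "(\<integral>\<^sup>+x. g x * h (y + x) \<partial>M) = (\<integral>\<^sup>+x. g (- y + x) * h x \<partial>M)"
      by (simp only: minus_add_cancel)
  qed
  also have "\<dots> = (\<integral>\<^sup>+x. (\<integral>\<^sup>+y. g (- y + x) * h x \<partial>L) \<partial>M)"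
    using Fubini[OF m2] by (simp only: fst_conv snd_conv)
  also have "\<dots> = (\<integral>\<^sup>+x. (\<integral>\<^sup>+y. g (- y) \<partial>L) * h x \<partial>M)"
  proof (rule nn_integral_cong)
    fix x
    have "(\<integral>\<^sup>+y. g (- y + x) \<partial>L) = (\<integral>\<^sup>+y. (\<lambda>y. g (- y + x)) (x + y) \<partial>L)"
      by (rule nn_integral_distr_invariant[OF lL measurable_borel(2)[OF tr(1)] hx(2), symmetric])
    also have "\<dots> = (\<integral>\<^sup>+y. g (- y) \<partial>L)"
      by (simp add: minus_add add.assoc del: add_uminus_conv_diff)
    finally show "(\<integral>\<^sup>+y. g (- y + x) * h x \<partial>L) = (\<integral>\<^sup>+y. g (- y) \<partial>L) * h x"
      using nn_integral_multc[OF meas(2)[OF hx(2)], of x "h x"] by simp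
  qed
  also have "\<dots> = (\<integral>\<^sup>+x. h x \<partial>M) * (\<integral>\<^sup>+y. g (- y) \<partial>L)"
    by (subst nn_integral_cmult[OF meas(1)[OF h]]) (rule mult.commute)
  finally show ?thesis .
qed

text \<open>The change of variables formula concerns sets of finite measure. It is an equivalence,
  so \<open>X\<close> and its preimage have finite measure together; otherwise both sides are
  infinite as \<open>c > 0\<close>.\<close>

lemma emeasure_lborel_constant_jacobian:
  fixes T :: "real^'n::{finite,wellorder} \<Rightarrow> real^'n::_"
  assumes bij: "bij T" and der: "\<And>x. (T has_derivative T' x) (at x)"
    and det: "\<And>x. \<bar>det (matrix (T' x))\<bar> = c" and c: "c > 0"
    and X: "X \<in> sets borel"
  shows "emeasure lborel X = ennreal c * emeasure lborel (T -` X)"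
proof -
  have "continuous_on UNIV T"
    using der by (meson continuous_at_imp_continuous_on has_derivative_continuous)
  then have mT: "T \<in> borel_measurable borel" by (rule borel_measurable_continuous_onI)
  let ?S = "T -` X"
  have S: "?S \<in> sets borel" using measurable_sets[OF mT X] by simp
  have im: "T ` ?S = X" using bij by (simp add: bij_is_surj surj_image_vimage_eq)
  have iff: "X \<in> lmeasurable \<and> measure lebesgue X = m \<longleftrightarrow> ?S \<in> lmeasurable \<and> measure lebesgue ?S = m / c" for m
  proof -
    have "X \<in> lmeasurable \<and> measure lebesgue X = m \<longleftrightarrow> ((\<lambda>x. \<bar>det (matrix (T' x))\<bar>) has_integral m) ?S"
      using has_measure_differentiable_image[of ?S T T' m] S der bij im
      by (auto intro: has_derivative_at_withinI inj_on_subset[of T UNIV] simp: bij_def)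
    also have "\<dots> \<longleftrightarrow> ((\<lambda>x. c *\<^sub>R 1) has_integral c *\<^sub>R (m / c)) ?S"
      using c by (simp add: det)
    also have "\<dots> \<longleftrightarrow> ((\<lambda>x. 1::real) has_integral m / c) ?S"
      using c by (intro has_integral_cmul_iff) simp
    also have "\<dots> \<longleftrightarrow> ?S \<in> lmeasurable \<and> measure lebesgue ?S = m / c"
      by (auto simp: has_integral_iff lmeasurable_iff_integrable_on lmeasure_integral)
    finally show ?thesis .
  qed
  have XS: "X \<in> sets lebesgue" "?S \<in> sets lebesgue" using X S by auto
  show ?thesis
  proof (cases "X \<in> lmeasurable")
    case True
    then have "?S \<in> lmeasurable" "measure lebesgue ?S = measure lebesgue X / c"
      using iff[of "measure lebesgue X"] by auto
    moreover have "emeasure lborel Y = ennreal (measure lebesgue Y)" if "Y \<in> lmeasurable" "Y \<in> sets borel" for Y :: "(real^'n::{finite,wellorder}) set"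
      using emeasure_eq_measure2[OF that(1)] that(2) by simp
    ultimately show ?thesis using True X S c by (simp add: ennreal_mult'[symmetric])
  next
    case False
    have "?S \<notin> lmeasurable"
      using iff[of "c * measure lebesgue ?S"] c False by auto
    then have "emeasure lborel ?S = \<infinity>" "emeasure lborel X = \<infinity>"
      using False XS X S by (auto simp: fmeasurable_def top.not_eq_extremum[symmetric])
    then show ?thesis using c by (simp add: ennreal_mult_top)
  qed
qed

section \<open>The scaling argument for Hardy's inequality\<close>

text \<open>The geometry enters through the scaling law alone; \<open>Z\<close> is to be the Euler
  derivative of \<open>f\<close>. The difference quotients for \<open>1 < l \<le> 2\<close> vanish
  off \<open>K\<close>, and \<open>N \<ge> c\<close> on \<open>K\<close>, so a multiple of the
  indicator of \<open>K\<close> dominates them and the integral can be differentiated.\<close>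

lemma hardy_scaling:
  fixes M :: "'x measure" and \<delta> :: "real \<Rightarrow> 'x \<Rightarrow> 'x" and f Z :: "'x \<Rightarrow> complex" and N :: "'x \<Rightarrow> real"
  assumes Q: "Q > 2"
    and scaling: "\<And>g l. l > 0 \<Longrightarrow> g \<in> borel_measurable M \<Longrightarrow>
        (\<integral>\<^sup>+x. g (\<delta> l x) \<partial>M) = ennreal (l powr (- Q)) * (\<integral>\<^sup>+x. g x \<partial>M)"
    and \<delta>1: "\<And>x. \<delta> 1 x = x"
    and m\<delta>: "\<And>l. l > 0 \<Longrightarrow> \<delta> l \<in> measurable M M"
    and mN: "N \<in> borel_measurable M" and N: "\<And>x. N x \<ge> 0" "\<And>l x. l > 0 \<Longrightarrow> N (\<delta> l x) = l * N x"
    and mf: "f \<in> borel_measurable M" and mZ: "Z \<in> borel_measurable M"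
    and der: "\<And>l x. l > 0 \<Longrightarrow> ((\<lambda>l. f (\<delta> l x)) has_vector_derivative Z (\<delta> l x) /\<^sub>R l) (at l)"
    and B: "\<And>x. cmod (f x) \<le> B" "\<And>x. cmod (Z x) \<le> B"
    and K: "K \<in> sets M" "emeasure M K < \<infinity>" and c: "c > 0" "\<And>x. x \<in> K \<Longrightarrow> N x \<ge> c"
    and supp: "\<And>l x. l \<in> {1..2} \<Longrightarrow> x \<notin> K \<Longrightarrow> f (\<delta> l x) = 0 \<and> Z (\<delta> l x) = 0"
  shows "(LINT x|M. (cmod (f x))\<^sup>2 / (N x)\<^sup>2) \<le> (2 / (Q - 2))\<^sup>2 * (LINT x|M. (cmod (Z x))\<^sup>2 / (N x)\<^sup>2)"
proof -
  define I where "I = (LINT x|M. (cmod (f x))\<^sup>2 / (N x)\<^sup>2)"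
  define J where "J = (LINT x|M. (cmod (Z x))\<^sup>2 / (N x)\<^sup>2)"
  define w where "w l x = (cmod (f (\<delta> l x)))\<^sup>2 / (N x)\<^sup>2" for l x
  define w' where "w' l x = 2 * (f (\<delta> l x) \<bullet> Z (\<delta> l x)) / l / (N x)\<^sup>2" for l x
  have B0: "B \<ge> 0" using B(1) norm_ge_zero order_trans by blast
  have meas [measurable]: "w l \<in> borel_measurable M" "w' l \<in> borel_measurable M" if "l > 0" for l
  proof -
    have [measurable]: "\<delta> l \<in> measurable M M" using m\<delta> that .
    note [measurable] = mf mZ mN
    show "w l \<in> borel_measurable M" "w' l \<in> borel_measurable M" unfolding w_def w'_def by measurable
  qed
  note [measurable] = mf mZ mN K(1)
  \<comment> \<open>The weight is taken at \<open>x\<close> and not at \<open>\<delta> l x\<close>,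
    where \<open>N\<close> is \<open>l\<close> times larger; the discrepancy \<open>l^2\<close>
    turns the exponent \<open>- Q\<close> into \<open>2 - Q\<close>.\<close>
  have int_w: "(LINT x|M. w l x) = l powr (2 - Q) * I" if l: "l > 0" for l
  proof -
    let ?g = "\<lambda>x. (cmod (f x))\<^sup>2 / (N x)\<^sup>2"
    have "(\<integral>\<^sup>+x. ennreal (w l x) \<partial>M) = (\<integral>\<^sup>+x. ennreal (l\<^sup>2) * ennreal (?g (\<delta> l x)) \<partial>M)"
      using l N(2)[OF l] by (simp add: w_def ennreal_mult'[symmetric] power_mult_distrib)
    also have "\<dots> = ennreal (l\<^sup>2) * (\<integral>\<^sup>+x. ennreal (?g (\<delta> l x)) \<partial>M)"
      by (intro nn_integral_cmult measurable_compose[OF m\<delta>[OF l]]) measurable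
    also have "\<dots> = ennreal (l\<^sup>2) * (ennreal (l powr (- Q)) * (\<integral>\<^sup>+x. ennreal (?g x) \<partial>M))"
      by (subst scaling[OF l, of "\<lambda>x. ennreal (?g x)"]) simp_all
    also have "\<dots> = ennreal (l powr (2 - Q)) * (\<integral>\<^sup>+x. ennreal (?g x) \<partial>M)"
      using l by (simp add: mult.assoc[symmetric] ennreal_mult'[symmetric] powr_diff powr_minus powr_numeral divide_inverse)
    finally show ?thesis
      unfolding I_def using l
      by (subst (1 2) integral_eq_nn_integral) (auto simp: meas enn2real_mult w_def)
  qed
  have der_w: "((\<lambda>l. w l x) has_real_derivative w' l x) (at l)" if l: "l > 0" for l x
  proof -
    have "((\<lambda>l. f (\<delta> l x) \<bullet> f (\<delta> l x)) has_derivative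
        (\<lambda>h. f (\<delta> l x) \<bullet> (h *\<^sub>R (Z (\<delta> l x) /\<^sub>R l)) + (h *\<^sub>R (Z (\<delta> l x) /\<^sub>R l)) \<bullet> f (\<delta> l x))) (at l)"
      using der[OF l, of x] unfolding has_vector_derivative_def by (intro has_derivative_inner)
    then have "((\<lambda>l. f (\<delta> l x) \<bullet> f (\<delta> l x)) has_real_derivative 2 * (f (\<delta> l x) \<bullet> Z (\<delta> l x)) / l) (at l)"
      by (rule has_derivative_imp_has_field_derivative) (simp add: inner_commute field_simps)
    from DERIV_cdivide[OF this, of "(N x)\<^sup>2"] show ?thesis
      by (simp add: w_def[abs_def] w'_def power2_norm_eq_inner)
  qed
  have w'_bound: "\<bar>w' l x\<bar> \<le> 2 * B\<^sup>2 / c\<^sup>2 * indicator K x" if l: "l \<in> {1..2}" for l x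
  proof (cases "x \<in> K")
    case True
    have "\<bar>f (\<delta> l x) \<bullet> Z (\<delta> l x)\<bar> \<le> cmod (f (\<delta> l x)) * cmod (Z (\<delta> l x))" by (rule Cauchy_Schwarz_ineq2)
    also have "\<dots> \<le> B * B" by (intro mult_mono B B0) auto
    finally have "2 * \<bar>f (\<delta> l x) \<bullet> Z (\<delta> l x)\<bar> \<le> 2 * B\<^sup>2" by (simp add: power2_eq_square)
    moreover have "2 * \<bar>f (\<delta> l x) \<bullet> Z (\<delta> l x)\<bar> / l \<le> 2 * \<bar>f (\<delta> l x) \<bullet> Z (\<delta> l x)\<bar> / 1"
      using l by (intro divide_left_mono) auto
    ultimately have *: "2 * \<bar>f (\<delta> l x) \<bullet> Z (\<delta> l x)\<bar> / l \<le> 2 * B\<^sup>2" by simp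
    have "c\<^sup>2 \<le> (N x)\<^sup>2" using c True by (intro power_mono) auto
    then have "2 * \<bar>f (\<delta> l x) \<bullet> Z (\<delta> l x)\<bar> / l / (N x)\<^sup>2 \<le> 2 * B\<^sup>2 / c\<^sup>2"
      using * c(1) l by (intro frac_le) auto
    then show ?thesis using True l by (simp add: w'_def abs_mult)
  next
    case False
    then show ?thesis using supp[OF l] by (simp add: w'_def)
  qed
  have quot: "\<bar>(w l x - w 1 x) / (l - 1)\<bar> \<le> 2 * B\<^sup>2 / c\<^sup>2 * indicator K x" if l: "1 < l" "l \<le> 2" for l x
  proof -
    obtain z where z: "1 < z" "z < l" "w l x - w 1 x = (l - 1) * w' z x"
      using MVT2[of 1 l "\<lambda>l. w l x" "\<lambda>l. w' l x"] l der_w by fastforce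
    then show ?thesis using w'_bound[of z x] l by simp
  qed
  \<comment> \<open>Dominated convergence is applied along a sequence that approaches 1 from the
    right and stays within \<open>{1..2}\<close>, where the bounds hold; this determines both
    derivatives at 1.\<close>
  define s where "s n = 1 + 1 / real (Suc n)" for n
  have s: "1 < s n" "s n \<le> 2" for n by (auto simp: s_def field_simps)
  have s_lim: "filterlim s (at 1) sequentially"
    unfolding filterlim_at
  proof (intro conjI)
    have "s \<longlonglongrightarrow> 1 + 0" unfolding s_def[abs_def]
      by (intro tendsto_intros LIMSEQ_Suc lim_1_over_n)
    then show "s \<longlonglongrightarrow> 1" by simp
    show "\<forall>\<^sub>F n in sequentially. s n \<in> UNIV \<and> s n \<noteq> 1"
      using s(1) by (auto intro!: always_eventually simp: less_le)
  qed
  have dom_int: "integrable M (\<lambda>x. 2 * B\<^sup>2 / c\<^sup>2 * indicator K x)"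
    using K by (intro integrable_mult_right integrable_real_indicator) auto
  have lim_w: "(\<lambda>n. (w (s n) x - w 1 x) / (s n - 1)) \<longlonglongrightarrow> w' 1 x" for x
    using filterlim_compose[OF der_w[of 1 x, unfolded has_field_derivative_iff] s_lim] by simp
  have dominated: "integrable M g"
    if "g \<in> borel_measurable M" "\<And>x. x \<in> K \<Longrightarrow> \<bar>g x\<bar> \<le> 2 * B\<^sup>2 / c\<^sup>2" "\<And>x. x \<notin> K \<Longrightarrow> g x = 0" for g :: "'x \<Rightarrow> real"
  proof (rule Bochner_Integration.integrable_bound[OF dom_int that(1)], intro AE_I2)
    show "norm (g x) \<le> norm (2 * B\<^sup>2 / c\<^sup>2 * indicator K x)" for x
      using that(2,3)[of x] by (cases "x \<in> K") auto
  qed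
  have quot_bound: "r\<^sup>2 / (N x)\<^sup>2 \<le> 2 * B\<^sup>2 / c\<^sup>2" if "x \<in> K" "0 \<le> r" "r \<le> B" for r x
  proof -
    have "r\<^sup>2 / (N x)\<^sup>2 \<le> B\<^sup>2 / c\<^sup>2" using that c by (intro frac_le power_mono) auto
    also have "\<dots> \<le> 2 * B\<^sup>2 / c\<^sup>2" by (intro divide_right_mono) auto
    finally show ?thesis .
  qed
  have int_w1: "integrable M (w l)" if l: "l \<in> {1..2}" for l
    using l supp[OF l] B quot_bound by (intro dominated meas) (auto simp: w_def)
  have lim1: "(\<lambda>n. LINT x|M. (w (s n) x - w 1 x) / (s n - 1)) \<longlonglongrightarrow> (LINT x|M. w' 1 x)"
  proof (rule integral_dominated_convergence[OF _ _ dom_int])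
    show "(\<lambda>x. (w (s n) x - w 1 x) / (s n - 1)) \<in> borel_measurable M" for n
      using meas(1)[of "s n"] meas(1)[of 1] s(1)[of n] by auto
    show "AE x in M. (\<lambda>n. (w (s n) x - w 1 x) / (s n - 1)) \<longlonglongrightarrow> w' 1 x" using lim_w by simp
    show "AE x in M. norm ((w (s n) x - w 1 x) / (s n - 1)) \<le> 2 * B\<^sup>2 / c\<^sup>2 * indicator K x" for n
      using quot[OF s] by simp
  qed (use meas in auto)
  have quot_eq: "(LINT x|M. (w (s n) x - w 1 x) / (s n - 1)) = ((s n) powr (2 - Q) - 1 powr (2 - Q)) / (s n - 1) * I" for n
  proof -
    have "(LINT x|M. (w (s n) x - w 1 x) / (s n - 1)) = ((LINT x|M. w (s n) x) - (LINT x|M. w 1 x)) / (s n - 1)"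
      using s[of n] by (simp add: int_w1 less_imp_le)
    also have "\<dots> = ((s n) powr (2 - Q) - 1 powr (2 - Q)) / (s n - 1) * I"
      using s[of n] by (simp add: int_w algebra_simps)
    finally show ?thesis .
  qed
  have lim2: "(\<lambda>n. ((s n) powr (2 - Q) - 1 powr (2 - Q)) / (s n - 1) * I) \<longlonglongrightarrow> (2 - Q) * I"
  proof -
    have "((\<lambda>l::real. l powr (2 - Q)) has_real_derivative (2 - Q)) (at 1)"
      by (auto intro!: derivative_eq_intros)
    then show ?thesis
      unfolding has_field_derivative_iff by (intro tendsto_intros filterlim_compose[OF _ s_lim])
  qed
  have eq: "(LINT x|M. w' 1 x) = (2 - Q) * I"
    using LIMSEQ_unique[OF lim1[unfolded quot_eq] lim2] .
  \<comment> \<open>With this weight the term \<open>t * I\<close> absorbs exactly half of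
    \<open>(Q - 2) * I\<close>.\<close>
  define t where "t = (Q - 2) / 2"
  have t: "t > 0" using Q by (simp add: t_def)
  have int_Z: "integrable M (\<lambda>x. (cmod (Z x))\<^sup>2 / (N x)\<^sup>2)"
    using supp[of 1] \<delta>1 B quot_bound by (intro dominated) auto
  have w1: "w 1 = (\<lambda>x. (cmod (f x))\<^sup>2 / (N x)\<^sup>2)" by (simp add: w_def fun_eq_iff \<delta>1)
  have int_w': "integrable M (w' 1)"
    by (rule Bochner_Integration.integrable_bound[OF dom_int]) (use w'_bound[of 1] meas in \<open>auto simp: order_trans[OF _ abs_ge_self]\<close>)
  have "(Q - 2) * I = (LINT x|M. - w' 1 x)" using eq by (simp add: algebra_simps)
  also have "\<dots> \<le> (LINT x|M. t * ((cmod (f x))\<^sup>2 / (N x)\<^sup>2) + 1 / t * ((cmod (Z x))\<^sup>2 / (N x)\<^sup>2))"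
  proof (rule integral_mono)
    fix x
    have "- (2 * (f x \<bullet> Z x)) \<le> 2 * (cmod (f x) * cmod (Z x))"
      using Cauchy_Schwarz_ineq2[of "f x" "Z x"] by linarith
    also have "\<dots> \<le> t * (cmod (f x))\<^sup>2 + 1 / t * (cmod (Z x))\<^sup>2"
    proof -
      have "0 \<le> (t * cmod (f x) - cmod (Z x))\<^sup>2 / t" using t by simp
      then show ?thesis using t by (simp add: power2_diff field_simps power2_eq_square)
    qed
    finally have "- (2 * (f x \<bullet> Z x)) / (N x)\<^sup>2 \<le> (t * (cmod (f x))\<^sup>2 + 1 / t * (cmod (Z x))\<^sup>2) / (N x)\<^sup>2"
      by (rule divide_right_mono) simp
    then show "- w' 1 x \<le> t * ((cmod (f x))\<^sup>2 / (N x)\<^sup>2) + 1 / t * ((cmod (Z x))\<^sup>2 / (N x)\<^sup>2)"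
      by (simp add: w'_def \<delta>1 add_divide_distrib)
    show "integrable M (\<lambda>x. t * ((cmod (f x))\<^sup>2 / (N x)\<^sup>2) + 1 / t * ((cmod (Z x))\<^sup>2 / (N x)\<^sup>2))"
      using int_w1[of 1] w1
      by (intro Bochner_Integration.integrable_add integrable_mult_right int_Z) auto
  qed (use int_w' in auto)
  also have "\<dots> = t * I + 1 / t * J"
    unfolding I_def J_def using int_Z int_w1[of 1] w1
    by (subst Bochner_Integration.integral_add) (auto intro!: integrable_mult_right simp del: times_divide_eq_left times_divide_eq_right)
  finally have "(Q - 2) * I - t * I \<le> 1 / t * J" by simp
  moreover have "(Q - 2) * I - t * I = t * I" by (simp add: t_def field_simps)
  ultimately have "t * I \<le> J / t" by simp
  then have "I \<le> J / t\<^sup>2" using t by (simp add: pos_le_divide_eq power2_eq_square mult_ac)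
  also have "\<dots> = (2 / (Q - 2))\<^sup>2 * J" by (simp add: t_def power_divide)
  finally show ?thesis unfolding I_def J_def .
qed

section \<open>An index type for bases\<close>

text \<open>The change of variables theorems of the library are stated for \<open>real^'n\<close> with a well-ordered index type;
  this one has \<open>DIM('a)\<close> elements.\<close>

typedef (overloaded) ('a::euclidean_space) bidx = "Basis :: 'a set" using nonempty_Basis by blast
instance bidx :: (euclidean_space) finite
proof
  have "inj_on Rep_bidx UNIV" by (simp add: inj_on_def Rep_bidx_inject)
  moreover have "Rep_bidx ` (UNIV::'a bidx set) \<subseteq> Basis" using Rep_bidx by blast
  ultimately show "finite (UNIV::'a bidx set)" by (meson finite_Basis finite_imageD finite_subset)
qed
text \<open>An arbitrary injection into the naturals; any choice serves, since the order pulled back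
  along it is a well-order.\<close>

definition bidx_index :: "'a::euclidean_space bidx \<Rightarrow> nat" where
  "bidx_index = (SOME f. inj f)"

lemma inj_bidx_index: "inj (bidx_index :: 'a::euclidean_space bidx \<Rightarrow> nat)"
proof -
  have "\<exists>f :: 'a bidx \<Rightarrow> nat. inj f"
    using finite_imp_inj_to_nat_seg[of "UNIV :: 'a bidx set"] by auto
  then show ?thesis unfolding bidx_index_def by (rule someI_ex)
qed

instantiation bidx :: (euclidean_space) wellorder
begin
definition less_eq_bidx :: "'a bidx \<Rightarrow> 'a bidx \<Rightarrow> bool" where
  "x \<le> y \<longleftrightarrow> bidx_index x \<le> (bidx_index y)"
definition less_bidx :: "'a bidx \<Rightarrow> 'a bidx \<Rightarrow> bool" where
  "x < y \<longleftrightarrow> bidx_index x < (bidx_index y)"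
instance
proof
  fix x y z :: "'a bidx"
  show "x < y \<longleftrightarrow> x \<le> y \<and> \<not> y \<le> x" unfolding less_eq_bidx_def less_bidx_def by auto
  show "x \<le> x" "x \<le> y \<Longrightarrow> y \<le> z \<Longrightarrow> x \<le> z" "x \<le> y \<or> y \<le> x" unfolding less_eq_bidx_def by auto
  show "x \<le> y \<Longrightarrow> y \<le> x \<Longrightarrow> x = y" unfolding less_eq_bidx_def using inj_bidx_index by (auto dest: injD)
  fix P :: "'a bidx \<Rightarrow> bool" and a :: "'a bidx" assume "\<And>x. (\<And>y. y < x \<Longrightarrow> P y) \<Longrightarrow> P x"
  then show "P a" unfolding less_bidx_def by (rule measure_induct_rule)
qed
end
lemma card_bidx: "CARD('a::euclidean_space bidx) = DIM('a)"
  by (metis type_definition.card type_definition_bidx)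

section \<open>Differential calculus\<close>

abbreviation "fderiv f x \<equiv> frechet_derivative f (at x)"

lemma has_real_derivative_along_line:
  fixes f :: "'a::real_normed_vector \<Rightarrow> real"
  assumes "(f has_derivative f') (at (x + s *\<^sub>R a))"
  shows "((\<lambda>s. f (x + s *\<^sub>R a)) has_real_derivative f' a) (at s)"
proof -
  have "((\<lambda>s. f (x + s *\<^sub>R a)) has_derivative (\<lambda>r. f' (r *\<^sub>R a))) (at s)"
    by (rule has_derivative_compose[where f="\<lambda>s. x + s *\<^sub>R a" and g=f, OF _ assms]) (auto intro!: derivative_eq_intros)
  then show ?thesis
    by (rule has_derivative_imp_has_field_derivative)
      (simp add: linear_cmul[OF has_derivative_linear[OF assms]])
qed

text \<open>The mean value theorem is applied twice to the second difference over a parallelogram,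
  along \<open>a\<close> and then along \<open>b\<close>. The second difference itself is symmetric
  in \<open>a\<close> and \<open>b\<close>.\<close>

lemma second_difference_mvt:
  fixes f :: "'a::real_normed_vector \<Rightarrow> real"
  assumes h: "h > 0" and S: "\<And>s t. s \<in> {0..h} \<Longrightarrow> t \<in> {0..h} \<Longrightarrow> x + s *\<^sub>R a + t *\<^sub>R b \<in> S"
    and f: "\<And>y. y \<in> S \<Longrightarrow> (f has_derivative f' y) (at y)"
    and fa: "\<And>y. y \<in> S \<Longrightarrow> ((\<lambda>y. f' y a) has_derivative fa' y) (at y)"
  shows "\<exists>s t. s \<in> {0..h} \<and> t \<in> {0..h} \<and>
    f (x + h *\<^sub>R a + h *\<^sub>R b) - f (x + h *\<^sub>R a) - f (x + h *\<^sub>R b) + f x = h * h * fa' (x + s *\<^sub>R a + t *\<^sub>R b) b"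
proof -
  have d1: "((\<lambda>s. f (x + s *\<^sub>R a + t *\<^sub>R b)) has_real_derivative f' (x + s *\<^sub>R a + t *\<^sub>R b) a) (at s)"
    if "s \<in> {0..h}" "t \<in> {0..h}" for s t
    using has_real_derivative_along_line[of f _ "x + t *\<^sub>R b" s a] f S[OF that] by (simp add: algebra_simps)
  have d2: "((\<lambda>t. f' (x + s *\<^sub>R a + t *\<^sub>R b) a) has_real_derivative fa' (x + s *\<^sub>R a + t *\<^sub>R b) b) (at t)"
    if "s \<in> {0..h}" "t \<in> {0..h}" for s t
    using has_real_derivative_along_line[of "\<lambda>y. f' y a"] fa S[OF that] by simp
  let ?F = "\<lambda>s. f (x + s *\<^sub>R a + h *\<^sub>R b) - f (x + s *\<^sub>R a + 0 *\<^sub>R b)"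
  have "\<exists>s. 0 < s \<and> s < h \<and> ?F h - ?F 0 = (h - 0) * (f' (x + s *\<^sub>R a + h *\<^sub>R b) a - f' (x + s *\<^sub>R a + 0 *\<^sub>R b) a)"
    using h by (intro MVT2 DERIV_diff d1) auto
  then obtain s where s: "0 < s" "s < h" "?F h - ?F 0 = h * (f' (x + s *\<^sub>R a + h *\<^sub>R b) a - f' (x + s *\<^sub>R a + 0 *\<^sub>R b) a)"
    by auto
  have "\<exists>t. 0 < t \<and> t < h \<and> f' (x + s *\<^sub>R a + h *\<^sub>R b) a - f' (x + s *\<^sub>R a + 0 *\<^sub>R b) a
      = (h - 0) * fa' (x + s *\<^sub>R a + t *\<^sub>R b) b"
    using h s(1,2) by (intro MVT2 d2) auto
  then obtain t where t: "0 < t" "t < h" "f' (x + s *\<^sub>R a + h *\<^sub>R b) a - f' (x + s *\<^sub>R a + 0 *\<^sub>R b) a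
      = h * fa' (x + s *\<^sub>R a + t *\<^sub>R b) b" by auto
  show ?thesis
    using s t by (intro exI[of _ s] exI[of _ t]) (auto simp: algebra_simps)
qed

text \<open>The same second difference is \<open>h * h\<close> times a value of either mixed
  derivative, and continuity brings both values close to those at \<open>x\<close>.\<close>

lemma second_derivative_symmetric_real:
  fixes f :: "'a::real_normed_vector \<Rightarrow> real"
  assumes S: "open S" "x \<in> S"
    and f: "\<And>y. y \<in> S \<Longrightarrow> (f has_derivative f' y) (at y)"
    and fa: "\<And>y. y \<in> S \<Longrightarrow> ((\<lambda>y. f' y a) has_derivative fa' y) (at y)"
    and fb: "\<And>y. y \<in> S \<Longrightarrow> ((\<lambda>y. f' y b) has_derivative fb' y) (at y)"
    and ca: "continuous_on S (\<lambda>y. fa' y b)" and cb: "continuous_on S (\<lambda>y. fb' y a)"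
  shows "fa' x b = fb' x a"
proof (rule ccontr)
  assume ne: "fa' x b \<noteq> fb' x a"
  define e where "e = \<bar>fa' x b - fb' x a\<bar> / 2"
  have e: "e > 0" using ne by (simp add: e_def)
  obtain d1 where d1: "d1 > 0" "\<And>y. y \<in> S \<Longrightarrow> dist y x < d1 \<Longrightarrow> dist (fa' y b) (fa' x b) < e"
    using ca S(2) e unfolding continuous_on_iff by meson
  obtain d2 where d2: "d2 > 0" "\<And>y. y \<in> S \<Longrightarrow> dist y x < d2 \<Longrightarrow> dist (fb' y a) (fb' x a) < e"
    using cb S(2) e unfolding continuous_on_iff by meson
  obtain d3 where d3: "d3 > 0" "ball x d3 \<subseteq> S" using S open_contains_ball by blast
  define d where "d = min d1 (min d2 d3)"
  \<comment> \<open>Keeps the parallelogram within \<open>d / 2\<close> of \<open>x\<close>; the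
    summand 1 covers \<open>a = b = 0\<close>.\<close>
  define h where "h = d / (2 * (norm a + norm b + 1))"
  have pos: "norm a + norm b + 1 > 0" by (smt (verit) norm_ge_zero)
  have d: "d > 0" using d1(1) d2(1) d3(1) by (simp add: d_def)
  have h: "h > 0" using d pos by (simp add: h_def)
  have small: "dist (x + s *\<^sub>R a + t *\<^sub>R b) x < d" if "s \<in> {0..h}" "t \<in> {0..h}" for s t
  proof -
    have "dist (x + s *\<^sub>R a + t *\<^sub>R b) x = norm (s *\<^sub>R a + t *\<^sub>R b)"
      by (simp add: dist_norm algebra_simps)
    also have "\<dots> \<le> s * norm a + t * norm b"
      using that norm_triangle_ineq[of "s *\<^sub>R a" "t *\<^sub>R b"] by simp
    also have "\<dots> \<le> h * norm a + h * norm b" using that by (intro add_mono mult_right_mono) auto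
    also have "\<dots> \<le> h * (norm a + norm b + 1)" using h by (simp add: algebra_simps)
    also have "\<dots> = d / 2" using pos by (simp add: h_def field_simps)
    also have "\<dots> < d" using d by simp
    finally show ?thesis .
  qed
  have inS: "x + s *\<^sub>R a + t *\<^sub>R b \<in> S" if "s \<in> {0..h}" "t \<in> {0..h}" for s t
    using small[OF that] d3(2) by (auto simp: d_def dist_commute)
  obtain s t where st: "s \<in> {0..h}" "t \<in> {0..h}"
    "f (x + h *\<^sub>R a + h *\<^sub>R b) - f (x + h *\<^sub>R a) - f (x + h *\<^sub>R b) + f x = h * h * fa' (x + s *\<^sub>R a + t *\<^sub>R b) b"
    using second_difference_mvt[of h x a b S f f' fa', OF h inS f fa] by blast
  have inS': "x + t *\<^sub>R b + s *\<^sub>R a \<in> S" if "t \<in> {0..h}" "s \<in> {0..h}" for s t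
    using inS[OF that(2,1)] by (simp add: algebra_simps)
  obtain t' s' where st': "t' \<in> {0..h}" "s' \<in> {0..h}"
    "f (x + h *\<^sub>R b + h *\<^sub>R a) - f (x + h *\<^sub>R b) - f (x + h *\<^sub>R a) + f x = h * h * fb' (x + t' *\<^sub>R b + s' *\<^sub>R a) a"
    using second_difference_mvt[of h x b a S f f' fb', OF h inS' f fb] by blast
  have "h * h * fa' (x + s *\<^sub>R a + t *\<^sub>R b) b = h * h * fb' (x + s' *\<^sub>R a + t' *\<^sub>R b) a"
    using st(3) st'(3) by (simp add: algebra_simps)
  then have eq: "fa' (x + s *\<^sub>R a + t *\<^sub>R b) b = fb' (x + s' *\<^sub>R a + t' *\<^sub>R b) a"
    using h by simp
  have "dist (fa' (x + s *\<^sub>R a + t *\<^sub>R b) b) (fa' x b) < e"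
    using d1(2)[OF inS[OF st(1,2)]] small[OF st(1,2)] by (simp add: d_def)
  moreover have "dist (fb' (x + s' *\<^sub>R a + t' *\<^sub>R b) a) (fb' x a) < e"
    using d2(2)[OF inS[OF st'(2,1)]] small[OF st'(2,1)] by (simp add: d_def)
  ultimately have "\<bar>fa' x b - fb' x a\<bar> < 2 * e"
    using eq unfolding dist_real_def by linarith
  then show False by (simp add: e_def)
qed

text \<open>Works component by component with the iterated directional derivatives of
  \<open>smooth_on\<close>. It serves to exchange the mixed derivatives of the group law, from which
  the Lie bracket arises.\<close>

lemma second_derivative_symmetric:
  fixes f :: "'a::real_normed_vector \<Rightarrow> 'b::euclidean_space"
  assumes S: "open S" "x \<in> S" and f: "smooth_on S f"
  shows "fderiv (\<lambda>y. fderiv f y a) x b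
       = fderiv (\<lambda>y. fderiv f y b) x a"
proof (rule euclidean_eqI)
  fix i :: 'b assume "i \<in> Basis"
  let ?D = "\<lambda>a y. fderiv f y a"
  have C: "Ck_on (Suc (Suc 0)) S f" using f unfolding smooth_on_def by blast
  have d0: "(f has_derivative fderiv f y) (at y)" if "y \<in> S" for y
    using C that unfolding frechet_derivative_works[symmetric] by simp
  have d1: "(?D a has_derivative fderiv (?D a) y) (at y)" if "y \<in> S" for y a
    using C that unfolding frechet_derivative_works[symmetric] by simp
  have c: "continuous_on S (\<lambda>y. fderiv (?D a) y b)" for a b
    using C by simp
  show "fderiv (?D a) x b \<bullet> i = fderiv (?D b) x a \<bullet> i"
    by (rule second_derivative_symmetric_real[OF S, of "\<lambda>y. f y \<bullet> i" "\<lambda>y v. ?D v y \<bullet> i" a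
          "\<lambda>y v. fderiv (?D a) y v \<bullet> i" b "\<lambda>y v. fderiv (?D b) y v \<bullet> i"])
      (intro has_derivative_inner_left d0 d1 c continuous_intros; assumption)+
qed

lemma smooth_on_D:
  assumes "smooth_on S f" "x \<in> S"
  shows "(f has_derivative fderiv f x) (at x)"
    "((\<lambda>y. fderiv f y v) has_derivative
       fderiv (\<lambda>y. fderiv f y v) x) (at x)"
proof -
  have "Ck_on (Suc (Suc 0)) S f" using assms(1) unfolding smooth_on_def by blast
  then show "(f has_derivative fderiv f x) (at x)"
    "((\<lambda>y. fderiv f y v) has_derivative
       fderiv (\<lambda>y. fderiv f y v) x) (at x)"
    using assms(2) unfolding frechet_derivative_works[symmetric] by simp_all
qed

lemma smooth_on_isCont_derivative:
  assumes "smooth_on S f" "x \<in> S"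
  shows "isCont (\<lambda>y. fderiv f y v) x"
  using smooth_on_D(2)[OF assms] by (rule has_derivative_continuous)

section \<open>Left-trivialised derivatives and the adjoint representation\<close>

context homogeneous_group
begin

section \<open>Charts and differentiability of translations\<close>

abbreviation "chart_inv \<equiv> inv_into U \<phi>"
abbreviation "chart_mult \<equiv> (\<lambda>(p, q). \<phi> (chart_inv p + chart_inv q))"
abbreviation "chart_mult_dom \<equiv> {(p, q). p \<in> \<phi> ` U \<and> q \<in> \<phi> ` U \<and> chart_inv p + chart_inv q \<in> U}"

lemma chart_homeomorphism:
  assumes "(V, \<psi>) \<in> \<A>"
  shows "open V" "open (\<psi> ` V)" "homeomorphism V (\<psi> ` V) \<psi> (inv_into V \<psi>)"
proof -
  note * = lie_group[unfolded lie_group_def smooth_atlas_def, THEN conjunct1, THEN conjunct2, THEN conjunct1]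
  from bspec[OF * assms]
  show "open V" "open (\<psi> ` V)" "homeomorphism V (\<psi> ` V) \<psi> (inv_into V \<psi>)" by simp_all
qed

lemma chart_inv_apply:
  assumes "(V, \<psi>) \<in> \<A>" "x \<in> V"
  shows "inv_into V \<psi> (\<psi> x) = x"
  by (rule homeomorphism_apply1[OF chart_homeomorphism(3)[OF assms(1)] assms(2)])

lemma chart_inv_continuous: "(V, \<psi>) \<in> \<A> \<Longrightarrow> continuous_on (\<psi> ` V) (inv_into V \<psi>)"
  by (rule homeomorphism_cont2[OF chart_homeomorphism(3)])

lemma chart_continuous: "(V, \<psi>) \<in> \<A> \<Longrightarrow> continuous_on V \<psi>"
  by (rule homeomorphism_cont1[OF chart_homeomorphism(3)])

lemma chart_at:
  obtains V \<psi> where "(V, \<psi>) \<in> \<A>" "x \<in> V"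
proof -
  have "(\<Union>(U, \<phi>)\<in>\<A>. U) = UNIV"
    using lie_group unfolding lie_group_def smooth_atlas_def by (elim conjE)
  then have "x \<in> (\<Union>(U, \<phi>)\<in>\<A>. U)" by simp
  then show thesis using that by auto
qed

lemma open_U: "open U" and open_chart_image: "open (\<phi> ` U)"
  by (rule chart_homeomorphism[OF unit_chart(1)])+

lemma chart_inv_\<phi>[simp]: "x \<in> U \<Longrightarrow> chart_inv (\<phi> x) = x"
  by (rule chart_inv_apply[OF unit_chart(1)])

lemma \<phi>_chart_inv: "p \<in> \<phi> ` U \<Longrightarrow> \<phi> (chart_inv p) = p"
  by (rule f_inv_into_f)

lemma chart_inv_in: "p \<in> \<phi> ` U \<Longrightarrow> chart_inv p \<in> U"
  by (rule inv_into_into)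

lemma chart_inv_0[simp]: "chart_inv (\<phi> 0) = 0"
  using unit_chart by simp

lemma mult_smooth:
  assumes "(V, \<psi>) \<in> \<A>" "(V', \<psi>') \<in> \<A>" "(W, \<omega>) \<in> \<A>"
  shows "smooth_on {(p, q). p \<in> \<psi> ` V \<and> q \<in> \<psi>' ` V' \<and> inv_into V \<psi> p + inv_into V' \<psi>' q \<in> W}
          (\<lambda>(p, q). \<omega> (inv_into V \<psi> p + inv_into V' \<psi>' q))"
proof -
  note * = lie_group[unfolded lie_group_def, THEN conjunct2, THEN conjunct1]
  note * = bspec[OF * assms(1), unfolded prod.case]
  note * = bspec[OF * assms(2), unfolded prod.case]
  from bspec[OF * assms(3), unfolded prod.case] show ?thesis .
qed

lemma mult_differentiable:
  assumes "(V, \<psi>) \<in> \<A>" "(V', \<psi>') \<in> \<A>" "(W, \<omega>) \<in> \<A>" "x \<in> V" "y \<in> V'" "x + y \<in> W"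
  shows "(\<lambda>(p, q). \<omega> (inv_into V \<psi> p + inv_into V' \<psi>' q)) differentiable at (\<psi> x, \<psi>' y)"
  using smooth_on_D(1)[OF mult_smooth[OF assms(1-3)], of "(\<psi> x, \<psi>' y)"] assms
  by (auto simp: chart_inv_apply differentiable_def)

lemma chart_mult_smooth: "smooth_on chart_mult_dom chart_mult"
  by (rule mult_smooth) (rule unit_chart)+

lemma open_chart_preimage:
  assumes "(V, \<psi>) \<in> \<A>" "open W" "continuous_on UNIV F"
  shows "open {p \<in> \<psi> ` V. F (inv_into V \<psi> p) \<in> W}"
proof -
  have "continuous_on (\<psi> ` V) (\<lambda>p. F (inv_into V \<psi> p))"
    using continuous_on_compose2[OF assms(3) chart_inv_continuous[OF assms(1)]] by simp
  then have "open (\<psi> ` V \<inter> (\<lambda>p. F (inv_into V \<psi> p)) -` W)"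
    using continuous_on_open_vimage[OF chart_homeomorphism(2)[OF assms(1)]] assms(2)
    by (metis Int_commute)
  moreover have "{p \<in> \<psi> ` V. F (inv_into V \<psi> p) \<in> W} = \<psi> ` V \<inter> (\<lambda>p. F (inv_into V \<psi> p)) -` W" by blast
  ultimately show ?thesis by (simp only:)
qed

lemma open_chart_minus: "open {p \<in> \<phi> ` U. - chart_inv p \<in> U}"
  using open_chart_preimage[OF unit_chart(1) open_U, of uminus] continuous_on_minus[OF continuous_on_id[of UNIV]]
  by simp

lemma right_translation_differentiable:
  assumes "(V, \<psi>) \<in> \<A>" "(W, \<omega>) \<in> \<A>" "x \<in> V" "x + y \<in> W"
  shows "(\<lambda>p. \<omega> (inv_into V \<psi> p + y)) differentiable at (\<psi> x)"
proof -
  obtain V' \<psi>' where V': "(V', \<psi>') \<in> \<A>" "y \<in> V'" by (rule chart_at)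
  have "(\<lambda>p. (p, \<psi>' y)) differentiable at (\<psi> x)" by (auto intro!: derivative_eq_intros simp: differentiable_def)
  then have "(\<lambda>(p, q). \<omega> (inv_into V \<psi> p + inv_into V' \<psi>' q)) \<circ> (\<lambda>p. (p, \<psi>' y)) differentiable at (\<psi> x)"
    by (rule differentiable_chain_at) (rule mult_differentiable[OF assms(1) V'(1) assms(2,3) V'(2) assms(4)])
  then show ?thesis using V' by (simp add: comp_def chart_inv_apply)
qed

lemma left_translation_differentiable:
  assumes "(V, \<psi>) \<in> \<A>" "(W, \<omega>) \<in> \<A>" "y \<in> V" "x + y \<in> W"
  shows "(\<lambda>p. \<omega> (x + inv_into V \<psi> p)) differentiable at (\<psi> y)"
proof -
  obtain V' \<psi>' where V': "(V', \<psi>') \<in> \<A>" "x \<in> V'" by (rule chart_at)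
  have "(\<lambda>p. (\<psi>' x, p)) differentiable at (\<psi> y)" by (auto intro!: derivative_eq_intros simp: differentiable_def)
  then have "(\<lambda>(p, q). \<omega> (inv_into V' \<psi>' p + inv_into V \<psi> q)) \<circ> (\<lambda>p. (\<psi>' x, p)) differentiable at (\<psi> y)"
    by (rule differentiable_chain_at) (rule mult_differentiable[OF V'(1) assms(1,2) V'(2) assms(3,4)])
  then show ?thesis using V' by (simp add: comp_def chart_inv_apply)
qed

section \<open>Conjugation, multiplication and inversion to first order at the unit\<close>

definition Ad :: "'g \<Rightarrow> 'a \<Rightarrow> 'a" where
  "Ad x = fderiv (\<lambda>q. \<phi> (x + chart_inv q - x)) (\<phi> 0)"

text \<open>The intermediate point \<open>x + chart_inv q\<close> need not lie in \<open>U\<close>.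
  The map is therefore factored through a chart \<open>\<psi>\<close> at \<open>x\<close>: a left
  translation into it, then a right translation back towards the unit.\<close>

lemma conj_has_derivative: "((\<lambda>q. \<phi> (x + chart_inv q - x)) has_derivative Ad x) (at (\<phi> 0))"
proof -
  obtain V \<psi> where V: "(V, \<psi>) \<in> \<A>" "x \<in> V" by (rule chart_at)
  have "(\<lambda>q. \<psi> (x + chart_inv q)) differentiable at (\<phi> 0)"
    using V unit_chart by (intro left_translation_differentiable) auto
  moreover have "(\<lambda>r. \<phi> (inv_into V \<psi> r + - x)) differentiable at (\<psi> (x + chart_inv (\<phi> 0)))"
    using right_translation_differentiable[OF V(1) unit_chart(1) V(2), of "- x"] unit_chart by simp
  ultimately have "(\<lambda>r. \<phi> (inv_into V \<psi> r + - x)) \<circ> (\<lambda>q. \<psi> (x + chart_inv q)) differentiable at (\<phi> 0)"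
    by (rule differentiable_chain_at)
  then obtain D where D: "((\<lambda>r. \<phi> (inv_into V \<psi> r + - x)) \<circ> (\<lambda>q. \<psi> (x + chart_inv q)) has_derivative D) (at (\<phi> 0))"
    unfolding differentiable_def by blast
  have "((\<lambda>q. \<phi> (x + chart_inv q - x)) has_derivative D) (at (\<phi> 0))"
  proof (rule has_derivative_transform_within_open[OF D])
    show "open {q \<in> \<phi> ` U. x + chart_inv q \<in> V}"
      by (intro open_chart_preimage unit_chart chart_homeomorphism(1)[OF V(1)] continuous_intros)
    show "\<phi> 0 \<in> {q \<in> \<phi> ` U. x + chart_inv q \<in> V}" using V unit_chart by simp
    show "((\<lambda>r. \<phi> (inv_into V \<psi> r + - x)) \<circ> (\<lambda>q. \<psi> (x + chart_inv q))) q = \<phi> (x + chart_inv q - x)"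
      if "q \<in> {q \<in> \<phi> ` U. x + chart_inv q \<in> V}" for q
      using that V by (simp add: chart_inv_apply)
  qed
  then have "(\<lambda>q. \<phi> (x + chart_inv q - x)) differentiable at (\<phi> 0)"
    unfolding differentiable_def by blast
  then show ?thesis unfolding Ad_def by (simp add: frechet_derivative_works)
qed

lemma linear_Ad: "linear (Ad x)"
  using conj_has_derivative by (rule has_derivative_linear)

lemma chart_mult_derivative_left:
  assumes "p \<in> \<phi> ` U"
  shows "fderiv chart_mult (p, \<phi> 0) (v, 0) = v"
proof -
  have "(p, \<phi> 0) \<in> chart_mult_dom" using assms unit_chart by (auto simp: chart_inv_in)
  from smooth_on_D(1)[OF chart_mult_smooth this]
  have "((\<lambda>p. chart_mult (p, \<phi> 0)) has_derivative (\<lambda>v. fderiv chart_mult (p, \<phi> 0) (v, 0))) (at p)"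
    by (intro has_derivative_compose[where f="\<lambda>p. (p, \<phi> 0)" and g=chart_mult]) (auto intro!: derivative_eq_intros)
  moreover have "((\<lambda>p. chart_mult (p, \<phi> 0)) has_derivative (\<lambda>v. v)) (at p)"
    by (rule has_derivative_transform_within_open[OF has_derivative_ident open_chart_image assms]) (simp add: \<phi>_chart_inv)
  ultimately show ?thesis using has_derivative_unique by metis
qed

lemma chart_mult_derivative_right:
  assumes "p \<in> \<phi> ` U"
  shows "((\<lambda>q. \<phi> (chart_inv p + chart_inv q)) has_derivative (\<lambda>v. left_field U \<phi> v p)) (at (\<phi> 0))"
    and "left_field U \<phi> v p = fderiv chart_mult (p, \<phi> 0) (0, v)"
proof -
  have "(p, \<phi> 0) \<in> chart_mult_dom" using assms unit_chart by (auto simp: chart_inv_in)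
  from smooth_on_D(1)[OF chart_mult_smooth this]
  have *: "((\<lambda>q. chart_mult (p, q)) has_derivative (\<lambda>v. fderiv chart_mult (p, \<phi> 0) (0, v))) (at (\<phi> 0))"
    by (intro has_derivative_compose[where f="\<lambda>q. (p, q)" and g=chart_mult]) (auto intro!: derivative_eq_intros)
  then have eq: "(\<lambda>v. left_field U \<phi> v p) = (\<lambda>v. fderiv chart_mult (p, \<phi> 0) (0, v))"
    unfolding left_field_def using frechet_derivative_at by fastforce
  show "((\<lambda>q. \<phi> (chart_inv p + chart_inv q)) has_derivative (\<lambda>v. left_field U \<phi> v p)) (at (\<phi> 0))"
    using * eq by simp
  show "left_field U \<phi> v p = fderiv chart_mult (p, \<phi> 0) (0, v)"
    using fun_cong[OF eq] .
qed

lemma left_field_unit: "left_field U \<phi> v (\<phi> 0) = v"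
proof -
  have "((\<lambda>q. \<phi> (chart_inv (\<phi> 0) + chart_inv q)) has_derivative (\<lambda>v. v)) (at (\<phi> 0))"
    by (rule has_derivative_transform_within_open[OF has_derivative_ident open_chart_image])
      (use unit_chart in \<open>auto simp: \<phi>_chart_inv\<close>)
  from has_derivative_unique[OF this chart_mult_derivative_right(1)] show ?thesis
    using unit_chart by (metis imageI)
qed

lemma chart_mult_derivative_unit:
  "(chart_mult has_derivative (\<lambda>(u, v). u + v)) (at (\<phi> 0, \<phi> 0))"
proof -
  have mem: "(\<phi> 0, \<phi> 0) \<in> chart_mult_dom" using unit_chart by auto
  note d = smooth_on_D(1)[OF chart_mult_smooth mem]
  have p: "\<phi> 0 \<in> \<phi> ` U" using unit_chart by auto
  have "fderiv chart_mult (\<phi> 0, \<phi> 0) (u, v) = u + v" for u v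
  proof -
    have "fderiv chart_mult (\<phi> 0, \<phi> 0) ((u, 0) + (0, v)) = u + v"
      unfolding linear_add[OF has_derivative_linear[OF d]]
      using chart_mult_derivative_left[OF p] chart_mult_derivative_right(2)[OF p] left_field_unit by metis
    then show ?thesis by simp
  qed
  then have "fderiv chart_mult (\<phi> 0, \<phi> 0) = (\<lambda>(u, v). u + v)" by auto
  then show ?thesis using d by simp
qed

text \<open>Obtained by differentiating \<open>x + - x = 0\<close>, with the derivative of the
  product at the unit already known.\<close>

lemma neg_has_derivative: "((\<lambda>q. \<phi> (- chart_inv q)) has_derivative (\<lambda>v. - v)) (at (\<phi> 0))"
proof -
  let ?S = "{p. p \<in> \<phi> ` U \<and> - chart_inv p \<in> U}"
  have p: "\<phi> 0 \<in> ?S" using unit_chart by auto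
  have "smooth_on ?S (\<lambda>p. \<phi> (- chart_inv p))"
  proof -
    note * = lie_group[unfolded lie_group_def, THEN conjunct2, THEN conjunct2]
    note * = bspec[OF * unit_chart(1), unfolded prod.case]
    from bspec[OF * unit_chart(1), unfolded prod.case] show ?thesis .
  qed
  from smooth_on_D(1)[OF this p] obtain D where D: "((\<lambda>q. \<phi> (- chart_inv q)) has_derivative D) (at (\<phi> 0))" by blast
  have "((\<lambda>q. chart_mult (q, \<phi> (- chart_inv q))) has_derivative (\<lambda>v. (\<lambda>(u, v). u + v) (v, D v))) (at (\<phi> 0))"
    by (rule has_derivative_compose[where f="\<lambda>q. (q, \<phi> (- chart_inv q))" and g=chart_mult])
      (use D chart_mult_derivative_unit in \<open>auto intro!: has_derivative_Pair\<close>)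
  from this have "((\<lambda>q. chart_mult (q, \<phi> (- chart_inv q))) has_derivative (\<lambda>v. v + D v)) (at (\<phi> 0))"
    by simp
  moreover have "((\<lambda>q. chart_mult (q, \<phi> (- chart_inv q))) has_derivative (\<lambda>v. 0)) (at (\<phi> 0))"
  proof (rule has_derivative_transform_within_open[OF has_derivative_const _ p])
    show "open ?S" by (rule open_chart_minus)
  qed simp
  ultimately have "(\<lambda>v. v + D v) = (\<lambda>v. 0)" by (rule has_derivative_unique)
  then have "D v = - v" for v using fun_cong[of _ _ v] by (metis add_eq_0_iff)
  then have "D = (\<lambda>v. - v)" by auto
  then show ?thesis using D by simp
qed

text \<open>The logarithmic derivative of \<open>c\<close>, i.e. the pull-back of the left Maurer-Cartan form. Continuity of \<open>c\<close>
  has to be required separately because \<open>\<phi>\<close> is arbitrary outside \<open>U\<close>.\<close>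

definition has_log_deriv :: "('x::real_normed_vector \<Rightarrow> 'g) \<Rightarrow> ('x \<Rightarrow> 'a) \<Rightarrow> 'x \<Rightarrow> bool" where
  "has_log_deriv c L t \<longleftrightarrow>
     (c \<longlongrightarrow> c t) (at t) \<and> ((\<lambda>s. \<phi> (- c t + c s)) has_derivative L) (at t)"

lemma has_log_deriv_near:
  assumes "has_log_deriv c L t"
  shows "\<forall>\<^sub>F s in at t. - c t + c s \<in> U"
proof -
  have "((\<lambda>s. - c t + c s) \<longlongrightarrow> - c t + c t) (at t)"
    using assms unfolding has_log_deriv_def by (intro tendsto_intros) auto
  then show ?thesis using topological_tendstoD[OF _ open_U] unit_chart by fastforce
qed

text \<open>\<open>c s\<close> is \<open>c t\<close> plus its left increment, whose chart image is
  differentiable. So \<open>F\<close> is differentiated only after left translation to the unit, and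
  no chart at \<open>c t\<close> enters.\<close>

lemma has_log_deriv_compose:
  assumes c: "has_log_deriv c L t" and F: "((\<lambda>q. F (c t + chart_inv q)) has_derivative D) (at (\<phi> 0))"
  shows "((\<lambda>s. F (c s)) has_derivative (\<lambda>h. D (L h))) (at t)"
proof -
  have "((\<lambda>s. F (c t + chart_inv (\<phi> (- c t + c s)))) has_derivative (\<lambda>h. D (L h))) (at t)"
    by (rule has_derivative_compose[where f="\<lambda>s. \<phi> (- c t + c s)" and g="\<lambda>q. F (c t + chart_inv q)"])
      (use c F in \<open>auto simp: has_log_deriv_def\<close>)
  then show ?thesis
  proof (rule has_derivative_transform_eventually)
    show "\<forall>\<^sub>F s in at t. F (c t + chart_inv (\<phi> (- c t + c s))) = F (c s)"
      using has_log_deriv_near[OF c] by eventually_elim (simp add: add.assoc[symmetric])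
  qed (use unit_chart in auto)
qed

lemma has_log_deriv_chain:
  assumes c: "has_log_deriv c L (g t)" and g: "(g has_derivative g') (at t)"
  shows "has_log_deriv (\<lambda>s. c (g s)) (\<lambda>h. L (g' h)) t"
proof -
  have "isCont c (g t)" using c by (simp add: has_log_deriv_def isCont_def)
  moreover have "isCont g t" using g by (rule has_derivative_continuous)
  ultimately have "isCont (\<lambda>s. c (g s)) t" by (rule isCont_o2[rotated])
  moreover have "((\<lambda>s. \<phi> (- c (g t) + c (g s))) has_derivative (\<lambda>h. L (g' h))) (at t)"
    by (rule has_derivative_compose[OF g, where g="\<lambda>s. \<phi> (- c (g t) + c s)"])
      (use c in \<open>auto simp: has_log_deriv_def\<close>)
  ultimately show ?thesis by (simp add: has_log_deriv_def isCont_def)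
qed

text \<open>The left increment of the sum is the increment of \<open>c\<close>, conjugated by
  \<open>- d t\<close>, followed by the increment of \<open>d\<close>; near the unit the product is
  addition to first order.\<close>

lemma has_log_deriv_add:
  assumes c: "has_log_deriv c L t" and d: "has_log_deriv d K t"
  shows "has_log_deriv (\<lambda>s. c s + d s) (\<lambda>h. Ad (- d t) (L h) + K h) t"
proof -
  let ?y = "\<lambda>s. - d t + (- c t + c s) - (- d t)"
  let ?z = "\<lambda>s. - d t + d s"
  have lim: "(c \<longlongrightarrow> c t) (at t)" "(d \<longlongrightarrow> d t) (at t)" using c d by (auto simp: has_log_deriv_def)
  have y: "((\<lambda>s. \<phi> (?y s)) has_derivative (\<lambda>h. Ad (- d t) (L h))) (at t)"
    by (rule has_log_deriv_compose[OF c, where F="\<lambda>x. \<phi> (- d t + (- c t + x) - (- d t))"])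
      (use conj_has_derivative[of "- d t"] in simp)
  have z: "((\<lambda>s. \<phi> (?z s)) has_derivative K) (at t)" using d by (auto simp: has_log_deriv_def)
  have "((\<lambda>s. chart_mult (\<phi> (?y s), \<phi> (?z s))) has_derivative (\<lambda>h. (\<lambda>(u, v). u + v) (Ad (- d t) (L h), K h))) (at t)"
    by (rule has_derivative_compose[where f="\<lambda>s. (\<phi> (?y s), \<phi> (?z s))" and g=chart_mult])
      (use y z chart_mult_derivative_unit in \<open>auto intro!: has_derivative_Pair\<close>)
  then have "((\<lambda>s. \<phi> (- (c t + d t) + (c s + d s))) has_derivative (\<lambda>h. Ad (- d t) (L h) + K h)) (at t)"
    unfolding prod.case
  proof (rule has_derivative_transform_eventually)
    have "(?y \<longlongrightarrow> - d t + (- c t + c t) - (- d t)) (at t)" by (intro tendsto_intros lim)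
    then have "\<forall>\<^sub>F s in at t. ?y s \<in> U" using topological_tendstoD[OF _ open_U] unit_chart by fastforce
    with has_log_deriv_near[OF d]
    show "\<forall>\<^sub>F s in at t. \<phi> (chart_inv (\<phi> (?y s)) + chart_inv (\<phi> (?z s))) = \<phi> (- (c t + d t) + (c s + d s))"
      by eventually_elim (simp add: minus_add add.assoc del: add_uminus_conv_diff)
  qed (use unit_chart in \<open>auto simp: minus_add add.assoc simp del: add_uminus_conv_diff\<close>)
  then show ?thesis unfolding has_log_deriv_def using lim by (auto intro: tendsto_intros)
qed

lemma has_log_deriv_minus:
  assumes c: "has_log_deriv c L t"
  shows "has_log_deriv (\<lambda>s. - c s) (\<lambda>h. - Ad (c t) (L h)) t"
proof -
  have lim: "(c \<longlongrightarrow> c t) (at t)" using c by (auto simp: has_log_deriv_def)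
  have "((\<lambda>q. \<phi> (c t + chart_inv (\<phi> (- chart_inv q)) - c t)) has_derivative (\<lambda>v. Ad (c t) (- v))) (at (\<phi> 0))"
    by (rule has_derivative_compose[OF neg_has_derivative, where g="\<lambda>q. \<phi> (c t + chart_inv q - c t)"])
      (use conj_has_derivative unit_chart in auto)
  then have "((\<lambda>q. \<phi> (c t - (c t + chart_inv q))) has_derivative (\<lambda>v. Ad (c t) (- v))) (at (\<phi> 0))"
    by (rule has_derivative_transform_within_open[OF _ open_chart_minus]) (use unit_chart in \<open>auto simp: diff_conv_add_uminus minus_add add.assoc simp del: add_uminus_conv_diff\<close>)
  from has_log_deriv_compose[OF c, where F="\<lambda>x. \<phi> (c t - x)", OF this]
  have "((\<lambda>s. \<phi> (c t - c s)) has_derivative (\<lambda>h. Ad (c t) (- L h))) (at t)" .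
  then show ?thesis unfolding has_log_deriv_def using lim
    by (auto intro: tendsto_intros simp: linear_neg[OF linear_Ad])
qed

lemma has_log_deriv_left_translation:
  assumes "has_log_deriv c L t"
  shows "has_log_deriv (\<lambda>s. x + c s) L t"
proof -
  have "- (x + c t) + (x + c s) = - c t + c s" for s by (simp add: minus_add add.assoc del: add_uminus_conv_diff)
  moreover have "((\<lambda>s. x + c s) \<longlongrightarrow> x + c t) (at t)"
    using assms unfolding has_log_deriv_def by (intro tendsto_intros) auto
  ultimately show ?thesis using assms unfolding has_log_deriv_def by simp
qed

text \<open>Near \<open>t\<close> the curve is read in the chart after left translation by
  \<open>- c t\<close>; its derivative there is the left-invariant field of the vector 0. So the
  curve is locally constant on a connected set.\<close>

lemma log_deriv_zero_constant:
  fixes c :: "real \<Rightarrow> 'g"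
  assumes S: "open S" "connected S" and c: "\<And>t. t \<in> S \<Longrightarrow> has_log_deriv c (\<lambda>_. 0) t"
    and st: "s \<in> S" "t \<in> S"
  shows "c s = c t"
proof -
  have "c constant_on S"
  proof (rule locally_constant_imp_constant[OF S(2)])
    fix t assume t: "t \<in> S"
    have "\<forall>\<^sub>F s in at t. - c t + c s \<in> U \<and> s \<in> S"
      by (intro eventually_conj has_log_deriv_near[OF c[OF t]] eventually_at_in_open'[OF S(1) t])
    then obtain e where e: "e > 0" "\<And>s. s \<noteq> t \<Longrightarrow> dist s t < e \<Longrightarrow> - c t + c s \<in> U \<and> s \<in> S"
      unfolding eventually_at by blast
    have near: "- c t + c s \<in> U" "s \<in> S" if "s \<in> ball t e" for s
      using e that t unit_chart by (cases "s = t"; force simp: dist_commute)+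
    have "((\<lambda>s. \<phi> (- c t + c s)) has_derivative (\<lambda>h. 0)) (at s within ball t e)" if s: "s \<in> ball t e" for s
    proof -
      have "((\<lambda>q. \<phi> (- c t + (c s + chart_inv q))) has_derivative (\<lambda>v. left_field U \<phi> v (\<phi> (- c t + c s)))) (at (\<phi> 0))"
        using chart_mult_derivative_right(1)[of "\<phi> (- c t + c s)"] near(1)[OF s] by (simp add: add.assoc)
      from has_log_deriv_compose[OF c[OF near(2)[OF s]], where F="\<lambda>x. \<phi> (- c t + x)", OF this]
      show ?thesis
        using linear_0[OF has_derivative_linear[OF chart_mult_derivative_right(1)[of "\<phi> (- c t + c s)"]]] near(1)[OF s]
        by (auto intro: has_derivative_at_withinI)
    qed
    then obtain k where k: "\<And>s. s \<in> ball t e \<Longrightarrow> \<phi> (- c t + c s) = k"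
      using has_derivative_zero_constant[of "ball t e"] by blast
    have eq: "c s = c t" if s: "s \<in> ball t e" for s
    proof -
      have "\<phi> (- c t + c s) = \<phi> 0" using k[OF s] k[of t] e(1) by simp
      then have "- c t + c s = 0" using near(1)[OF s] unit_chart by (metis chart_inv_\<phi>)
      then show ?thesis by (metis add.right_neutral add_minus_cancel)
    qed
    show "\<exists>T. openin (top_of_set S) T \<and> t \<in> T \<and> (\<forall>s\<in>T. c s = c t)"
    proof (intro exI conjI ballI)
      show "openin (top_of_set S) (S \<inter> ball t e)" by (simp add: openin_open_Int)
      show "t \<in> S \<inter> ball t e" using t e(1) by simp
      show "c s = c t" if "s \<in> S \<inter> ball t e" for s using that by (intro eq) blast
    qed
  qed
  then show ?thesis using st unfolding constant_on_def by metis
qed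

text \<open>The product rule gives \<open>c - d\<close> the logarithmic derivative
  \<open>Ad (d t) (L t h) - Ad (d t) (L t h)\<close>.\<close>

lemma equal_log_deriv_diff_constant:
  fixes c d :: "real \<Rightarrow> 'g"
  assumes S: "open S" "connected S" and c: "\<And>t. t \<in> S \<Longrightarrow> has_log_deriv c (L t) t"
    and d: "\<And>t. t \<in> S \<Longrightarrow> has_log_deriv d (L t) t" and st: "s \<in> S" "t \<in> S"
  shows "c s - d s = c t - d t"
proof -
  have "has_log_deriv (\<lambda>t. c t + - d t) (\<lambda>h. 0) t" if "t \<in> S" for t
    using has_log_deriv_add[OF c[OF that] has_log_deriv_minus[OF d[OF that]]] by simp
  from log_deriv_zero_constant[OF S this st] show ?thesis by simp
qed

end

lemma has_vector_derivative_reflect: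
  assumes "(f has_vector_derivative f') (at 0)"
  shows "((\<lambda>t. f (- t)) has_vector_derivative - f') (at 0)"
proof -
  have "((\<lambda>t. f (- t)) has_derivative (\<lambda>h. - h *\<^sub>R f')) (at 0)"
    by (rule has_derivative_compose[where f="\<lambda>t. - t" and g=f])
      (use assms in \<open>auto simp: has_vector_derivative_def intro!: derivative_eq_intros\<close>)
  then show ?thesis by (simp add: has_vector_derivative_def)
qed

lemma has_vector_derivative_shift:
  assumes "(f has_vector_derivative f') (at 0)"
  shows "((\<lambda>s. f (s - t)) has_vector_derivative f') (at t)"
  unfolding has_vector_derivative_def
  by (rule has_derivative_compose[where f="\<lambda>s. s - t" and g=f])
    (use assms in \<open>auto simp: has_vector_derivative_def intro!: derivative_eq_intros\<close>)

lemma has_vector_derivative_compose_at: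
  assumes "(f has_vector_derivative f') (at t)" "(g has_derivative g') (at (f t))"
  shows "((\<lambda>t. g (f t)) has_vector_derivative g' f') (at t)"
  using vector_derivative_diff_chain_within[OF assms(1) has_derivative_at_withinI[OF assms(2)]]
  by (simp add: comp_def)

text \<open>A product rule from pointwise derivatives of \<open>A h w\<close>: expansion in
  \<open>Basis\<close> leaves finitely many products with scalars. Linearity is asked for only near
  \<open>t\<close>, as suits operators that are given in a chart.\<close>

lemma has_vector_derivative_linear_family:
  fixes A :: "real \<Rightarrow> 'a::euclidean_space \<Rightarrow> 'b::real_normed_vector"
  assumes lin: "\<forall>\<^sub>F h in at t. linear (A h)" "linear (A t)"
    and A: "\<And>w. ((\<lambda>h. A h w) has_vector_derivative A' w) (at t)"
    and z: "(z has_vector_derivative z') (at t)"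
  shows "((\<lambda>h. A h (z h)) has_vector_derivative A t z' + A' (z t)) (at t)"
proof -
  have exp: "A h w = (\<Sum>b\<in>Basis. (w \<bullet> b) *\<^sub>R A h b)" if "linear (A h)" for h w
    using linear_sum[OF that, of "\<lambda>b. (w \<bullet> b) *\<^sub>R b" Basis] linear_cmul[OF that]
    by (simp add: euclidean_representation)
  have ev: "((\<lambda>h. A h (z h)) has_vector_derivative D) (at t)"
    if "((\<lambda>h. \<Sum>b\<in>Basis. (z h \<bullet> b) *\<^sub>R A h b) has_vector_derivative D) (at t)" for D and z :: "real \<Rightarrow> 'a"
    using that unfolding has_vector_derivative_def
  proof (rule has_derivative_transform_eventually)
    show "\<forall>\<^sub>F h in at t. (\<Sum>b\<in>Basis. (z h \<bullet> b) *\<^sub>R A h b) = A h (z h)"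
      using lin(1) by eventually_elim (rule exp[symmetric])
    show "(\<Sum>b\<in>Basis. (z t \<bullet> b) *\<^sub>R A t b) = A t (z t)" by (rule exp[OF lin(2), symmetric])
  qed simp
  have sm: "((\<lambda>h. \<Sum>b\<in>Basis. (z h \<bullet> b) *\<^sub>R A h b) has_vector_derivative
          (\<Sum>b\<in>Basis. (z t \<bullet> b) *\<^sub>R A' b + (z' \<bullet> b) *\<^sub>R A t b)) (at t)"
    if "(z has_vector_derivative z') (at t)" for z z'
    by (intro has_vector_derivative_sum has_vector_derivative_scaleR A)
      (use bounded_linear.has_vector_derivative[OF bounded_linear_inner_left that]
        in \<open>simp add: has_real_derivative_iff_has_vector_derivative\<close>)
  have A'_exp: "A' w = (\<Sum>b\<in>Basis. (w \<bullet> b) *\<^sub>R A' b)" for w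
  proof -
    have "((\<lambda>h. A h w) has_vector_derivative (\<Sum>b\<in>Basis. (w \<bullet> b) *\<^sub>R A' b + (0 \<bullet> b) *\<^sub>R A t b)) (at t)"
      by (rule ev[where z="\<lambda>_. w"], rule sm[where z="\<lambda>_. w" and z'=0], rule has_vector_derivative_const)
    from vector_derivative_unique_at[OF A[of w] this] show ?thesis
      by (simp only: inner_zero_left scaleR_zero_left add_0_right)
  qed
  have "(\<Sum>b\<in>Basis. (z t \<bullet> b) *\<^sub>R A' b + (z' \<bullet> b) *\<^sub>R A t b) = A' (z t) + A t z'"
    by (simp only: sum.distrib exp[OF lin(2), symmetric] A'_exp[symmetric])
  with ev[where z=z, OF sm[where z=z and z'=z', OF z]] show ?thesis
    by (simp only: add.commute)
qed

context homogeneous_group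
begin

section \<open>The adjoint action along one-parameter subgroups\<close>

lemma Ad_0: "Ad 0 = (\<lambda>v. v)"
proof -
  have "((\<lambda>q. \<phi> (0 + chart_inv q - 0)) has_derivative (\<lambda>v. v)) (at (\<phi> 0))"
    by (rule has_derivative_transform_within_open[OF has_derivative_ident open_chart_image])
      (use unit_chart in \<open>auto simp: \<phi>_chart_inv\<close>)
  then show ?thesis using conj_has_derivative has_derivative_unique by metis
qed

lemma Ad_add: "Ad (x + y) v = Ad x (Ad y v)"
proof -
  have "((\<lambda>q. \<phi> (x + chart_inv (\<phi> (y + chart_inv q - y)) - x)) has_derivative (\<lambda>v. Ad x (Ad y v))) (at (\<phi> 0))"
    by (rule has_derivative_compose[OF conj_has_derivative, where g="\<lambda>q. \<phi> (x + chart_inv q - x)"])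
      (use conj_has_derivative unit_chart in auto)
  then have "((\<lambda>q. \<phi> (x + y + chart_inv q - (x + y))) has_derivative (\<lambda>v. Ad x (Ad y v))) (at (\<phi> 0))"
  proof (rule has_derivative_transform_within_open)
    show "open {p \<in> \<phi> ` U. y + chart_inv p - y \<in> U}"
      by (intro open_chart_preimage[OF unit_chart(1) open_U, of "\<lambda>z. y + z - y"] continuous_intros)
  qed (use unit_chart in \<open>auto simp: diff_conv_add_uminus minus_add add.assoc simp del: add_uminus_conv_diff\<close>)
  then show ?thesis using conj_has_derivative has_derivative_unique by metis
qed

lemma Ad_inverse: "Ad x (Ad (- x) v) = v" "Ad (- x) (Ad x v) = v"
  using Ad_add[of x "- x" v] Ad_add[of "- x" x v] by (simp_all add: Ad_0)

text \<open>By the group law \<open>- \<gamma> t + \<gamma> s = \<gamma> (s - t)\<close>, so the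
  derivative at \<open>0\<close> is the logarithmic derivative at every \<open>t\<close>.\<close>

lemma one_parameter_subgroup_has_log_deriv:
  assumes "one_parameter_subgroup \<phi> v \<gamma>"
  shows "has_log_deriv \<gamma> (\<lambda>h. h *\<^sub>R v) t"
proof -
  have c: "continuous_on UNIV \<gamma>" and hom: "\<And>s t. \<gamma> (s + t) = \<gamma> s + \<gamma> t"
    and d: "((\<lambda>t. \<phi> (\<gamma> t)) has_vector_derivative v) (at 0)"
    using assms unfolding one_parameter_subgroup_def by auto
  have "\<gamma> t + (- \<gamma> t + \<gamma> s) = \<gamma> t + \<gamma> (s - t)" for s
    using hom[of t "s - t"] by simp
  then have eq: "- \<gamma> t + \<gamma> s = \<gamma> (s - t)" for s by (metis add_left_cancel)
  have "((\<lambda>s. \<phi> (\<gamma> (s - t))) has_derivative (\<lambda>h. h *\<^sub>R v)) (at t)"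
    by (rule has_derivative_compose[where f="\<lambda>s. s - t" and g="\<lambda>t. \<phi> (\<gamma> t)"])
      (use d in \<open>auto simp: has_vector_derivative_def intro!: derivative_eq_intros\<close>)
  then show ?thesis unfolding has_log_deriv_def eq
    using c by (auto simp: continuous_on_def)
qed

lemma one_parameter_subgroup_unique:
  assumes "one_parameter_subgroup \<phi> v \<gamma>" "one_parameter_subgroup \<phi> v \<gamma>'"
  shows "\<gamma> = \<gamma>'"
proof
  fix t :: real
  have "\<gamma> 0 = \<gamma> 0 + \<gamma> 0" "\<gamma>' 0 = \<gamma>' 0 + \<gamma>' 0"
    using assms unfolding one_parameter_subgroup_def by (metis add_0)+
  then have 0: "\<gamma> 0 = 0" "\<gamma>' 0 = 0" using add_left_cancel[of "\<gamma> 0" "\<gamma> 0" 0] add_left_cancel[of "\<gamma>' 0" "\<gamma>' 0" 0] by simp_all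
  have "\<gamma> t - \<gamma>' t = \<gamma> 0 - \<gamma>' 0"
    by (rule equal_log_deriv_diff_constant[of UNIV \<gamma> "\<lambda>_ h. h *\<^sub>R v" \<gamma>'])
      (use one_parameter_subgroup_has_log_deriv assms in auto)
  then show "\<gamma> t = \<gamma>' t" using 0 by simp
qed

lemma E_one_parameter_subgroup: "one_parameter_subgroup \<phi> v (\<lambda>t. E (t *\<^sub>R v))"
  using exponential_map unfolding exponential_map_def by simp

lemma E_add: "E ((s + t) *\<^sub>R v) = E (s *\<^sub>R v) + E (t *\<^sub>R v)"
  using E_one_parameter_subgroup[of v] unfolding one_parameter_subgroup_def by blast

lemma E_0[simp]: "E 0 = 0"
  using E_add[of 0 0 0] add_left_cancel[of "E 0" "E 0" 0] by simp

lemma E_minus: "E (- v) = - E v"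
  using E_add[of "- 1" 1 v] by (simp add: eq_neg_iff_add_eq_0)

lemma E_has_log_deriv: "has_log_deriv (\<lambda>t. E (t *\<^sub>R v)) (\<lambda>h. h *\<^sub>R v) t"
  by (rule one_parameter_subgroup_has_log_deriv[OF E_one_parameter_subgroup])

lemma chart_E_has_vector_derivative: "((\<lambda>t. \<phi> (E (t *\<^sub>R v))) has_vector_derivative v) (at 0)"
  using E_one_parameter_subgroup[of v] unfolding one_parameter_subgroup_def by blast

text \<open>Expresses \<open>Ad\<close> by the first derivative of the group law in the fixed chart,
  a form that can be differentiated once more in \<open>x\<close>.\<close>

lemma Ad_in_chart:
  assumes "x \<in> U" "- x \<in> U"
  shows "Ad x v = fderiv chart_mult (\<phi> x, \<phi> (- x)) (left_field U \<phi> v (\<phi> x), 0)"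
proof -
  have mem: "(\<phi> x, \<phi> (- x)) \<in> chart_mult_dom" using assms unit_chart by auto
  have "((\<lambda>q. \<phi> (chart_inv (\<phi> x) + chart_inv q)) has_derivative (\<lambda>v. left_field U \<phi> v (\<phi> x))) (at (\<phi> 0))"
    using chart_mult_derivative_right(1)[of "\<phi> x"] assms by simp
  then have d: "((\<lambda>q. (\<phi> (x + chart_inv q), \<phi> (- x))) has_derivative (\<lambda>v. (left_field U \<phi> v (\<phi> x), 0))) (at (\<phi> 0))"
    using assms by (intro has_derivative_Pair has_derivative_const) simp_all
  have "((\<lambda>q. chart_mult (\<phi> (x + chart_inv q), \<phi> (- x))) has_derivative
      (\<lambda>v. fderiv chart_mult (\<phi> x, \<phi> (- x)) (left_field U \<phi> v (\<phi> x), 0))) (at (\<phi> 0))"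
    by (rule has_derivative_compose[OF d]) (use smooth_on_D(1)[OF chart_mult_smooth mem] in simp)
  then have "((\<lambda>q. \<phi> (x + chart_inv q - x)) has_derivative
      (\<lambda>v. fderiv chart_mult (\<phi> x, \<phi> (- x)) (left_field U \<phi> v (\<phi> x), 0))) (at (\<phi> 0))"
  proof (rule has_derivative_transform_within_open)
    show "open {p \<in> \<phi> ` U. x + chart_inv p \<in> U}"
      by (intro open_chart_preimage[OF unit_chart(1) open_U] continuous_intros)
  qed (use unit_chart assms in auto)
  from has_derivative_unique[OF conj_has_derivative this] show ?thesis by (rule fun_cong)
qed

lemma open_chart_mult_dom: "open chart_mult_dom"
proof -
  have "continuous_on (\<phi> ` U \<times> \<phi> ` U) (\<lambda>z. chart_inv (fst z) + chart_inv (snd z))"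
    by (intro continuous_intros continuous_on_compose2[OF chart_inv_continuous[OF unit_chart(1)]]) auto
  then have "open ((\<phi> ` U \<times> \<phi> ` U) \<inter> (\<lambda>z. chart_inv (fst z) + chart_inv (snd z)) -` U)"
    by (rule continuous_open_preimage[OF _ open_Times[OF open_chart_image open_chart_image] open_U])
  moreover have "chart_mult_dom = (\<phi> ` U \<times> \<phi> ` U) \<inter> (\<lambda>z. chart_inv (fst z) + chart_inv (snd z)) -` U"
    by auto
  ultimately show ?thesis by (simp only:)
qed

lemma left_field_has_derivative:
  "(left_field U \<phi> v has_derivative
      (\<lambda>u. fderiv (\<lambda>z. fderiv chart_mult z (0, v)) (\<phi> 0, \<phi> 0) (u, 0))) (at (\<phi> 0))"
proof -
  have mem: "(\<phi> 0, \<phi> 0) \<in> chart_mult_dom" using unit_chart by auto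
  have "((\<lambda>p. fderiv chart_mult (p, \<phi> 0) (0, v)) has_derivative
      (\<lambda>u. fderiv (\<lambda>z. fderiv chart_mult z (0, v)) (\<phi> 0, \<phi> 0) (u, 0))) (at (\<phi> 0))"
    by (rule has_derivative_compose[where f="\<lambda>p. (p, \<phi> 0)" and g="\<lambda>z. fderiv chart_mult z (0, v)"])
      (use smooth_on_D(2)[OF chart_mult_smooth mem] in \<open>auto intro!: derivative_eq_intros\<close>)
  then show ?thesis
    by (rule has_derivative_transform_within_open[OF _ open_chart_image])
      (use unit_chart chart_mult_derivative_right(2) in auto)
qed

text \<open>In the chart, \<open>Ad (E (t *\<^sub>R v)) w\<close> is the derivative of the group law
  at \<open>(p t, p (- t))\<close>, applied to the left field of \<open>w\<close> at
  \<open>p t\<close>. The variation of the left field gives one half of the bracket, that of the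
  base point in direction \<open>(v, - v)\<close> the other.\<close>

lemma Ad_E_derivative_0:
  "((\<lambda>t. Ad (E (t *\<^sub>R v)) w) has_vector_derivative lie_bracket U \<phi> v w) (at 0)"
proof -
  let ?o = "\<phi> 0"
  let ?G = "\<lambda>w z. fderiv chart_mult z (w, 0)"
  let ?H = "\<lambda>w z. fderiv chart_mult z (0, w)"
  define p where "p t = \<phi> (E (t *\<^sub>R v))" for t
  have mem: "(?o, ?o) \<in> chart_mult_dom" using unit_chart by auto
  have p0[simp]: "p 0 = ?o" by (simp add: p_def)
  have p: "(p has_vector_derivative v) (at 0)"
    using chart_E_has_vector_derivative unfolding p_def[abs_def] .
  have pm: "((\<lambda>t. p (- t)) has_vector_derivative - v) (at 0)"
    by (rule has_vector_derivative_reflect[OF p])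
  have pair: "((\<lambda>t. (p t, p (- t))) has_vector_derivative (v, - v)) (at 0)"
    by (intro has_vector_derivative_Pair p pm)
  have contE: "((\<lambda>t. E (t *\<^sub>R v)) \<longlongrightarrow> 0) (at 0)" "((\<lambda>t. E (- t *\<^sub>R v)) \<longlongrightarrow> 0) (at 0)"
  proof -
    show *: "((\<lambda>t. E (t *\<^sub>R v)) \<longlongrightarrow> 0) (at 0)"
      using E_has_log_deriv[of v 0] by (simp add: has_log_deriv_def)
    show "((\<lambda>t. E (- t *\<^sub>R v)) \<longlongrightarrow> 0) (at 0)"
      using tendsto_minus[OF *] by (simp add: E_minus)
  qed
  have near: "\<forall>\<^sub>F t in at 0. E (t *\<^sub>R v) \<in> U \<and> E (- t *\<^sub>R v) \<in> U"
    by (intro eventually_conj topological_tendstoD[OF contE(1) open_U] topological_tendstoD[OF contE(2) open_U] unit_chart)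
  have dom: "(p t, p (- t)) \<in> chart_mult_dom" if "E (t *\<^sub>R v) \<in> U \<and> E (- t *\<^sub>R v) \<in> U" for t
    using that unit_chart E_minus by (auto simp: p_def)
  have lin: "linear (\<lambda>w. ?G w z)" if "z \<in> chart_mult_dom" for z
    by (rule linear_compose[where f="\<lambda>w. (w, 0)", unfolded comp_def, OF _ has_derivative_linear[OF smooth_on_D(1)[OF chart_mult_smooth that]]])
      (auto intro: linearI)
  have GD: "((\<lambda>t. ?G w (p t, p (- t))) has_vector_derivative fderiv (?G w) (?o, ?o) (v, - v)) (at 0)" for w
    by (rule has_vector_derivative_compose_at[OF pair]) (simp add: smooth_on_D(2)[OF chart_mult_smooth mem])
  have u: "((\<lambda>t. left_field U \<phi> w (p t)) has_vector_derivative fderiv (?H w) (?o, ?o) (v, 0)) (at 0)"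
    by (rule has_vector_derivative_compose_at[OF p]) (simp add: left_field_has_derivative)
  have "((\<lambda>t. ?G (left_field U \<phi> w (p t)) (p t, p (- t))) has_vector_derivative
      ?G (fderiv (?H w) (?o, ?o) (v, 0)) (p 0, p (- 0)) +
      fderiv (?G (left_field U \<phi> w (p 0))) (?o, ?o) (v, - v)) (at 0)"
  proof (rule has_vector_derivative_linear_family[where A="\<lambda>t w. ?G w (p t, p (- t))"
        and A'="\<lambda>w. fderiv (?G w) (?o, ?o) (v, - v)"])
    show "\<forall>\<^sub>F t in at 0. linear (\<lambda>w. ?G w (p t, p (- t)))"
      using near by eventually_elim (intro lin dom)
  qed (use lin mem GD u in auto)
  moreover have "?G b (p 0, p (- 0)) = b" for b
    using chart_mult_derivative_left[of ?o b] unit_chart by simp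
  \<comment> \<open>\<open>?G w\<close> is constantly \<open>w\<close> at the points
    \<open>(p, ?o)\<close>, since multiplication by the unit is the identity. Only the direction
    \<open>(0, - v)\<close> remains, and there the order of differentiation is exchanged.\<close>
  moreover have "fderiv (?G w) (?o, ?o) (v, - v) = - fderiv (?H v) (?o, ?o) (w, 0)"
  proof -
    note d = smooth_on_D(2)[OF chart_mult_smooth mem, of "(w, 0)"]
    have "((\<lambda>p. ?G w (p, ?o)) has_derivative (\<lambda>u. fderiv (?G w) (?o, ?o) (u, 0))) (at ?o)"
      by (rule has_derivative_compose[where f="\<lambda>p. (p, ?o)" and g="?G w"])
        (use d in \<open>auto intro!: derivative_eq_intros\<close>)
    moreover have "((\<lambda>p. ?G w (p, ?o)) has_derivative (\<lambda>u. 0)) (at ?o)"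
      by (rule has_derivative_transform_within_open[OF has_derivative_const open_chart_image])
        (use unit_chart chart_mult_derivative_left in auto)
    ultimately have "(\<lambda>u. fderiv (?G w) (?o, ?o) (u, 0)) = (\<lambda>u. 0)"
      by (rule has_derivative_unique)
    then have 0: "fderiv (?G w) (?o, ?o) (v, 0) = 0" by (rule fun_cong)
    have "fderiv (?G w) (?o, ?o) ((v, 0) - (0, v))
        = 0 - fderiv (?G w) (?o, ?o) (0, v)"
      unfolding linear_diff[OF has_derivative_linear[OF d]] 0 ..
    also have "fderiv (?G w) (?o, ?o) (0, v) = fderiv (?H v) (?o, ?o) (w, 0)"
      by (rule second_derivative_symmetric[OF open_chart_mult_dom mem chart_mult_smooth])
    finally show ?thesis by simp
  qed
  moreover have "lie_bracket U \<phi> v w = fderiv (?H w) (?o, ?o) (v, 0) - fderiv (?H v) (?o, ?o) (w, 0)"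
    unfolding lie_bracket_def frechet_derivative_at[OF left_field_has_derivative, symmetric] ..
  ultimately have *: "((\<lambda>t. ?G (left_field U \<phi> w (p t)) (p t, p (- t))) has_vector_derivative lie_bracket U \<phi> v w) (at 0)"
    by (simp add: left_field_unit)
  show ?thesis
    unfolding has_vector_derivative_def
  proof (rule has_derivative_transform_eventually[OF *[unfolded has_vector_derivative_def]])
    show "\<forall>\<^sub>F t in at 0. ?G (left_field U \<phi> w (p t)) (p t, p (- t)) = Ad (E (t *\<^sub>R v)) w"
      using near by eventually_elim (simp add: Ad_in_chart p_def E_minus)
    show "?G (left_field U \<phi> w (p 0)) (p 0, p (- 0)) = Ad (E (0 *\<^sub>R v)) w"
      using Ad_in_chart[of 0 w] unit_chart by (simp add: p_def)
  qed simp
qed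

text \<open>\<open>Ad (E (t *\<^sub>R v')) \<circ> D \<circ> Ad (E (- t *\<^sub>R v))\<close> is
  independent of \<open>t\<close>: its derivative vanishes at \<open>0\<close> by the bracket
  hypothesis, and the group law moves this to every \<open>t\<close>.\<close>

lemma Ad_E_intertwine:
  assumes D: "linear D" and br: "\<And>w. D (lie_bracket U \<phi> v w) = lie_bracket U \<phi> v' (D w)"
  shows "Ad (E (t *\<^sub>R v')) (D w) = D (Ad (E (t *\<^sub>R v)) w)"
proof -
  let ?\<eta> = "\<lambda>u t. Ad (E (t *\<^sub>R v')) (D (Ad (E (- t *\<^sub>R v)) u))"
  have d0: "(?\<eta> u has_vector_derivative 0) (at 0)" for u
  proof -
    have "((\<lambda>t. Ad (E (- t *\<^sub>R v)) u) has_vector_derivative - lie_bracket U \<phi> v u) (at 0)"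
      by (rule has_vector_derivative_reflect[OF Ad_E_derivative_0])
    from bounded_linear.has_vector_derivative[OF linear_conv_bounded_linear[THEN iffD1, OF D] this]
    have "((\<lambda>t. D (Ad (E (- t *\<^sub>R v)) u)) has_vector_derivative - lie_bracket U \<phi> v' (D u)) (at 0)"
      by (simp add: linear_neg[OF D] br)
    from has_vector_derivative_linear_family[where A="\<lambda>t. Ad (E (t *\<^sub>R v'))" and A'="lie_bracket U \<phi> v'",
        OF always_eventually[OF allI[OF linear_Ad]] linear_Ad Ad_E_derivative_0 this]
    have "(?\<eta> u has_vector_derivative Ad (E (0 *\<^sub>R v')) (- lie_bracket U \<phi> v' (D u))
        + lie_bracket U \<phi> v' (D (Ad (E (- 0 *\<^sub>R v)) u))) (at 0)" .
    moreover have "Ad (E (0 *\<^sub>R v')) (- lie_bracket U \<phi> v' (D u))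
        + lie_bracket U \<phi> v' (D (Ad (E (- 0 *\<^sub>R v)) u)) = 0"
      by (simp only: minus_zero scaleR_zero_left E_0 Ad_0 left_minus)
    ultimately show ?thesis by (simp only:)
  qed
  have d: "(?\<eta> u has_vector_derivative 0) (at t within UNIV)" for u t
  proof -
    have shift: "?\<eta> u s = Ad (E (t *\<^sub>R v')) (?\<eta> (Ad (E (- t *\<^sub>R v)) u) (s - t))" for s
    proof -
      have "E (s *\<^sub>R v') = E (t *\<^sub>R v') + E ((s - t) *\<^sub>R v')" using E_add[of t "s - t" v'] by simp
      moreover have "E (- s *\<^sub>R v) = E (- (s - t) *\<^sub>R v) + E (- t *\<^sub>R v)"
        using E_add[of "- (s - t)" "- t" v] by simp
      ultimately show ?thesis by (simp only: Ad_add)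
    qed
    have "((\<lambda>s. ?\<eta> (Ad (E (- t *\<^sub>R v)) u) (s - t)) has_vector_derivative 0) (at t)"
      by (rule has_vector_derivative_shift[OF d0])
    from bounded_linear.has_vector_derivative[OF linear_conv_bounded_linear[THEN iffD1, OF linear_Ad[of "E (t *\<^sub>R v')"]] this]
    show ?thesis unfolding shift by (simp add: linear_0[OF linear_Ad])
  qed
  have "\<exists>c. \<forall>s. ?\<eta> u s = c" for u
    using has_vector_derivative_zero_constant[OF convex_UNIV d[of u]] by (metis UNIV_I)
  then have "?\<eta> u t = ?\<eta> u 0" for u by metis
  from this[of "Ad (E (t *\<^sub>R v)) w"] show ?thesis
    by (simp add: Ad_0 E_minus Ad_inverse)
qed

end

section \<open>Coordinates of the second kind\<close>

lemma tendsto_det: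
  fixes M :: "'x \<Rightarrow> real^'n^'n"
  assumes "\<And>i j. ((\<lambda>x. M x $ i $ j) \<longlongrightarrow> m $ i $ j) F"
  shows "((\<lambda>x. det (M x)) \<longlongrightarrow> det m) F"
  unfolding det_def by (intro tendsto_sum tendsto_mult tendsto_const tendsto_prod assms)

lemma tendsto_linear_family:
  fixes A :: "'x \<Rightarrow> 'a::euclidean_space \<Rightarrow> 'b::real_normed_vector"
  assumes lin: "\<forall>\<^sub>F x in F. linear (A x)" "linear B"
    and A: "\<And>w. ((\<lambda>x. A x w) \<longlongrightarrow> B w) F" and z: "(z \<longlongrightarrow> w) F"
  shows "((\<lambda>x. A x (z x)) \<longlongrightarrow> B w) F"
proof -
  have exp: "L w = (\<Sum>b\<in>Basis. (w \<bullet> b) *\<^sub>R L b)" if "linear L" for L :: "'a \<Rightarrow> 'b" and w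
    using linear_sum[OF that, of "\<lambda>b. (w \<bullet> b) *\<^sub>R b" Basis] linear_cmul[OF that]
    by (simp add: euclidean_representation)
  have "((\<lambda>x. \<Sum>b\<in>Basis. (z x \<bullet> b) *\<^sub>R A x b) \<longlongrightarrow> B w) F"
    unfolding exp[OF lin(2), of w] by (intro tendsto_sum tendsto_scaleR tendsto_inner z A tendsto_const)
  moreover have "\<forall>\<^sub>F x in F. (\<Sum>b\<in>Basis. (z x \<bullet> b) *\<^sub>R A x b) = A x (z x)"
    using lin(1) by eventually_elim (rule exp[symmetric])
  ultimately show ?thesis by (rule Lim_transform_eventually)
qed

text \<open>Fixes an eigenbasis of \<open>A\<close>; bijectivity of the combination map expresses
  that \<open>e\<close> is a basis. The coordinates live in \<open>real^'n\<close>, where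
  determinants and change of variables are at hand.\<close>

locale homogeneous_coordinates = homogeneous_group \<A> U \<phi> E A
  for \<A> :: "('g::{topological_group_add, t2_space, second_countable_topology}, 'a::euclidean_space) chart set"
    and U \<phi> E A +
  fixes e :: "'n::{finite,wellorder} \<Rightarrow> 'a" and \<nu> :: "'n \<Rightarrow> real"
  assumes bij_e: "bij (\<lambda>t::real^'n::{finite,wellorder}. \<Sum>i\<in>UNIV. t $ i *\<^sub>R e i)"
    and A_e: "A (e i) = \<nu> i *\<^sub>R e i" and \<nu>_pos: "\<nu> i > 0"
begin

definition comb :: "(real, 'n) vec \<Rightarrow> 'a" where "comb t = (\<Sum>i\<in>UNIV. t $ i *\<^sub>R e i)"

definition coords :: "'a \<Rightarrow> (real, 'n) vec" where "coords = inv comb"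

text \<open>For \<open>l > 0\<close> the factor is \<open>l powr \<nu> i\<close>. The exponential
  form is the sum of the series in \<open>alg_dilation\<close>, so that the two agree for every real
  \<open>l\<close>.\<close>

definition dil :: "real \<Rightarrow> (real, 'n) vec \<Rightarrow> (real, 'n) vec" where
  "dil l t = (\<chi> i. exp (ln l * \<nu> i) * t $ i)"

lemma bij_comb: "bij comb"
  using bij_e unfolding comb_def[abs_def] .

lemma coords_comb[simp]: "coords (comb t) = t"
  unfolding coords_def using bij_comb by (simp add: bij_is_inj)

lemma comb_coords[simp]: "comb (coords v) = v"
  unfolding coords_def using bij_comb by (simp add: bij_is_surj surj_f_inv_f)

lemma linear_comb: "linear comb"
  unfolding comb_def[abs_def] by (rule linearI) (simp_all add: scaleR_left_distrib sum.distrib scaleR_sum_right)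

lemma linear_coords: "linear coords"
proof (rule linearI)
  show "coords (v + w) = coords v + coords w" for v w
    using linear_add[OF linear_comb, of "coords v" "coords w"] by (metis coords_comb comb_coords)
  show "coords (r *\<^sub>R v) = r *\<^sub>R coords v" for r v
    using linear_cmul[OF linear_comb, of r "coords v"] by (metis coords_comb comb_coords)
qed

lemma linear_dil: "linear (dil l)"
  by (rule linearI) (simp_all add: dil_def vec_eq_iff algebra_simps)

lemma bounded_linear_dil: "bounded_linear (dil l)"
  using linear_dil by (simp add: linear_conv_bounded_linear)

lemma dil_mult: "l > 0 \<Longrightarrow> m > 0 \<Longrightarrow> dil (l * m) t = dil l (dil m t)"
  by (simp add: dil_def vec_eq_iff ln_mult algebra_simps exp_add)

lemma dil_1[simp]: "dil 1 t = t" by (simp add: dil_def)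

lemma dil_0[simp]: "dil l 0 = 0" by (simp add: dil_def vec_eq_iff)

lemma dil_inverse: "l > 0 \<Longrightarrow> dil l (dil (1 / l) t) = t" "l > 0 \<Longrightarrow> dil (1 / l) (dil l t) = t"
  using dil_mult[of l "1 / l" t] dil_mult[of "1 / l" l t] by simp_all

lemma alg_dilation_comb: "alg_dilation A l (comb t) = comb (dil l t)"
proof -
  have pow: "((\<lambda>w. ln l *\<^sub>R A w) ^^ k) (comb t) = (\<Sum>i\<in>UNIV. ((ln l * \<nu> i) ^ k * t $ i) *\<^sub>R e i)" for k
  proof (induction k)
    case (Suc k)
    then show ?case
      by (simp add: linear_sum[OF linear] linear_cmul[OF linear] A_e scaleR_sum_right algebra_simps)
  qed (simp add: comb_def)
  have "(\<lambda>k. \<Sum>i\<in>UNIV. ((ln l * \<nu> i) ^ k /\<^sub>R fact k) *\<^sub>R (t $ i *\<^sub>R e i)) sums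
      (\<Sum>i\<in>UNIV. exp (ln l * \<nu> i) *\<^sub>R (t $ i *\<^sub>R e i))"
    by (intro sums_sum sums_scaleR_left exp_converges)
  then have "(\<lambda>k. (1 / fact k) *\<^sub>R (((\<lambda>w. ln l *\<^sub>R A w) ^^ k) (comb t))) sums comb (dil l t)"
    unfolding pow by (simp add: comb_def dil_def scaleR_sum_right field_simps)
  then show ?thesis unfolding alg_dilation_def by (rule sums_unique[symmetric])
qed

lemma alg_dilation_eq: "alg_dilation A l v = comb (dil l (coords v))"
  using alg_dilation_comb[of l "coords v"] by simp

lemma coords_alg_dilation: "coords (alg_dilation A l v) = dil l (coords v)"
  by (simp add: alg_dilation_eq)

lemma linear_alg_dilation: "linear (alg_dilation A l)"
  using linear_compose[OF linear_compose[OF linear_coords linear_dil] linear_comb]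
  by (simp add: comp_def alg_dilation_eq[abs_def])

lemma comb_axis: "comb (axis i s) = s *\<^sub>R e i"
proof -
  have "comb (axis i s) = (\<Sum>j\<in>UNIV. if j = i then s *\<^sub>R e j else 0)"
    unfolding comb_def by (rule sum.cong) (auto simp: axis_def)
  then show ?thesis by simp
qed

lemma alg_dilation_e: "alg_dilation A l (s *\<^sub>R e i) = (exp (ln l * \<nu> i) * s) *\<^sub>R e i"
proof -
  have "dil l (axis i s) = axis i (exp (ln l * \<nu> i) * s)" by (auto simp: dil_def axis_def vec_eq_iff)
  then show ?thesis using alg_dilation_comb[of l "axis i s"] by (simp add: comb_axis)
qed

section \<open>Products of one-parameter subgroups and their logarithmic derivatives\<close>

primrec eprod :: "'n list \<Rightarrow> (real, 'n) vec \<Rightarrow> 'g" where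
  "eprod [] t = 0"
| "eprod (i # is) t = E (t $ i *\<^sub>R e i) + eprod is t"

text \<open>The product rule for logarithmic derivatives, unfolded: the velocity of each factor is
  conjugated by the inverse of the product of the factors to its right.\<close>

primrec eprod_deriv :: "'n list \<Rightarrow> (real, 'n) vec \<Rightarrow> (real, 'n) vec \<Rightarrow> 'a" where
  "eprod_deriv [] t h = 0"
| "eprod_deriv (i # is) t h = Ad (- eprod is t) (h $ i *\<^sub>R e i) + eprod_deriv is t h"

lemma eprod_has_log_deriv: "has_log_deriv (eprod is) (eprod_deriv is t) t"
proof (induction "is")
  case Nil
  have "eprod [] = (\<lambda>t. 0)" "eprod_deriv [] t = (\<lambda>h. 0)" by auto
  then show ?case unfolding has_log_deriv_def by simp
next
  case (Cons i "is")
  have "has_log_deriv (\<lambda>t. E (t $ i *\<^sub>R e i)) (\<lambda>h. h $ i *\<^sub>R e i) t"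
    by (rule has_log_deriv_chain[OF E_has_log_deriv])
      (auto intro!: bounded_linear_imp_has_derivative bounded_linear_vec_nth)
  from has_log_deriv_add[OF this Cons.IH]
  show ?case by (simp add: eprod.simps[abs_def] eprod_deriv.simps[abs_def])
qed

lemma eprod_0[simp]: "eprod is 0 = 0"
  by (induction "is") simp_all

lemma eprod_deriv_0: "distinct is \<Longrightarrow> eprod_deriv is 0 h = (\<Sum>i\<in>set is. h $ i *\<^sub>R e i)"
  by (induction "is") (simp_all add: Ad_0)

lemma linear_eprod_deriv: "linear (eprod_deriv is t)"
  using eprod_has_log_deriv[of "is" t] unfolding has_log_deriv_def
  by (blast intro: has_derivative_linear)

text \<open>Each \<open>e i\<close> is an eigenvector of the dilation, which is a Lie algebra
  morphism; so the intertwining along \<open>E (s *\<^sub>R e i)\<close> rescales the parameter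
  exactly as \<open>dil\<close> does. Products follow as \<open>Ad\<close> is
  multiplicative.\<close>

lemma Ad_eprod_dil:
  assumes l: "l > 0"
  shows "Ad (eprod is (dil l t)) (alg_dilation A l w) = alg_dilation A l (Ad (eprod is t) w)"
proof (induction "is" arbitrary: w)
  case (Cons i "is")
  have "Ad (E (t $ i *\<^sub>R (exp (ln l * \<nu> i) *\<^sub>R e i))) (alg_dilation A l w) = alg_dilation A l (Ad (E (t $ i *\<^sub>R e i)) w)" for w
    by (rule Ad_E_intertwine[OF linear_alg_dilation])
      (use dilation_morphism[OF l] alg_dilation_e[of l 1 i] in simp)
  then have "Ad (E (dil l t $ i *\<^sub>R e i)) (alg_dilation A l w) = alg_dilation A l (Ad (E (t $ i *\<^sub>R e i)) w)" for w
    by (simp add: dil_def mult.commute)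
  then show ?case using Cons.IH by (simp add: Ad_add)
qed (simp add: Ad_0)

lemma Ad_minus_eprod_dil:
  assumes l: "l > 0"
  shows "Ad (- eprod is (dil l t)) (alg_dilation A l w) = alg_dilation A l (Ad (- eprod is t) w)"
  using Ad_eprod_dil[OF l, of "is" t "Ad (- eprod is t) w"] Ad_inverse by metis

lemma eprod_deriv_dil:
  assumes l: "l > 0"
  shows "eprod_deriv is (dil l t) (dil l h) = alg_dilation A l (eprod_deriv is t h)"
proof (induction "is")
  case Nil
  then show ?case by (simp add: linear_0[OF linear_alg_dilation])
next
  case (Cons i "is")
  have "dil l h $ i *\<^sub>R e i = alg_dilation A l (h $ i *\<^sub>R e i)"
    by (simp add: alg_dilation_e dil_def)
  then show ?case
    using Cons Ad_minus_eprod_dil[OF l] by (simp add: linear_add[OF linear_alg_dilation])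
qed

lemma Ad_E_tendsto: "((\<lambda>s. Ad (E (s *\<^sub>R v)) w) \<longlongrightarrow> Ad (E (r *\<^sub>R v)) w) (at r)"
proof -
  have "isCont (\<lambda>s. Ad (E (s *\<^sub>R v)) w) 0"
    by (rule has_vector_derivative_continuous[OF Ad_E_derivative_0])
  then have "((\<lambda>s. Ad (E (s *\<^sub>R v)) w) \<longlongrightarrow> w) (at 0)" by (simp add: isCont_def Ad_0)
  then have "((\<lambda>s. Ad (E ((s - r) *\<^sub>R v)) w) \<longlongrightarrow> w) (at r)"
    using LIM_offset[of "\<lambda>s. Ad (E (s *\<^sub>R v)) w" w 0 "- r"] by simp
  then have "((\<lambda>s. Ad (E (r *\<^sub>R v)) (Ad (E ((s - r) *\<^sub>R v)) w)) \<longlongrightarrow> Ad (E (r *\<^sub>R v)) w) (at r)"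
    by (rule bounded_linear.tendsto[OF linear_conv_bounded_linear[THEN iffD1, OF linear_Ad]])
  moreover have "Ad (E (r *\<^sub>R v)) (Ad (E ((s - r) *\<^sub>R v)) w) = Ad (E (s *\<^sub>R v)) w" for s
  proof -
    have "E (s *\<^sub>R v) = E (r *\<^sub>R v) + E ((s - r) *\<^sub>R v)" using E_add[of r "s - r" v] by simp
    then show ?thesis by (simp only: Ad_add)
  qed
  ultimately show ?thesis by simp
qed

lemma Ad_E_coord_tendsto:
  "((\<lambda>t. Ad (E ((c * t $ i) *\<^sub>R v)) w) \<longlongrightarrow> Ad (E ((c * s $ i) *\<^sub>R v)) w) (at (s :: (real, 'n) vec))"
proof -
  have "isCont (\<lambda>s. Ad (E (s *\<^sub>R v)) w) (c * s $ i)"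
    using Ad_E_tendsto by (simp add: isCont_def)
  moreover have "isCont (\<lambda>t. c * t $ i) s" by (intro continuous_intros)
  ultimately have "isCont (\<lambda>t. Ad (E ((c * t $ i) *\<^sub>R v)) w) s" by (rule isCont_o2[rotated])
  then show ?thesis by (simp add: isCont_def)
qed

lemma Ad_eprod_tendsto: "((\<lambda>t. Ad (eprod is t) w) \<longlongrightarrow> Ad (eprod is s) w) (at s)"
proof (induction "is" arbitrary: w)
  case (Cons i "is")
  have "((\<lambda>t. Ad (E (t $ i *\<^sub>R e i)) (Ad (eprod is t) w)) \<longlongrightarrow> Ad (E (s $ i *\<^sub>R e i)) (Ad (eprod is s) w)) (at s)"
    by (rule tendsto_linear_family[OF always_eventually[OF allI[OF linear_Ad]] linear_Ad _ Cons.IH])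
      (use Ad_E_coord_tendsto[of 1] in simp)
  then show ?case by (simp add: Ad_add)
qed simp

lemma Ad_minus_eprod_tendsto: "((\<lambda>t. Ad (- eprod is t) w) \<longlongrightarrow> Ad (- eprod is s) w) (at s)"
proof (induction "is" arbitrary: w)
  case (Cons i "is")
  have "((\<lambda>t. Ad (- eprod is t) (Ad (E ((- 1 * t $ i) *\<^sub>R e i)) w)) \<longlongrightarrow>
      Ad (- eprod is s) (Ad (E ((- 1 * s $ i) *\<^sub>R e i)) w)) (at s)"
    by (rule tendsto_linear_family[OF always_eventually[OF allI[OF linear_Ad]] linear_Ad Cons.IH Ad_E_coord_tendsto])
  then show ?case by (simp add: Ad_add minus_add E_minus del: add_uminus_conv_diff)
qed simp

lemma eprod_deriv_tendsto: "((\<lambda>t. eprod_deriv is t h) \<longlongrightarrow> eprod_deriv is s h) (at s)"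
  by (induction "is") (auto intro!: tendsto_intros Ad_minus_eprod_tendsto)

abbreviation "indices \<equiv> sorted_list_of_set UNIV"

definition Psi :: "(real, 'n) vec \<Rightarrow> 'g" where "Psi = eprod indices"

definition Psi_deriv :: "(real, 'n) vec \<Rightarrow> (real, 'n) vec \<Rightarrow> 'a" where
  "Psi_deriv = eprod_deriv indices"

lemmas Psi_has_log_deriv = eprod_has_log_deriv[of indices, folded Psi_def Psi_deriv_def]
lemmas Psi_0[simp] = eprod_0[of indices, folded Psi_def]
lemmas linear_Psi_deriv = linear_eprod_deriv[of indices, folded Psi_deriv_def]
lemmas Ad_Psi_dil = Ad_eprod_dil[of _ indices, folded Psi_def]
lemmas Psi_deriv_dil = eprod_deriv_dil[of _ indices, folded Psi_deriv_def]
lemmas Ad_Psi_tendsto = Ad_eprod_tendsto[of indices, folded Psi_def]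
lemmas Psi_deriv_tendsto = eprod_deriv_tendsto[of indices, folded Psi_deriv_def]

lemma Psi_deriv_0: "Psi_deriv 0 = comb"
  unfolding Psi_deriv_def by (rule ext) (simp add: eprod_deriv_0 comb_def)

lemma Psi_tendsto: "(Psi \<longlongrightarrow> Psi t) (at t)"
  using Psi_has_log_deriv[of t] by (simp add: has_log_deriv_def)

lemma continuous_Psi: "continuous_on UNIV Psi"
  using Psi_tendsto by (simp add: continuous_on_def)

lemma dil_tendsto_0: "((\<lambda>l. dil l t) \<longlongrightarrow> 0) (at_right 0)"
proof (rule vec_tendstoI)
  fix i
  have "((\<lambda>l. exp (ln l * \<nu> i) * t $ i) \<longlongrightarrow> 0 * t $ i) (at_right 0)"
  proof (intro tendsto_mult tendsto_const)
    have "filterlim (\<lambda>l. ln l * \<nu> i) at_bot (at_right (0::real))"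
      using filterlim_tendsto_pos_mult_at_bot[OF tendsto_const \<nu>_pos ln_at_0, of i] by (simp add: mult.commute)
    then show "((\<lambda>l. exp (ln l * \<nu> i)) \<longlongrightarrow> 0) (at_right 0)"
      by (rule filterlim_compose[OF exp_at_bot])
  qed
  then show "((\<lambda>l. dil l t $ i) \<longlongrightarrow> 0 $ i) (at_right 0)" by (simp add: dil_def)
qed

text \<open>\<open>M (dil l t)\<close> is conjugate to \<open>M t\<close> by \<open>dil l\<close>,
  so the determinants agree, while \<open>dil l t\<close> tends to \<open>0\<close> with
  \<open>l\<close>.\<close>

lemma det_dil_invariant:
  fixes M :: "(real, 'n) vec \<Rightarrow> (real, 'n) vec \<Rightarrow> (real, 'n) vec"
  assumes lin: "\<And>t. linear (M t)" and M0: "M 0 = id"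
    and lim: "\<And>h. ((\<lambda>t. M t h) \<longlongrightarrow> M 0 h) (at 0)"
    and eq: "\<And>l h. l > 0 \<Longrightarrow> M (dil l t) (dil l h) = dil l (M t h)"
  shows "det (matrix (M t)) = 1"
proof -
  have "det (matrix (M (dil l t))) = det (matrix (M t))" if l: "l > 0" for l
  proof -
    have "M (dil l t) \<circ> dil l = dil l \<circ> M t" using eq[OF l] by auto
    then have "matrix (M (dil l t)) ** matrix (dil l) = matrix (dil l) ** matrix (M t)"
      by (metis lin linear_dil matrix_compose)
    then have "det (matrix (M (dil l t))) * det (matrix (dil l)) = det (matrix (dil l)) * det (matrix (M t))"
      by (metis det_mul)
    moreover have "det (matrix (dil l)) \<noteq> 0"
      by (subst det_diagonal) (auto simp: matrix_def dil_def axis_def)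
    ultimately show ?thesis by simp
  qed
  moreover have "((\<lambda>l. det (matrix (M (dil l t)))) \<longlongrightarrow> det (matrix (M 0))) (at_right 0)"
  proof (rule tendsto_det)
    fix i j
    have "isCont (\<lambda>t. M t (axis j 1) $ i) 0"
      using lim[of "axis j 1"] by (auto simp: isCont_def intro: tendsto_vec_nth)
    then have "((\<lambda>l. M (dil l t) (axis j 1) $ i) \<longlongrightarrow> M 0 (axis j 1) $ i) (at_right 0)"
      by (rule isCont_tendsto_compose[OF _ dil_tendsto_0])
    then show "((\<lambda>l. matrix (M (dil l t)) $ i $ j) \<longlongrightarrow> matrix (M 0) $ i $ j) (at_right 0)"
      by (simp add: matrix_def)
  qed
  moreover have "\<forall>\<^sub>F l in at_right (0::real). l > 0" by (simp add: eventually_at_right_less)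
  ultimately have "((\<lambda>l::real. det (matrix (M t))) \<longlongrightarrow> det (matrix (M 0))) (at_right 0)"
    by (rule_tac Lim_transform_eventually) (auto elim: eventually_mono)
  then have "det (matrix (M t)) = det (matrix (M 0))"
    by (simp add: tendsto_const_iff)
  then show ?thesis by (simp add: M0)
qed

lemma det_Psi_deriv: "det (matrix (coords \<circ> Psi_deriv t)) = 1"
proof (rule det_dil_invariant[of "\<lambda>t. coords \<circ> Psi_deriv t"])
  show "linear (coords \<circ> Psi_deriv t)" for t
    by (intro linear_compose linear_coords linear_Psi_deriv)
  show "((\<lambda>t. (coords \<circ> Psi_deriv t) h) \<longlongrightarrow> (coords \<circ> Psi_deriv 0) h) (at 0)" for h
    using bounded_linear.tendsto[OF linear_conv_bounded_linear[THEN iffD1, OF linear_coords] Psi_deriv_tendsto]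
    by (simp add: comp_def)
qed (auto simp: Psi_deriv_0 Psi_deriv_dil alg_dilation_eq)

text \<open>This is unimodularity of the group, the reason why right translations preserve Lebesgue
  measure in the coordinates.\<close>

lemma det_Ad_Psi: "det (matrix (coords \<circ> Ad (Psi t) \<circ> comb)) = 1"
proof (rule det_dil_invariant[of "\<lambda>t. coords \<circ> Ad (Psi t) \<circ> comb"])
  show "linear (coords \<circ> Ad (Psi t) \<circ> comb)" for t
    by (intro linear_compose linear_coords linear_Ad linear_comb)
  show "((\<lambda>t. (coords \<circ> Ad (Psi t) \<circ> comb) h) \<longlongrightarrow> (coords \<circ> Ad (Psi 0) \<circ> comb) h) (at 0)" for h
    using bounded_linear.tendsto[OF linear_conv_bounded_linear[THEN iffD1, OF linear_coords] Ad_Psi_tendsto, of "comb h" 0]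
    by (simp add: comp_def)
qed (auto simp: Ad_0 Ad_Psi_dil alg_dilation_comb[symmetric] coords_alg_dilation)

end

context homogeneous_coordinates
begin

section \<open>Local inversion of \<open>Psi\<close> and extension of the local dilation\<close>

lemma left_field_tendsto:
  assumes p: "p \<in> \<phi> ` U"
  shows "((\<lambda>p. left_field U \<phi> v p) \<longlongrightarrow> left_field U \<phi> v p) (at p)"
proof -
  have mem: "(p, \<phi> 0) \<in> chart_mult_dom" using p unit_chart by (auto simp: chart_inv_in)
  have "isCont (\<lambda>p. (p, \<phi> 0)) p" by (intro continuous_intros)
  moreover have "isCont (\<lambda>z. fderiv chart_mult z (0, v)) (p, \<phi> 0)"
    by (rule smooth_on_isCont_derivative[OF chart_mult_smooth mem])
  ultimately have "((\<lambda>p. fderiv chart_mult (p, \<phi> 0) (0, v)) \<longlongrightarrow>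
      fderiv chart_mult (p, \<phi> 0) (0, v)) (at p)"
    using isCont_o2[of p "\<lambda>p. (p, \<phi> 0)"] by (simp add: isCont_def)
  then have "((\<lambda>p. left_field U \<phi> v p) \<longlongrightarrow> fderiv chart_mult (p, \<phi> 0) (0, v)) (at p)"
  proof (rule Lim_transform_eventually)
    show "\<forall>\<^sub>F p in at p. fderiv chart_mult (p, \<phi> 0) (0, v) = left_field U \<phi> v p"
      using eventually_at_in_open'[OF open_chart_image p] by eventually_elim (simp add: chart_mult_derivative_right(2))
  qed
  then show ?thesis by (simp add: chart_mult_derivative_right(2)[OF p])
qed

lemma chart_has_derivative:
  assumes c: "has_log_deriv c L t" and U: "c t \<in> U"
  shows "((\<lambda>s. \<phi> (c s)) has_derivative (\<lambda>h. left_field U \<phi> (L h) (\<phi> (c t)))) (at t)"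
  by (rule has_log_deriv_compose[OF c])
    (use chart_mult_derivative_right(1)[of "\<phi> (c t)"] U in simp)

lemma linear_left_field: "p \<in> \<phi> ` U \<Longrightarrow> linear (\<lambda>v. left_field U \<phi> v p)"
  using chart_mult_derivative_right(1) by (rule has_derivative_linear)

text \<open>The last clause is differentiability of \<open>\<Theta>\<close> in left-trivialised form
  at every point of \<open>W\<close>, so that lifts of curves through \<open>\<Theta>\<close> are
  differentiable.\<close>

definition local_inverse :: "((real, 'n) vec) set \<Rightarrow> 'g set \<Rightarrow> ('g \<Rightarrow> (real, 'n) vec) \<Rightarrow> bool" where
  "local_inverse U' W \<Theta> \<longleftrightarrow> open U' \<and> 0 \<in> U' \<and> open W \<and> Psi ` U' = W \<and> (\<forall>t\<in>U'. \<Theta> (Psi t) = t) \<and>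
     continuous_on W \<Theta> \<and> (\<forall>x\<in>W. \<Theta> x \<in> U' \<and> Psi (\<Theta> x) = x) \<and>
     (\<forall>x\<in>W. (\<lambda>q. \<Theta> (x + chart_inv q)) differentiable at (\<phi> 0))"

lemma local_inverseD:
  assumes "local_inverse U' W \<Theta>"
  shows "open U'" "0 \<in> U'" "open W" "Psi ` U' = W" "\<And>t. t \<in> U' \<Longrightarrow> \<Theta> (Psi t) = t"
    "continuous_on W \<Theta>" "\<And>x. x \<in> W \<Longrightarrow> \<Theta> x \<in> U' \<and> Psi (\<Theta> x) = x"
    "\<And>x. x \<in> W \<Longrightarrow> (\<lambda>q. \<Theta> (x + chart_inv q)) differentiable at (\<phi> 0)" "0 \<in> W"
proof -
  show 0: "0 \<in> U'" and "open U'" "open W" and W: "Psi ` U' = W" and "\<And>t. t \<in> U' \<Longrightarrow> \<Theta> (Psi t) = t"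
    "continuous_on W \<Theta>" "\<And>x. x \<in> W \<Longrightarrow> \<Theta> x \<in> U' \<and> Psi (\<Theta> x) = x"
    "\<And>x. x \<in> W \<Longrightarrow> (\<lambda>q. \<Theta> (x + chart_inv q)) differentiable at (\<phi> 0)"
    using assms unfolding local_inverse_def by blast+
  show "0 \<in> W" using 0 W by (metis Psi_0 imageI)
qed

text \<open>The inverse function theorem applies to
  \<open>coords \<circ> \<phi> \<circ> Psi\<close>: its derivative is continuous because
  \<open>Psi_deriv\<close> and the left fields are, and it is the identity at \<open>0\<close>
  because \<open>Psi_deriv 0 = comb\<close>.\<close>

lemma local_inverse_exists:
  obtains U' W \<Theta> where "local_inverse U' W \<Theta>"
proof -
  let ?\<Omega> = "Psi -` U"
  let ?f = "\<lambda>t. coords (\<phi> (Psi t))"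
  have bl: "bounded_linear coords" using linear_coords by (simp add: linear_conv_bounded_linear)
  define F where "F t = (\<lambda>h. coords (left_field U \<phi> (Psi_deriv t h) (\<phi> (Psi t))))" for t
  define f' where "f' t = Blinfun (F t)" for t
  have open_\<Omega>: "open ?\<Omega>" by (rule open_vimage[OF open_U continuous_Psi])
  have 0: "0 \<in> ?\<Omega>" using unit_chart by simp
  have d: "(?f has_derivative F t) (at t)" if "t \<in> ?\<Omega>" for t
    unfolding F_def
    by (rule bounded_linear.has_derivative[OF bl])
      (use chart_has_derivative[OF Psi_has_log_deriv] that in auto)
  have f': "blinfun_apply (f' t) = F t" if "t \<in> ?\<Omega>" for t
    unfolding f'_def by (rule bounded_linear_Blinfun_apply) (rule has_derivative_bounded_linear[OF d[OF that]])
  have d': "(?f has_derivative blinfun_apply (f' t)) (at t)" if "t \<in> ?\<Omega>" for t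
    using d[OF that] f'[OF that] by simp
  have cont: "continuous_on ?\<Omega> f'"
  proof (rule continuous_on_blinfun_componentwise)
    fix h :: "(real, 'n) vec"
    have "((\<lambda>t. F t h) \<longlongrightarrow> F t h) (at t within ?\<Omega>)" if t: "t \<in> ?\<Omega>" for t
      unfolding F_def
    proof (rule bounded_linear.tendsto[OF bl])
      have pt: "\<phi> (Psi t) \<in> \<phi> ` U" using t by auto
      have "isCont (\<lambda>t. \<phi> (Psi t)) t"
        using has_derivative_continuous[OF chart_has_derivative[OF Psi_has_log_deriv]] t by auto
      then have lf: "((\<lambda>t. left_field U \<phi> v (\<phi> (Psi t))) \<longlongrightarrow> left_field U \<phi> v (\<phi> (Psi t))) (at t)" for v
        using isCont_o2[of t "\<lambda>t. \<phi> (Psi t)" "left_field U \<phi> v"] left_field_tendsto[OF pt] by (simp add: isCont_def)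
      have "((\<lambda>s. left_field U \<phi> (Psi_deriv s h) (\<phi> (Psi s))) \<longlongrightarrow> left_field U \<phi> (Psi_deriv t h) (\<phi> (Psi t))) (at t)"
      proof (rule tendsto_linear_family[where A="\<lambda>s v. left_field U \<phi> v (\<phi> (Psi s))", OF _ linear_left_field[OF pt] lf Psi_deriv_tendsto])
        show "\<forall>\<^sub>F s in at t. linear (\<lambda>v. left_field U \<phi> v (\<phi> (Psi s)))"
          using eventually_at_in_open'[OF open_\<Omega> t] by eventually_elim (auto intro: linear_left_field)
      qed
      then show "((\<lambda>s. left_field U \<phi> (Psi_deriv s h) (\<phi> (Psi s))) \<longlongrightarrow> left_field U \<phi> (Psi_deriv t h) (\<phi> (Psi t))) (at t within ?\<Omega>)"
        by (rule tendsto_within_subset) simp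
    qed
    then have "continuous_on ?\<Omega> (\<lambda>t. F t h)" unfolding continuous_on_def by blast
    then show "continuous_on ?\<Omega> (\<lambda>t. blinfun_apply (f' t) h)"
      by (rule continuous_on_eq) (simp add: f')
  qed
  have "F 0 = id" using unit_chart by (auto simp: F_def Psi_deriv_0 left_field_unit)
  then have "f' 0 = id_blinfun" using f'[OF 0] by (intro blinfun_eqI) simp
  then have inv: "id_blinfun o\<^sub>L f' 0 = id_blinfun" by (intro blinfun_eqI) simp
  obtain U' V g g' where IFT: "open U'" "U' \<subseteq> ?\<Omega>" "0 \<in> U'" "open V" "?f 0 \<in> V" "homeomorphism U' V ?f g"
    "\<And>y. y \<in> V \<Longrightarrow> (g has_derivative (g' y)) (at y)"
  proof (rule inverse_function_theorem[OF open_\<Omega> d' cont 0 inv])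
    fix U' V g g'
    assume *: "open U'" "U' \<subseteq> ?\<Omega>" "0 \<in> U'" "open V" "?f 0 \<in> V" "homeomorphism U' V ?f g"
      "\<And>y. y \<in> V \<Longrightarrow> (g has_derivative (g' y)) (at y)"
    show thesis by (rule that[OF *])
  qed
  let ?W = "U \<inter> (\<lambda>x. coords (\<phi> x)) -` V"
  let ?\<Theta> = "\<lambda>x. g (coords (\<phi> x))"
  have cf: "continuous_on U (\<lambda>x. coords (\<phi> x))"
    using bounded_linear.continuous_on[OF bl chart_continuous[OF unit_chart(1)]] .
  have openW: "open ?W" by (rule continuous_open_preimage[OF cf open_U IFT(4)])
  have \<Theta>Psi: "?\<Theta> (Psi t) = t" if "t \<in> U'" for t
    using homeomorphism_apply1[OF IFT(6) that] .
  have Psi\<Theta>: "?\<Theta> x \<in> U' \<and> Psi (?\<Theta> x) = x" if x: "x \<in> ?W" for x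
  proof
    show "?\<Theta> x \<in> U'" using homeomorphism_image2[OF IFT(6)] x by blast
    then have "Psi (?\<Theta> x) \<in> U" using IFT(2) by blast
    moreover have "coords (\<phi> (Psi (?\<Theta> x))) = coords (\<phi> x)"
      using homeomorphism_apply2[OF IFT(6)] x by blast
    then have "\<phi> (Psi (?\<Theta> x)) = \<phi> x" by (metis comb_coords)
    ultimately show "Psi (?\<Theta> x) = x" using x by (metis IntD1 chart_inv_\<phi>)
  qed
  have image: "Psi ` U' = ?W"
  proof
    show "Psi ` U' \<subseteq> ?W" using IFT(2) homeomorphism_image1[OF IFT(6)] by auto
    show "?W \<subseteq> Psi ` U'" using Psi\<Theta> by force
  qed
  have cont\<Theta>: "continuous_on ?W ?\<Theta>"
    by (rule continuous_on_compose2[OF homeomorphism_cont2[OF IFT(6)] continuous_on_subset[OF cf]]) auto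
  have diff: "(\<lambda>q. ?\<Theta> (x + chart_inv q)) differentiable at (\<phi> 0)" if "x \<in> ?W" for x
  proof -
    have "((\<lambda>q. \<phi> (x + chart_inv q)) has_derivative (\<lambda>v. left_field U \<phi> v (\<phi> x))) (at (\<phi> 0))"
      using chart_mult_derivative_right(1)[of "\<phi> x"] that by simp
    from has_derivative_compose[OF bounded_linear.has_derivative[OF bl this], of g] IFT(7) that show ?thesis
      unfolding differentiable_def by auto
  qed
  show thesis
    by (rule that[of U' ?W ?\<Theta>])
      (use IFT(1,3) openW image \<Theta>Psi cont\<Theta> Psi\<Theta> diff in \<open>unfold local_inverse_def, intro conjI ballI\<close>; blast?)
qed

lemma has_log_deriv_unique:
  assumes "has_log_deriv c L t" "has_log_deriv c K t"
  shows "L = K"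
  using assms unfolding has_log_deriv_def by (blast intro: has_derivative_unique)

lemma has_log_deriv_cong:
  assumes "has_log_deriv c L t" "\<forall>\<^sub>F s in at t. c s = d s" "c t = d t"
  shows "has_log_deriv d L t"
proof -
  have "(c \<longlongrightarrow> d t) (at t)" and D: "((\<lambda>s. \<phi> (- c t + c s)) has_derivative L) (at t)"
    using assms unfolding has_log_deriv_def by auto
  then have "(d \<longlongrightarrow> d t) (at t)" using assms(2) by (rule_tac Lim_transform_eventually)
  moreover have "((\<lambda>s. \<phi> (- d t + d s)) has_derivative L) (at t)"
  proof (rule has_derivative_transform_eventually[OF D])
    show "\<forall>\<^sub>F s in at t. \<phi> (- c t + c s) = \<phi> (- d t + d s)"
      using assms(2) by eventually_elim (simp only: assms(3))
  qed (use assms(3) in auto)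
  ultimately show ?thesis by (simp add: has_log_deriv_def)
qed

text \<open>Uniqueness of logarithmic derivatives determines the velocity of a lift without
  inverting \<open>Psi_deriv\<close>.\<close>

lemma Psi_lift_derivative:
  assumes c: "has_log_deriv c L t" and \<tau>: "(\<tau> has_derivative T) (at t)"
    and eq: "\<forall>\<^sub>F s in at t. Psi (\<tau> s) = c s" "Psi (\<tau> t) = c t"
  shows "Psi_deriv (\<tau> t) (T h) = L h"
proof -
  have "has_log_deriv (\<lambda>s. Psi (\<tau> s)) (\<lambda>h. Psi_deriv (\<tau> t) (T h)) t"
    by (rule has_log_deriv_chain[OF Psi_has_log_deriv \<tau>])
  from has_log_deriv_unique[OF has_log_deriv_cong[OF this eq] c]
  show ?thesis by (rule fun_cong)
qed

text \<open>With \<open>h = Psi \<circ> dil l \<circ> \<Theta>\<close> and a curve \<open>c\<close> from \<open>0\<close> to \<open>y\<close>, the curves \<open>h (x + c s)\<close> and \<open>h (c s)\<close>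
  have the same logarithmic derivative; hence \<open>h (x + y) - h y = h x\<close> near the unit.\<close>

lemma dilation_extends:
  assumes l: "l > 0"
  obtains H r where "r > 0" "\<And>x y. H (x + y) = H x + H y" "\<And>t. t \<in> ball 0 r \<Longrightarrow> H (Psi t) = Psi (dil l t)"
proof -
  obtain U' W \<Theta> where L: "local_inverse U' W \<Theta>" by (rule local_inverse_exists)
  note loc = local_inverseD[OF L]
  note W0 = loc(9)
  define h where "h x = Psi (dil l (\<Theta> x))" for x
  have hPsi: "h (Psi t) = Psi (dil l t)" if "t \<in> U'" for t using loc(5)[OF that] by (simp add: h_def)
  \<comment> \<open>Ensures that \<open>x + c s\<close> stays in \<open>W\<close>: the sum is read
    as \<open>- (- x) + c s\<close>, which is why the negatives of \<open>W1\<close> occur in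
    \<open>?W2\<close>.\<close>
  obtain W1 where W1: "open W1" "0 \<in> W1" "\<And>x y. x \<in> W1 \<Longrightarrow> y \<in> W1 \<Longrightarrow> - x + y \<in> W"
    using nhds_zero_diff[OF loc(3) W0] by metis
  let ?W2 = "W1 \<inter> uminus -` W1 \<inter> W"
  have openW2: "open ?W2" by (intro open_Int open_vimage W1(1) loc(3) continuous_on_minus continuous_on_id)
  have W2: "0 \<in> ?W2" using W1(2) W0 by simp
  have "open (Psi -` ?W2 \<inter> U')" by (intro open_Int open_vimage openW2 continuous_Psi loc(1))
  moreover have "0 \<in> Psi -` ?W2 \<inter> U'" using W2 loc(2) by simp
  ultimately obtain r where r: "r > 0" "ball 0 r \<subseteq> Psi -` ?W2 \<inter> U'" using open_contains_ball by blast
  let ?V = "Psi ` ball 0 r"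
  have V_eq: "?V = W \<inter> \<Theta> -` ball 0 r"
  proof
    show "?V \<subseteq> W \<inter> \<Theta> -` ball 0 r" using r(2) loc(4,5) by auto
    show "W \<inter> \<Theta> -` ball 0 r \<subseteq> ?V" using loc(7) by force
  qed
  have openV: "open ?V"
    unfolding V_eq by (rule continuous_open_preimage[OF loc(6,3)]) simp
  have V0: "0 \<in> ?V" using r(1) Psi_0 by (metis centre_in_ball imageI)
  have hom: "h (x + y) = h x + h y" if x: "x \<in> ?V" and y: "y \<in> ?V" for x y
  proof -
    obtain y0 where y0: "y0 \<in> ball 0 r" "y = Psi y0" using y by blast
    let ?S = "(\<lambda>s. s *\<^sub>R y0) -` ball 0 r"
    have openS: "open ?S" by (intro open_vimage continuous_intros) simp
    have connS: "connected ?S"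
    proof (rule convex_connected, rule convex_linear_vimage)
      show "linear (\<lambda>s. s *\<^sub>R y0)" by (rule linearI) (simp_all add: scaleR_left_distrib)
    qed simp
    define c where "c s = Psi (s *\<^sub>R y0)" for s
    have der_c: "has_log_deriv c (\<lambda>k. Psi_deriv (s *\<^sub>R y0) (k *\<^sub>R y0)) s" for s
      unfolding c_def[abs_def]
      by (rule has_log_deriv_chain[OF Psi_has_log_deriv]) (auto intro!: derivative_eq_intros)
    have inW: "x + c s \<in> W" "c s \<in> W" if s: "s \<in> ?S" for s
    proof -
      have "s *\<^sub>R y0 \<in> ball 0 r" using s by (rule vimageD)
      then have "Psi (s *\<^sub>R y0) \<in> ?W2" using r(2) by blast
      moreover have "x \<in> ?W2" using x r(2) by blast
      ultimately show "x + c s \<in> W" "c s \<in> W" using W1(3)[of "- x" "c s"] by (auto simp: c_def)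
    qed
    have der_xc: "has_log_deriv (\<lambda>s. x + c s) (\<lambda>k. Psi_deriv (s *\<^sub>R y0) (k *\<^sub>R y0)) s" for s
      by (rule has_log_deriv_left_translation[OF der_c])
    \<comment> \<open>The curve is lifted through \<open>\<Theta>\<close>, dilated, and mapped back
      by \<open>Psi\<close>; equivariance of \<open>Psi_deriv\<close> dilates \<open>L\<close>. The
      outcome depends on \<open>d\<close> only through \<open>L\<close>, so \<open>x + c s\<close>
      and \<open>c s\<close> give the same.\<close>
    have der_h: "has_log_deriv (\<lambda>s. h (d s)) (\<lambda>k. alg_dilation A l (L k)) s"
      if d: "has_log_deriv d L s" and dS: "\<And>s. s \<in> ?S \<Longrightarrow> d s \<in> W" and s: "s \<in> ?S" for d :: "real \<Rightarrow> 'g" and L s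
    proof -
      obtain T where T: "((\<lambda>s. \<Theta> (d s)) has_derivative T) (at s)"
        using loc(8)[OF dS[OF s]] has_log_deriv_compose[OF d] unfolding differentiable_def by blast
      have "\<forall>\<^sub>F s in at s. Psi (\<Theta> (d s)) = d s"
        using eventually_at_in_open'[OF openS s] by eventually_elim (use loc(7) dS in blast)
      from Psi_lift_derivative[OF d T this] have T': "Psi_deriv (\<Theta> (d s)) (T k) = L k" for k
        using loc(7) dS s by blast
      have "((\<lambda>s. dil l (\<Theta> (d s))) has_derivative (\<lambda>k. dil l (T k))) (at s)"
        by (rule bounded_linear.has_derivative[OF bounded_linear_dil T])
      from has_log_deriv_chain[OF Psi_has_log_deriv this]
      show ?thesis unfolding h_def[abs_def] by (simp add: Psi_deriv_dil[OF l] T')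
    qed
    have S01: "0 \<in> ?S" "1 \<in> ?S" using r(1) y0(1) by simp_all
    have "h (x + c 1) - h (c 1) = h (x + c 0) - h (c 0)"
      by (rule equal_log_deriv_diff_constant[OF openS connS _ _ S01(2,1)])
        (rule der_h[OF der_xc] der_h[OF der_c]; use inW in blast)+
    moreover have "c 0 = 0" "c 1 = y" using y0 by (simp_all add: c_def)
    moreover have "h 0 = 0" using hPsi[OF loc(2)] by simp
    ultimately have "h (x + y) - h y = h x" by simp
    then show ?thesis by (metis diff_add_cancel)
  qed
  \<comment> \<open>All left differences along the connecting paths have to lie in
    \<open>?V\<close>; radial paths whose images stay in \<open>V'\<close> have this
    property.\<close>
  obtain V' where V': "open V'" "0 \<in> V'" "\<And>x y. x \<in> V' \<Longrightarrow> y \<in> V' \<Longrightarrow> - x + y \<in> ?V"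
    using nhds_zero_diff[OF openV V0] by metis
  have "open (Psi -` V')" by (intro open_vimage V'(1) continuous_Psi)
  then obtain r' where r': "r' > 0" "ball 0 r' \<subseteq> Psi -` V'" using V'(2) open_contains_ball by (metis Psi_0 vimageI)
  define \<rho> where "\<rho> = min r r'"
  have \<rho>: "\<rho> > 0" "ball 0 \<rho> \<subseteq> Psi -` V'" "ball (0::(real, 'n) vec) \<rho> \<subseteq> ball 0 r" using r' r(1) by (auto simp: \<rho>_def)
  have W\<rho>: "Psi ` ball 0 \<rho> = W \<inter> \<Theta> -` ball 0 \<rho>"
  proof
    show "Psi ` ball 0 \<rho> \<subseteq> W \<inter> \<Theta> -` ball 0 \<rho>" using \<rho>(3) r(2) loc(4,5) by auto
    show "W \<inter> \<Theta> -` ball 0 \<rho> \<subseteq> Psi ` ball 0 \<rho>" using loc(7) by force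
  qed
  obtain H where H: "\<And>x y. H (x + y) = H x + H y" "\<And>x. x \<in> Psi ` ball 0 \<rho> \<Longrightarrow> H x = h x"
  proof (rule local_hom_extends[OF simply_connected connected openV V0, of h "Psi ` ball 0 \<rho>"])
    show "open (Psi ` ball 0 \<rho>)" unfolding W\<rho> by (rule continuous_open_preimage[OF loc(6,3)]) simp
    show "0 \<in> Psi ` ball 0 \<rho>" using \<rho>(1) Psi_0 by (metis centre_in_ball imageI)
    show "\<exists>c. path c \<and> c 0 = 0 \<and> c 1 = x \<and> (\<forall>s\<in>{0..1}. \<forall>t\<in>{0..1}. - c s + c t \<in> ?V)"
      if x: "x \<in> Psi ` ball 0 \<rho>" for x
    proof -
      obtain y0 where y0: "y0 \<in> ball 0 \<rho>" "x = Psi y0" using x by blast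
      have "Psi (s *\<^sub>R y0) \<in> V'" if "s \<in> {0..1}" for s
      proof -
        have "norm (s *\<^sub>R y0) \<le> 1 * norm y0" using that unfolding norm_scaleR by (intro mult_right_mono) auto
        then have "s *\<^sub>R y0 \<in> ball 0 \<rho>" using y0(1) by simp
        then show ?thesis using \<rho>(2) by blast
      qed
      moreover have "path (\<lambda>s. Psi (s *\<^sub>R y0))"
        unfolding path_def by (rule continuous_on_compose2[OF continuous_Psi]) (auto intro!: continuous_intros)
      ultimately show ?thesis using V'(3) y0(2) by (intro exI[of _ "\<lambda>s. Psi (s *\<^sub>R y0)"]) auto
    qed
  qed (use hom in auto)
  show thesis
  proof (rule that[OF \<rho>(1) H(1)])
    show "H (Psi t) = Psi (dil l t)" if "t \<in> ball 0 \<rho>" for t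
    proof -
      have "t \<in> U'" using that \<rho>(3) r(2) by blast
      then show ?thesis using H(2)[of "Psi t"] hPsi that by simp
    qed
  qed
qed

end

section \<open>The dilations of the group\<close>

context homogeneous_coordinates
begin

lemma eprod_axis: "distinct is \<Longrightarrow> eprod is (axis i s) = (if i \<in> set is then E (s *\<^sub>R e i) else 0)"
  by (induction "is") (auto simp: axis_def)

lemma Psi_axis: "Psi (axis i s) = E (s *\<^sub>R e i)"
  unfolding Psi_def by (subst eprod_axis) auto

text \<open>The extended homomorphism is known on a small ball only. Its value at
  \<open>E (s *\<^sub>R e i)\<close> is fixed by that at a small fraction \<open>s / n\<close> of
  the parameter, and \<open>Psi\<close> is a product of such elements.\<close>

lemma group_dilation_exists:
  assumes l: "l > 0"
  shows "\<exists>H. (\<forall>x y. H (x + y) = H x + H y) \<and> (\<forall>t. H (Psi t) = Psi (dil l t))"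
proof -
  obtain H r where r: "r > 0" and add: "\<And>x y. H (x + y) = H x + H y" and H: "\<And>t. t \<in> ball 0 r \<Longrightarrow> H (Psi t) = Psi (dil l t)"
    using dilation_extends[OF l] by metis
  let ?k = "\<lambda>i. exp (ln l * \<nu> i)"
  have H0: "H 0 = 0" using add[of 0 0] idempotent_zero by simp
  have small: "H (E (s *\<^sub>R e i)) = E ((?k i * s) *\<^sub>R e i)" if "\<bar>s\<bar> < r" for s i
  proof -
    have "axis i s = s *\<^sub>R axis i (1::real)" by (simp add: axis_def vec_eq_iff)
    then have "axis i s \<in> ball 0 r" using that by (simp add: norm_axis_1)
    from H[OF this] have "H (E (s *\<^sub>R e i)) = Psi (dil l (axis i s))" by (simp add: Psi_axis)
    also have "dil l (axis i s) = axis i (?k i * s)" by (auto simp: dil_def axis_def vec_eq_iff)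
    finally show ?thesis by (simp add: Psi_axis)
  qed
  have HE: "H (E (s *\<^sub>R e i)) = E ((?k i * s) *\<^sub>R e i)" for s i
  proof -
    obtain n :: nat where n: "\<bar>s\<bar> / r < real n" using reals_Archimedean2 by blast
    have n0: "n > 0" using n r by (cases "n = 0") (auto simp: field_simps)
    have "\<bar>s / n\<bar> < r" using n n0 r by (simp add: field_simps)
    note 1 = small[OF this, of i]
    have "H (E ((real m * (s / n)) *\<^sub>R e i)) = E ((real m * (?k i * (s / n))) *\<^sub>R e i)" for m :: nat
    proof (induction m)
      case (Suc m)
      have "E ((real (Suc m) * (s / n)) *\<^sub>R e i) = E ((real m * (s / n)) *\<^sub>R e i) + E ((s / n) *\<^sub>R e i)"
        unfolding E_add[symmetric] by (rule arg_cong[of _ _ "\<lambda>r. E (r *\<^sub>R e i)"]) (simp add: algebra_simps add_divide_distrib)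
      moreover have "E ((real (Suc m) * (?k i * (s / n))) *\<^sub>R e i)
          = E ((real m * (?k i * (s / n))) *\<^sub>R e i) + E ((?k i * (s / n)) *\<^sub>R e i)"
        unfolding E_add[symmetric] by (rule arg_cong[of _ _ "\<lambda>r. E (r *\<^sub>R e i)"]) (simp add: algebra_simps add_divide_distrib)
      ultimately show ?case using Suc 1 by (simp only: add)
    qed (simp add: H0)
    from this[of n] show ?thesis using n0 by simp
  qed
  have "H (eprod is t) = eprod is (dil l t)" for "is" t
    by (induction "is") (simp_all add: H0 add HE dil_def)
  then show ?thesis using add unfolding Psi_def by blast
qed

definition gdil :: "real \<Rightarrow> 'g \<Rightarrow> 'g" where
  "gdil l = (SOME H. (\<forall>x y. H (x + y) = H x + H y) \<and> (\<forall>t. H (Psi t) = Psi (dil l t)))"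

lemma gdil_add: "l > 0 \<Longrightarrow> gdil l (x + y) = gdil l x + gdil l y"
  and gdil_Psi: "l > 0 \<Longrightarrow> gdil l (Psi t) = Psi (dil l t)"
  using someI_ex[OF group_dilation_exists, of l] unfolding gdil_def by blast+

lemma gdil_0[simp]: "l > 0 \<Longrightarrow> gdil l 0 = 0"
  using gdil_Psi[of l 0] by simp

lemma gdil_minus: "l > 0 \<Longrightarrow> gdil l (- x) = - gdil l x"
  using gdil_add[of l "- x" x] by (simp add: eq_neg_iff_add_eq_0)

text \<open>The image of \<open>Psi\<close> contains a neighbourhood of the unit and the group is
  connected. Identities between homomorphisms can thus be checked on \<open>Psi t\<close> before
  \<open>Psi\<close> is known to be onto.\<close>

lemma Psi_generates:
  assumes "\<And>t. Psi t \<in> S" "\<And>x y. x \<in> S \<Longrightarrow> y \<in> S \<Longrightarrow> x + y \<in> S" "\<And>x. x \<in> S \<Longrightarrow> - x \<in> S"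
  shows "x \<in> S"
proof -
  obtain U' W \<Theta> where L: "local_inverse U' W \<Theta>" by (rule local_inverse_exists)
  note loc = local_inverseD[OF L]
  have "S = UNIV"
    using assms loc by (intro connected_group_generated[OF connected, of W]) auto
  then show ?thesis by simp
qed

lemma gdil_gdil: 
  assumes "l > 0" "m > 0"
  shows "gdil l (gdil m x) = gdil (l * m) x"
  using Psi_generates[of "{x. gdil l (gdil m x) = gdil (l * m) x}" x] assms
  by (simp add: gdil_Psi dil_mult gdil_add gdil_minus)

lemma gdil_1[simp]: "gdil 1 x = x"
  using Psi_generates[of "{x. gdil 1 x = x}" x] by (simp add: gdil_Psi gdil_add gdil_minus)

lemma gdil_inverse: "l > 0 \<Longrightarrow> gdil l (gdil (1 / l) x) = x" "l > 0 \<Longrightarrow> gdil (1 / l) (gdil l x) = x"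
  by (simp_all add: gdil_gdil)

lemma gdil_tendsto_0: "((\<lambda>l. gdil l x) \<longlongrightarrow> 0) (at_right 0)"
proof -
  let ?S = "{x. ((\<lambda>l. gdil l x) \<longlongrightarrow> 0) (at_right 0)}"
  have S: "y \<in> ?S" if "(F \<longlongrightarrow> 0) (at_right 0)" "\<And>l. l > 0 \<Longrightarrow> F l = gdil l y" for y F
  proof -
    have "\<forall>\<^sub>F l in at_right 0. F l = gdil l y"
      using eventually_at_right_less[of "0::real"] by eventually_elim (rule that(2))
    then show ?thesis using Lim_transform_eventually[OF that(1)] by simp
  qed
  have "x \<in> ?S"
  proof (rule Psi_generates)
    fix t
    have "((\<lambda>l. Psi (dil l t)) \<longlongrightarrow> Psi 0) (at_right 0)"
      by (rule isCont_tendsto_compose[OF _ dil_tendsto_0]) (use Psi_tendsto[of 0] in \<open>simp add: isCont_def\<close>)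
    then show "Psi t \<in> ?S" by (intro S[of "\<lambda>l. Psi (dil l t)"]) (simp_all add: gdil_Psi)
  next
    fix x y assume "x \<in> ?S" "y \<in> ?S"
    then show "x + y \<in> ?S"
      using tendsto_add[of "\<lambda>l. gdil l x" 0 _ "\<lambda>l. gdil l y" 0]
      by (intro S[of "\<lambda>l. gdil l x + gdil l y"]) (simp_all add: gdil_add)
  next
    fix x assume "x \<in> ?S"
    then show "- x \<in> ?S"
      using tendsto_minus[of "\<lambda>l. gdil l x" 0] by (intro S[of "\<lambda>l. - gdil l x"]) (simp_all add: gdil_minus)
  qed
  then show ?thesis by simp
qed

lemma gdil_enters:
  assumes "open V" "0 \<in> V"
  obtains l where "l > 0" "gdil l x \<in> V"
proof -
  have "\<forall>\<^sub>F l in at_right (0::real). gdil l x \<in> V \<and> l > 0"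
    by (intro eventually_conj topological_tendstoD[OF gdil_tendsto_0] assms) (simp add: eventually_at_right_less)
  then have "\<exists>l. gdil l x \<in> V \<and> l > 0" by (rule eventually_happens'[rotated]) simp
  then show thesis using that by blast
qed

lemma bij_Psi: "bij Psi"
proof (rule bijI)
  obtain U' W \<Theta> where L: "local_inverse U' W \<Theta>" by (rule local_inverse_exists)
  note loc = local_inverseD[OF L]
  show "inj Psi"
  proof (rule injI)
    fix s t assume eq: "Psi s = Psi t"
    have "\<forall>\<^sub>F l in at_right (0::real). dil l s \<in> U' \<and> dil l t \<in> U' \<and> l > 0"
      by (intro eventually_conj topological_tendstoD[OF dil_tendsto_0] loc) (simp add: eventually_at_right_less)
    then have "\<exists>l. dil l s \<in> U' \<and> dil l t \<in> U' \<and> l > 0" by (rule eventually_happens'[rotated]) simp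
    then obtain l where l: "dil l s \<in> U'" "dil l t \<in> U'" "l > 0" by blast
    have "Psi (dil l s) = Psi (dil l t)" using gdil_Psi[OF l(3)] eq by metis
    then have "dil l s = dil l t" using loc(5)[OF l(1)] loc(5)[OF l(2)] by metis
    then show "s = t" using dil_inverse(2)[OF l(3)] by metis
  qed
  show "surj Psi"
  proof -
    have "x \<in> range Psi" for x
    proof -
      obtain l where l: "l > 0" "gdil l x \<in> W" by (rule gdil_enters[OF loc(3) loc(9)])
      then obtain t where t: "gdil l x = Psi t" using loc(4) by blast
      have "x = gdil (1 / l) (Psi t)" using gdil_inverse(2)[OF l(1), of x] t by simp
      also have "\<dots> = Psi (dil (1 / l) t)" using l(1) by (simp add: gdil_Psi)
      finally show ?thesis by blast
    qed
    then show ?thesis by blast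
  qed
qed

definition clog :: "'g \<Rightarrow> (real, 'n) vec" where "clog = inv Psi"

lemma clog_Psi[simp]: "clog (Psi t) = t" and Psi_clog[simp]: "Psi (clog x) = x"
  using bij_Psi by (auto simp: clog_def bij_is_inj bij_is_surj surj_f_inv_f)

text \<open>Differentiating \<open>Psi (\<Theta> x) = x\<close> at the unit shows that
  \<open>\<Theta>\<close> has derivative \<open>coords\<close> there; hence
  \<open>Psi \<circ> dil l \<circ> \<Theta>\<close> has derivative
  \<open>comb \<circ> dil l \<circ> coords\<close>.\<close>

lemma gdil_has_derivative:
  assumes l: "l > 0"
  shows "((\<lambda>q. \<phi> (gdil l (chart_inv q))) has_derivative alg_dilation A l) (at (\<phi> 0))"
proof -
  obtain U' W \<Theta> where L: "local_inverse U' W \<Theta>" by (rule local_inverse_exists)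
  note loc = local_inverseD[OF L]
  obtain T where T: "((\<lambda>q. \<Theta> (chart_inv q)) has_derivative T) (at (\<phi> 0))"
    using loc(8)[OF loc(9)] unfolding differentiable_def by auto
  have \<Theta>0: "\<Theta> 0 = 0" using loc(5)[OF loc(2)] by simp
  let ?S = "{p \<in> \<phi> ` U. chart_inv p \<in> W}"
  have S: "open ?S" "\<phi> 0 \<in> ?S"
    using open_chart_preimage[OF unit_chart(1) loc(3), of "\<lambda>x. x"] loc(9) unit_chart by (auto simp: continuous_on_id)
  have "has_log_deriv (\<lambda>q. Psi (\<Theta> (chart_inv q))) (\<lambda>h. Psi_deriv (\<Theta> (chart_inv (\<phi> 0))) (T h)) (\<phi> 0)"
    by (rule has_log_deriv_chain[OF Psi_has_log_deriv T])
  then have "((\<lambda>q. \<phi> (Psi (\<Theta> (chart_inv q)))) has_derivative (\<lambda>h. comb (T h))) (at (\<phi> 0))"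
    unfolding has_log_deriv_def by (simp add: \<Theta>0 Psi_deriv_0)
  then have "((\<lambda>q. q) has_derivative (\<lambda>h. comb (T h))) (at (\<phi> 0))"
    by (rule has_derivative_transform_within_open[OF _ S]) (use loc(7) in \<open>auto simp: \<phi>_chart_inv\<close>)
  from has_derivative_unique[OF this has_derivative_ident] have "comb (T h) = h" for h by (rule fun_cong)
  then have Th: "T h = coords h" for h by (metis coords_comb)
  have "((\<lambda>q. dil l (\<Theta> (chart_inv q))) has_derivative (\<lambda>h. dil l (T h))) (at (\<phi> 0))"
    by (rule bounded_linear.has_derivative[OF bounded_linear_dil T])
  from has_log_deriv_chain[OF Psi_has_log_deriv this]
  have "((\<lambda>q. \<phi> (Psi (dil l (\<Theta> (chart_inv q))))) has_derivative (\<lambda>h. comb (dil l (T h)))) (at (\<phi> 0))"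
    unfolding has_log_deriv_def by (simp add: \<Theta>0 Psi_deriv_0)
  then have "((\<lambda>q. \<phi> (gdil l (chart_inv q))) has_derivative (\<lambda>h. comb (dil l (T h)))) (at (\<phi> 0))"
    by (rule has_derivative_transform_within_open[OF _ S]) (use loc(7) gdil_Psi[OF l, symmetric] in auto)
  then show ?thesis by (simp add: Th alg_dilation_eq[abs_def])
qed

text \<open>A homomorphism continuous at the unit is continuous. Near any \<open>x\<close> the
  inverse of \<open>Psi\<close> is \<open>dil (1 / l) \<circ> \<Theta> \<circ> gdil l\<close>, for a
  ratio \<open>l\<close> that brings \<open>x\<close> into \<open>W\<close>.\<close>

lemma continuous_clog: "continuous_on UNIV clog"
  and gdil_continuous: "l > 0 \<Longrightarrow> continuous_on UNIV (gdil l)"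
proof -
  obtain U' W \<Theta> where L: "local_inverse U' W \<Theta>" by (rule local_inverse_exists)
  note loc = local_inverseD[OF L]
  have dil_cont: "continuous_on UNIV (dil l)" for l
    by (rule linear_continuous_on[OF bounded_linear_dil])
  have gd: "continuous_on UNIV (gdil l)" if l: "l > 0" for l
  proof -
    have "continuous_on W (\<lambda>x. Psi (dil l (\<Theta> x)))"
      by (rule continuous_on_compose2[OF continuous_Psi continuous_on_compose2[OF dil_cont loc(6)]]) auto
    then have "continuous_on W (gdil l)"
      by (rule continuous_on_eq) (use loc(7) gdil_Psi[OF l] in metis)
    then have "isCont (gdil l) 0" using loc(3) loc(9) by (simp add: continuous_on_eq_continuous_at)
    then have "(gdil l \<longlongrightarrow> gdil l 0) (nhds 0)" unfolding isCont_def tendsto_at_iff_tendsto_nhds .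
    then have g0: "(gdil l \<longlongrightarrow> 0) (nhds 0)" using l by simp
    have "(gdil l \<longlongrightarrow> gdil l x) (at x)" for x
    proof -
      have "((\<lambda>y. - x + y) \<longlongrightarrow> - x + x) (at x)" by (intro tendsto_intros)
      then have "((\<lambda>y. gdil l (- x + y)) \<longlongrightarrow> 0) (at x)"
        by (intro filterlim_compose[OF g0]) simp
      then have "((\<lambda>y. gdil l x + gdil l (- x + y)) \<longlongrightarrow> gdil l x + 0) (at x)" by (intro tendsto_add tendsto_const)
      moreover have "gdil l x + gdil l (- x + y) = gdil l y" for y
        using l by (simp add: gdil_add gdil_minus add.assoc[symmetric])
      ultimately show ?thesis by simp
    qed
    then show ?thesis by (simp add: continuous_on_def)
  qed
  show "continuous_on UNIV (gdil l)" if "l > 0" using gd[OF that] .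
  have "isCont clog x" for x
  proof -
    obtain l where l: "l > 0" "gdil l x \<in> W" by (rule gdil_enters[OF loc(3) loc(9)])
    have "open (gdil l -` W)" by (rule open_vimage[OF loc(3) gd[OF l(1)]])
    moreover have "continuous_on (gdil l -` W) (\<lambda>y. dil (1 / l) (\<Theta> (gdil l y)))"
      by (rule continuous_on_compose2[OF dil_cont continuous_on_compose2[OF loc(6) continuous_on_subset[OF gd[OF l(1)]]]]) auto
    moreover have "dil (1 / l) (\<Theta> (gdil l y)) = clog y" if "y \<in> gdil l -` W" for y
    proof -
      have "Psi (dil (1 / l) (\<Theta> (gdil l y))) = gdil (1 / l) (Psi (\<Theta> (gdil l y)))"
        using l(1) by (simp add: gdil_Psi)
      also have "\<dots> = gdil (1 / l) (gdil l y)" using loc(7)[of "gdil l y"] that by simp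
      also have "\<dots> = y" by (rule gdil_inverse(2)[OF l(1)])
      finally have "Psi (dil (1 / l) (\<Theta> (gdil l y))) = y" .
      then show ?thesis by (metis clog_Psi)
    qed
    ultimately have "continuous_on (gdil l -` W) clog" by (metis (no_types, lifting) continuous_on_cong)
    then show ?thesis using \<open>open (gdil l -` W)\<close> l(2) by (simp add: continuous_on_eq_continuous_at)
  qed
  then show "continuous_on UNIV clog" by (simp add: continuous_at_imp_continuous_on)
qed

lemma gdil_has_log_deriv:
  assumes l: "l > 0" and c: "has_log_deriv c L t"
  shows "has_log_deriv (\<lambda>s. gdil l (c s)) (\<lambda>h. alg_dilation A l (L h)) t"
proof -
  have "((\<lambda>s. \<phi> (gdil l (- c t + c s))) has_derivative (\<lambda>h. alg_dilation A l (L h))) (at t)"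
    by (rule has_log_deriv_compose[OF c, where F="\<lambda>x. \<phi> (gdil l (- c t + x))"])
      (use gdil_has_derivative[OF l] in \<open>simp add: add.assoc[symmetric]\<close>)
  moreover have "((\<lambda>s. gdil l (c s)) \<longlongrightarrow> gdil l (c t)) (at t)"
  proof (rule isCont_tendsto_compose[where g="gdil l" and f=c])
    show "isCont (gdil l) (c t)" using gdil_continuous[OF l] by (simp add: continuous_on_eq_continuous_at)
    show "(c \<longlongrightarrow> c t) (at t)" using c by (simp add: has_log_deriv_def)
  qed
  ultimately show ?thesis unfolding has_log_deriv_def using l by (simp add: gdil_add gdil_minus)
qed

lemma clog_differentiable:
  assumes c: "has_log_deriv c L t"
  shows "(\<lambda>s. clog (c s)) differentiable at t"
proof -
  obtain U' W \<Theta> where L: "local_inverse U' W \<Theta>" by (rule local_inverse_exists)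
  note loc = local_inverseD[OF L]
  obtain l where l: "l > 0" "gdil l (c t) \<in> W" by (rule gdil_enters[OF loc(3) loc(9)])
  note gc = gdil_has_log_deriv[OF l(1) c]
  obtain D where "((\<lambda>q. \<Theta> (gdil l (c t) + chart_inv q)) has_derivative D) (at (\<phi> 0))"
    using loc(8)[OF l(2)] unfolding differentiable_def by blast
  from has_log_deriv_compose[OF gc, where F=\<Theta>, OF this]
  have "((\<lambda>s. dil (1 / l) (\<Theta> (gdil l (c s)))) has_derivative (\<lambda>h. dil (1 / l) (D (alg_dilation A l (L h))))) (at t)"
    by (rule bounded_linear.has_derivative[OF bounded_linear_dil])
  then have "((\<lambda>s. clog (c s)) has_derivative (\<lambda>h. dil (1 / l) (D (alg_dilation A l (L h))))) (at t)"
  proof (rule has_derivative_transform_eventually)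
    have eq: "dil (1 / l) (\<Theta> y) = clog (gdil (1 / l) y)" if "y \<in> W" for y
      using loc(7)[OF that] gdil_Psi[of "1 / l" "\<Theta> y"] l(1) by (metis clog_Psi zero_less_divide_1_iff)
    have "\<forall>\<^sub>F s in at t. gdil l (c s) \<in> W"
      using gc topological_tendstoD[OF _ loc(3) l(2)] unfolding has_log_deriv_def by blast
    then show "\<forall>\<^sub>F s in at t. dil (1 / l) (\<Theta> (gdil l (c s))) = clog (c s)"
      by eventually_elim (simp add: eq gdil_inverse l(1))
    show "dil (1 / l) (\<Theta> (gdil l (c t))) = clog (c t)" using eq[OF l(2)] l(1) by (simp add: gdil_inverse)
  qed simp
  then show ?thesis unfolding differentiable_def by blast
qed

text \<open>Determinants are taken in
  \<open>Psi_deriv (clog (c q)) \<circ> T = B \<circ> Psi_deriv q\<close>; in coordinates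
  \<open>B\<close> and both values of \<open>Psi_deriv\<close> have determinant 1.\<close>

lemma clog_jacobian:
  assumes c: "has_log_deriv c (\<lambda>h. B (Psi_deriv q h)) q"
    and B: "linear B" "det (matrix (coords \<circ> B \<circ> comb)) = 1"
  obtains T where "((\<lambda>s. clog (c s)) has_derivative T) (at q)" "det (matrix T) = 1"
proof -
  obtain T where T: "((\<lambda>s. clog (c s)) has_derivative T) (at q)"
    using clog_differentiable[OF c] unfolding differentiable_def by blast
  have "Psi_deriv (clog (c q)) (T h) = B (Psi_deriv q h)" for h
    by (rule Psi_lift_derivative[OF c T]) simp_all
  then have eq: "(coords \<circ> Psi_deriv (clog (c q))) \<circ> T = (coords \<circ> B \<circ> comb) \<circ> (coords \<circ> Psi_deriv q)"
    by (simp add: fun_eq_iff)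
  have lin: "linear T" "linear (coords \<circ> B \<circ> comb)" "linear (coords \<circ> Psi_deriv t)" for t
    by (rule has_derivative_linear[OF T])
      (intro linear_compose linear_coords linear_comb B linear_Psi_deriv)+
  have "matrix (coords \<circ> Psi_deriv (clog (c q))) ** matrix T = matrix (coords \<circ> B \<circ> comb) ** matrix (coords \<circ> Psi_deriv q)"
    using matrix_compose[OF lin(1) lin(3)] matrix_compose[OF lin(3) lin(2)] eq by metis
  then have "det (matrix (coords \<circ> Psi_deriv (clog (c q)))) * det (matrix T)
      = det (matrix (coords \<circ> B \<circ> comb)) * det (matrix (coords \<circ> Psi_deriv q))"
    by (metis det_mul)
  then have "det (matrix T) = 1" by (simp add: B det_Psi_deriv)
  then show thesis using that T by blast
qed

lemma left_translation_jacobian: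
  "\<exists>T. ((\<lambda>q. clog (x + Psi q)) has_derivative T) (at q) \<and> det (matrix T) = 1"
proof -
  have "has_log_deriv (\<lambda>q. x + Psi q) (\<lambda>h. Psi_deriv q h) q"
    by (rule has_log_deriv_left_translation[OF Psi_has_log_deriv])
  moreover have "coords \<circ> (\<lambda>v. v) \<circ> comb = id" by auto
  then have "det (matrix (coords \<circ> (\<lambda>v. v) \<circ> comb)) = 1" by simp
  ultimately show ?thesis using clog_jacobian[of "\<lambda>q. x + Psi q" "\<lambda>v. v" q] linear_ident by metis
qed

lemma right_translation_jacobian:
  "\<exists>T. ((\<lambda>q. clog (Psi q + x)) has_derivative T) (at q) \<and> det (matrix T) = 1"
proof -
  have "has_log_deriv (\<lambda>q. x) (\<lambda>h. 0) q" unfolding has_log_deriv_def by simp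
  from has_log_deriv_add[OF Psi_has_log_deriv this]
  have "has_log_deriv (\<lambda>q. Psi q + x) (\<lambda>h. Ad (- x) (Psi_deriv q h)) q" by simp
  moreover have "det (matrix (coords \<circ> Ad (- x) \<circ> comb)) = 1"
    using det_Ad_Psi[of "clog (- x)"] by simp
  ultimately show ?thesis using clog_jacobian[of "\<lambda>q. Psi q + x" "Ad (- x)" q] linear_Ad by metis
qed

text \<open>\<open>gdil l\<close> carries the one-parameter subgroup of \<open>v\<close> to one with
  velocity \<open>alg_dilation A l v\<close>, and the velocity determines the subgroup.\<close>

lemma E_alg_dilation:
  assumes l: "l > 0"
  shows "E (alg_dilation A l v) = gdil l (E v)"
proof -
  have "one_parameter_subgroup \<phi> (alg_dilation A l v) (\<lambda>t. gdil l (E (t *\<^sub>R v)))"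
    unfolding one_parameter_subgroup_def
  proof (intro conjI allI)
    have "continuous_on UNIV (\<lambda>t. E (t *\<^sub>R v))"
      using E_one_parameter_subgroup[of v] unfolding one_parameter_subgroup_def by blast
    then show "continuous_on UNIV (\<lambda>t. gdil l (E (t *\<^sub>R v)))"
      by (rule continuous_on_compose2[OF gdil_continuous[OF l]]) simp
    show "gdil l (E ((s + t) *\<^sub>R v)) = gdil l (E (s *\<^sub>R v)) + gdil l (E (t *\<^sub>R v))" for s t
      unfolding E_add by (rule gdil_add[OF l])
    show "((\<lambda>t. \<phi> (gdil l (E (t *\<^sub>R v)))) has_vector_derivative alg_dilation A l v) (at 0)"
      using gdil_has_log_deriv[OF l E_has_log_deriv[of v 0]] l
      unfolding has_log_deriv_def has_vector_derivative_def
      by (simp add: linear_cmul[OF linear_alg_dilation])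
  qed
  from one_parameter_subgroup_unique[OF E_one_parameter_subgroup this]
  have "E (1 *\<^sub>R alg_dilation A l v) = gdil l (E (1 *\<^sub>R v))" by (rule fun_cong)
  then show ?thesis by simp
qed

text \<open>Outside the range of \<open>E\<close> the value of \<open>inv E\<close> is one fixed vector, so a homogeneous quasi-norm would be
  constant there; but this set is dilation invariant and the dilations contract every point to the unit.\<close>

lemma surj_E:
  assumes N: "homogeneous_quasi_norm E A N"
  shows "surj E"
proof (rule ccontr)
  assume "\<not> surj E"
  then obtain x where x: "x \<notin> range E" by blast
  have not_range: "gdil l x \<notin> range E" if l: "l > 0" for l
  proof
    assume "gdil l x \<in> range E"
    then obtain w where "gdil l x = E w" by blast
    then have "x = E (alg_dilation A (1 / l) w)"
      using gdil_inverse(2)[OF l, of x] l by (simp add: E_alg_dilation)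
    then show False using x by blast
  qed
  have const: "N y = N (E (SOME v. False))" if "y \<notin> range E" for y
  proof -
    have "E v \<noteq> y" for v using that by blast
    then have "inv E y = (SOME v. False)" by (simp add: inv_into_def)
    moreover have "alg_dilation A 1 v = v" for v by (simp add: alg_dilation_eq)
    \<comment> \<open>Homogeneity is used with ratio 1: \<open>N y\<close> is the value of
      \<open>N\<close> at \<open>dilation E A 1 y\<close>, which is one and the same element for all
      \<open>y\<close> outside the range of \<open>E\<close>.\<close>
    ultimately have "dilation E A 1 y = E (SOME v. False)" by (simp add: dilation_def)
    moreover have "N (dilation E A 1 y) = 1 * N y"
      using N unfolding homogeneous_quasi_norm_def by (meson zero_less_one)
    ultimately show ?thesis by simp
  qed
  have "isCont N 0" using N unfolding homogeneous_quasi_norm_def by (simp add: continuous_on_eq_continuous_at)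
  from isCont_tendsto_compose[OF this gdil_tendsto_0]
  have "((\<lambda>l. N (gdil l x)) \<longlongrightarrow> N 0) (at_right 0)" .
  then have "((\<lambda>l::real. N x) \<longlongrightarrow> N 0) (at_right 0)"
  proof (rule Lim_transform_eventually)
    have "\<forall>\<^sub>F l in at_right (0::real). l > 0" by (simp add: eventually_at_right_less)
    then show "\<forall>\<^sub>F l in at_right 0. N (gdil l x) = N x"
      by eventually_elim (use const[OF not_range] const[OF x] in simp)
  qed
  then have "N x = N 0" by (simp add: tendsto_const_iff)
  then have "x = 0" using N unfolding homogeneous_quasi_norm_def by metis
  then show False using x E_0 by (metis rangeI)
qed

lemma dilation_eq_gdil:
  assumes "homogeneous_quasi_norm E A N" "l > 0"
  shows "dilation E A l x = gdil l x"
  using surj_f_inv_f[OF surj_E[OF assms(1)]] by (simp add: dilation_def E_alg_dilation[OF assms(2)])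

end

section \<open>Haar measure\<close>

context homogeneous_coordinates
begin

text \<open>The definition takes the trace in \<open>Basis\<close>. The passage to the eigenbasis
  rests on \<open>coords (e i) $ i = 1\<close>, with \<open>e i\<close> expanded in
  \<open>Basis\<close>.\<close>

lemma trace_eq_sum: "homogeneous_dimension A = (\<Sum>i\<in>UNIV. \<nu> i)"
proof -
  have Av: "A v = (\<Sum>i\<in>UNIV. (\<nu> i * coords v $ i) *\<^sub>R e i)" for v
  proof -
    have "A v = A (comb (coords v))" by simp
    also have "\<dots> = (\<Sum>i\<in>UNIV. (\<nu> i * coords v $ i) *\<^sub>R e i)"
      unfolding comb_def by (simp add: linear_sum[OF linear] linear_cmul[OF linear] A_e mult.commute)
    finally show ?thesis .
  qed
  have "(\<Sum>b\<in>Basis. (coords b $ i) * (e i \<bullet> b)) = 1" for i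
  proof -
    have "(\<Sum>b\<in>Basis. (e i \<bullet> b) *\<^sub>R coords b) = coords (\<Sum>b\<in>Basis. (e i \<bullet> b) *\<^sub>R b)"
      by (simp add: linear_sum[OF linear_coords] linear_cmul[OF linear_coords])
    also have "\<dots> = axis i 1" using coords_comb[of "axis i 1"] by (simp add: euclidean_representation comb_axis)
    finally have "(\<Sum>b\<in>Basis. (e i \<bullet> b) *\<^sub>R coords b) $ i = 1" by simp
    then show ?thesis by (simp add: mult.commute)
  qed
  note one = this
  have "homogeneous_dimension A = (\<Sum>b\<in>Basis. \<Sum>i\<in>UNIV. \<nu> i * ((coords b $ i) * (e i \<bullet> b)))"
    unfolding homogeneous_dimension_def Av by (simp add: inner_sum_left mult.assoc)
  also have "\<dots> = (\<Sum>i\<in>UNIV. \<nu> i * (\<Sum>b\<in>Basis. (coords b $ i) * (e i \<bullet> b)))"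
    by (subst sum.swap) (simp add: sum_distrib_left)
  finally show ?thesis by (simp add: one)
qed

section \<open>Lebesgue measure in the coordinates, its invariance and scaling\<close>

definition lebesgue_haar :: "'g measure" where "lebesgue_haar = distr lborel borel Psi"

lemma measurable_Psi: "Psi \<in> borel_measurable borel"
  by (rule borel_measurable_continuous_onI[OF continuous_Psi])

lemma sets_lebesgue_haar[simp]: "sets lebesgue_haar = sets borel"
  by (simp add: lebesgue_haar_def)

lemma emeasure_lebesgue_haar: "X \<in> sets borel \<Longrightarrow> emeasure lebesgue_haar X = emeasure lborel (Psi -` X)"
  unfolding lebesgue_haar_def using measurable_Psi by (subst emeasure_distr) auto

lemma sigma_finite_lebesgue_haar: "sigma_finite_measure lebesgue_haar"
proof (rule sigma_finite_measure_distr)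
  have clog: "clog \<in> borel_measurable borel" by (rule borel_measurable_continuous_onI[OF continuous_clog])
  then show m: "clog \<in> measurable lebesgue_haar borel" by (simp cong: measurable_cong_sets)
  have "distr lebesgue_haar borel clog = distr lborel borel (clog \<circ> Psi)"
    unfolding lebesgue_haar_def using clog measurable_Psi by (intro distr_distr) auto
  also have "\<dots> = lborel" by (simp add: comp_def distr_id2)
  finally show "sigma_finite_measure (distr lebesgue_haar borel clog)"
    by (simp add: sigma_finite_lborel)
qed

text \<open>\<open>T\<close> is read in the coordinates as
  \<open>clog \<circ> T \<circ> Psi\<close>, a bijection with constant Jacobian. Translations come
  with \<open>c = 1\<close>, dilations with
  \<open>c = l powr homogeneous_dimension A\<close>.\<close>

lemma lebesgue_haar_invariant:
  assumes T: "continuous_on UNIV T" "bij T"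
    and jac: "\<And>q. \<exists>D. ((\<lambda>q. clog (T (Psi q))) has_derivative D) (at q) \<and> \<bar>det (matrix D)\<bar> = c" and c: "c > 0"
    and X: "X \<in> sets borel"
  shows "emeasure lebesgue_haar X = ennreal c * emeasure lebesgue_haar (T -` X)"
proof -
  have mT: "T \<in> borel_measurable borel" by (rule borel_measurable_continuous_onI[OF T(1)])
  have TX: "T -` X \<in> sets borel" using measurable_sets[OF mT X] by simp
  have PX: "Psi -` X \<in> sets borel" using measurable_sets[OF measurable_Psi X] by simp
  obtain D where D: "\<And>q. ((\<lambda>q. clog (T (Psi q))) has_derivative D q) (at q)" "\<And>q. \<bar>det (matrix (D q))\<bar> = c"
    using jac by metis
  have "bij clog" unfolding clog_def using bij_Psi by (rule bij_imp_bij_inv)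
  then have "bij (clog \<circ> (T \<circ> Psi))" using T(2) bij_Psi by (intro bij_comp)
  then have bij: "bij (\<lambda>q. clog (T (Psi q)))" by (simp add: comp_def)
  have "emeasure lborel (Psi -` X) = ennreal c * emeasure lborel ((\<lambda>q. clog (T (Psi q))) -` (Psi -` X))"
    by (rule emeasure_lborel_constant_jacobian[OF bij D c PX])
  also have "(\<lambda>q. clog (T (Psi q))) -` (Psi -` X) = Psi -` (T -` X)" by auto
  finally show ?thesis using X TX by (simp add: emeasure_lebesgue_haar)
qed

lemma lebesgue_haar_translation:
  "distr lebesgue_haar borel (\<lambda>y. x + y) = lebesgue_haar" "distr lebesgue_haar borel (\<lambda>y. y + x) = lebesgue_haar"
proof -
  have cont: "continuous_on UNIV (\<lambda>y. x + y)" "continuous_on UNIV (\<lambda>y. y + x)" for x :: 'g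
    by (intro continuous_intros)+
  have bij: "bij (\<lambda>y. x + y)" "bij (\<lambda>y. y + x)" for x :: 'g
  proof -
    show "bij (\<lambda>y. x + y)" by (rule bij_betw_byWitness[of _ "\<lambda>y. - x + y"]) (auto simp: add.assoc[symmetric])
    show "bij (\<lambda>y. y + x)" by (rule bij_betw_byWitness[of _ "\<lambda>y. y - x"]) auto
  qed
  have *: "distr lebesgue_haar borel T = lebesgue_haar"
    if T: "continuous_on UNIV T" "bij T"
      "\<And>q. \<exists>D. ((\<lambda>q. clog (T (Psi q))) has_derivative D) (at q) \<and> det (matrix D) = 1" for T
  proof (rule measure_eqI)
    fix X assume "X \<in> sets (distr lebesgue_haar borel T)"
    then have X: "X \<in> sets borel" by simp
    have mT: "T \<in> measurable lebesgue_haar borel"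
      using borel_measurable_continuous_onI[OF T(1)] by (simp cong: measurable_cong_sets)
    have "space lebesgue_haar = UNIV" by (simp add: lebesgue_haar_def)
    then show "emeasure (distr lebesgue_haar borel T) X = emeasure lebesgue_haar X"
      using lebesgue_haar_invariant[OF T(1,2) _ _ X, of 1] T(3) X mT by (force simp: emeasure_distr)
  qed simp
  show "distr lebesgue_haar borel (\<lambda>y. x + y) = lebesgue_haar"
    by (intro * cont bij left_translation_jacobian)
  show "distr lebesgue_haar borel (\<lambda>y. y + x) = lebesgue_haar"
    by (intro * cont bij right_translation_jacobian)
qed

lemma bij_gdil: "l > 0 \<Longrightarrow> bij (gdil l)"
  by (rule bij_betw_byWitness[of _ "gdil (1 / l)"]) (auto simp: gdil_inverse)

lemma det_dil: "l > 0 \<Longrightarrow> det (matrix (dil l)) = l powr homogeneous_dimension A"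
  by (subst det_diagonal)
    (auto simp: matrix_def dil_def axis_def trace_eq_sum powr_def exp_sum sum_distrib_left mult.commute)

lemma nn_integral_lebesgue_haar_gdil:
  assumes l: "l > 0" and g: "g \<in> borel_measurable borel"
  shows "(\<integral>\<^sup>+x. g (gdil l x) \<partial>lebesgue_haar) = ennreal (l powr (- homogeneous_dimension A)) * (\<integral>\<^sup>+x. g x \<partial>lebesgue_haar)"
proof -
  let ?c = "l powr homogeneous_dimension A"
  have mg: "gdil l \<in> measurable lebesgue_haar borel"
    using borel_measurable_continuous_onI[OF gdil_continuous[OF l]] by (simp cong: measurable_cong_sets)
  have "distr lebesgue_haar borel (gdil l) = scale_measure (ennreal (1 / ?c)) lebesgue_haar"
  proof (rule measure_eqI)
    fix X assume "X \<in> sets (distr lebesgue_haar borel (gdil l))"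
    then have X: "X \<in> sets borel" by simp
    have "emeasure lebesgue_haar X = ennreal ?c * emeasure lebesgue_haar (gdil l -` X)"
    proof (rule lebesgue_haar_invariant[OF gdil_continuous[OF l] bij_gdil[OF l] _ _ X])
      fix q
      have "(dil l has_derivative dil l) (at q)"
        by (rule bounded_linear_imp_has_derivative[OF bounded_linear_dil])
      then show "\<exists>D. ((\<lambda>q. clog (gdil l (Psi q))) has_derivative D) (at q) \<and> \<bar>det (matrix D)\<bar> = ?c"
        using det_dil[OF l] l by (intro exI[of _ "dil l"]) (simp add: gdil_Psi)
    qed (use l in simp)
    then have "ennreal (1 / ?c) * emeasure lebesgue_haar X = ennreal (1 / ?c * ?c) * emeasure lebesgue_haar (gdil l -` X)"
      using l by (simp add: mult.assoc[symmetric] ennreal_mult'[symmetric])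
    also have "1 / ?c * ?c = 1" using l by simp
    finally have "ennreal (1 / ?c) * emeasure lebesgue_haar X = emeasure lebesgue_haar (gdil l -` X)" by simp
    moreover have "space lebesgue_haar = UNIV" by (simp add: lebesgue_haar_def)
    ultimately show "emeasure (distr lebesgue_haar borel (gdil l)) X = emeasure (scale_measure (ennreal (1 / ?c)) lebesgue_haar) X"
      using X mg by (simp add: emeasure_distr)
  qed simp
  moreover have "(\<integral>\<^sup>+x. g x \<partial>distr lebesgue_haar borel (gdil l)) = (\<integral>\<^sup>+x. g (gdil l x) \<partial>lebesgue_haar)"
    using mg g by (intro nn_integral_distr) simp_all
  moreover have "g \<in> borel_measurable lebesgue_haar" using g by (simp cong: measurable_cong_sets)
  ultimately show ?thesis
    by (simp add: nn_integral_scale_measure powr_minus_divide)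
qed

section \<open>Transfer of the scaling law to an arbitrary Haar measure\<close>

lemma compact_Psi_image: "compact K \<Longrightarrow> compact (Psi ` K)"
  by (rule compact_continuous_image[OF continuous_on_subset[OF continuous_Psi]]) auto

lemma sigma_finite_haar:
  fixes \<mu> :: "'g measure"
  assumes "haar_measure \<mu>"
  shows "sigma_finite_measure \<mu>"
proof
  have sets: "sets \<mu> = sets borel" using assms by (simp add: haar_measure_def)
  let ?F = "range (\<lambda>n::nat. Psi ` cball 0 (real n))"
  have c: "compact (Psi ` cball 0 (real n))" for n by (intro compact_Psi_image) simp
  have 1: "?F \<subseteq> sets \<mu>"
    unfolding sets using c by (auto intro: borel_closed compact_imp_closed)
  have 2: "\<forall>a\<in>?F. emeasure \<mu> a \<noteq> \<infinity>"
  proof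
    fix a assume "a \<in> ?F"
    then have "compact a" using c by auto
    then have "emeasure \<mu> a < \<infinity>" using assms unfolding haar_measure_def by blast
    then show "emeasure \<mu> a \<noteq> \<infinity>" by simp
  qed
  have "x \<in> \<Union>?F" for x
  proof -
    obtain n :: nat where "norm (clog x) \<le> real n" using real_arch_simple by blast
    then have "Psi (clog x) \<in> Psi ` cball 0 (real n)" by (intro imageI) simp
    then show ?thesis by auto
  qed
  then have 3: "\<Union>?F = space \<mu>" using sets_eq_imp_space_eq[OF sets] by auto
  have "countable ?F" by simp
  then show "\<exists>F. countable F \<and> F \<subseteq> sets \<mu> \<and> \<Union>F = space \<mu> \<and> (\<forall>a\<in>F. emeasure \<mu> a \<noteq> \<infinity>)"
    using 1 2 3 by blast
qed

text \<open>The proportionality identity is applied to \<open>g \<circ> gdil l\<close> and to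
  \<open>g\<close>, with the same \<open>h\<close>. The inversion on the Lebesgue side does no harm
  because \<open>gdil l\<close> commutes with it.\<close>

lemma nn_integral_haar_gdil:
  fixes \<mu> :: "'g measure" and g :: "'g \<Rightarrow> ennreal"
  assumes \<mu>: "haar_measure \<mu>" and l: "l > 0" and g: "g \<in> borel_measurable borel"
  shows "(\<integral>\<^sup>+x. g (gdil l x) \<partial>\<mu>) = ennreal (l powr (- homogeneous_dimension A)) * (\<integral>\<^sup>+x. g x \<partial>\<mu>)"
proof -
  \<comment> \<open>The image of the unit cube has \<open>?L\<close>-measure 1, so no division by
    the integral of \<open>?h\<close> arises.\<close>
  let ?L = lebesgue_haar and ?K = "Psi ` cbox 0 One"
  let ?h = "indicator ?K :: 'g \<Rightarrow> ennreal" and ?c = "ennreal (l powr (- homogeneous_dimension A))"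
  have "compact ?K" by (intro compact_Psi_image) simp
  then have K: "?K \<in> sets borel" by (intro borel_closed compact_imp_closed)
  then have h: "?h \<in> borel_measurable borel" by simp
  have "emeasure ?L ?K = emeasure lborel (cbox 0 (One :: (real, 'n) vec))"
    using emeasure_lebesgue_haar[OF K] bij_Psi by (simp add: bij_is_inj inj_vimage_image_eq)
  also have "\<dots> = 1" by (subst emeasure_lborel_cbox) simp_all
  finally have Lh: "(\<integral>\<^sup>+x. ?h x \<partial>?L) = 1" using K by simp
  have sm: "sets \<mu> = sets borel" and lm: "\<And>x. distr \<mu> borel (\<lambda>y. x + y) = \<mu>"
    using \<mu> by (auto simp: haar_measure_def)
  note proportional = left_invariant_proportional[OF sm sets_lebesgue_haar sigma_finite_haar[OF \<mu>] sigma_finite_lebesgue_haar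
      lm lebesgue_haar_translation]
  have gd: "(\<lambda>x. g (gdil l x)) \<in> borel_measurable borel"
    by (rule measurable_compose[OF borel_measurable_continuous_onI[OF gdil_continuous[OF l]] g])
  have gm: "(\<lambda>x. g (- x)) \<in> borel_measurable borel"
    by (rule measurable_compose[OF borel_measurable_continuous_onI g]) (intro continuous_on_minus continuous_on_id)
  have "(\<integral>\<^sup>+x. g (gdil l x) \<partial>\<mu>) * (\<integral>\<^sup>+x. ?h x \<partial>?L) = (\<integral>\<^sup>+x. ?h x \<partial>\<mu>) * (\<integral>\<^sup>+x. g (gdil l (- x)) \<partial>?L)"
    by (rule proportional[OF gd h])
  also have "(\<integral>\<^sup>+x. g (gdil l (- x)) \<partial>?L) = ?c * (\<integral>\<^sup>+x. g (- x) \<partial>?L)"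
    using nn_integral_lebesgue_haar_gdil[OF l gm] by (simp add: gdil_minus[OF l])
  also have "(\<integral>\<^sup>+x. ?h x \<partial>\<mu>) * (?c * (\<integral>\<^sup>+x. g (- x) \<partial>?L)) = ?c * ((\<integral>\<^sup>+x. ?h x \<partial>\<mu>) * (\<integral>\<^sup>+x. g (- x) \<partial>?L))"
    by (simp add: mult_ac)
  also have "(\<integral>\<^sup>+x. ?h x \<partial>\<mu>) * (\<integral>\<^sup>+x. g (- x) \<partial>?L) = (\<integral>\<^sup>+x. g x \<partial>\<mu>) * (\<integral>\<^sup>+x. ?h x \<partial>?L)"
    by (rule proportional[OF g h, symmetric])
  finally show ?thesis unfolding Lh by simp
qed

end

section \<open>The Hardy inequality\<close>

context homogeneous_group
begin

text \<open>The differential of \<open>f\<close> at \<open>x\<close>, pulled back to the tangent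
  space at the unit by left translation; it pairs directly with logarithmic derivatives.\<close>

definition ldiff :: "('g \<Rightarrow> 'b::real_normed_vector) \<Rightarrow> 'g \<Rightarrow> 'a \<Rightarrow> 'b" where
  "ldiff f x = fderiv (\<lambda>q. f (x + chart_inv q)) (\<phi> 0)"

text \<open>In a chart \<open>\<psi>\<close> at \<open>x\<close>, \<open>ldiff f y v\<close> is the
  derivative of \<open>f\<close> in that chart, applied to the derivative of the group law in its
  second argument. Both depend continuously on \<open>y\<close>.\<close>

lemma smooth_function_ldiff:
  fixes f :: "'g \<Rightarrow> 'b::real_normed_vector"
  assumes f: "smooth_function \<A> f"
  shows smooth_function_isCont: "isCont f x"
    and smooth_function_has_ldiff: "((\<lambda>q. f (x + chart_inv q)) has_derivative ldiff f x) (at (\<phi> 0))"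
    and smooth_function_ldiff_isCont: "isCont (\<lambda>x. ldiff f x v) x"
proof -
  obtain V \<psi> where V: "(V, \<psi>) \<in> \<A>" "x \<in> V" by (rule chart_at)
  note openV = chart_homeomorphism(1)[OF V(1)]
  let ?f = "\<lambda>p. f (inv_into V \<psi> p)"
  let ?M = "\<lambda>(p, q). \<psi> (inv_into V \<psi> p + chart_inv q)"
  let ?O = "{(p, q). p \<in> \<psi> ` V \<and> q \<in> \<phi> ` U \<and> inv_into V \<psi> p + chart_inv q \<in> V}"
  have fs: "smooth_on (\<psi> ` V) ?f"
    using bspec[OF f[unfolded smooth_function_def] V(1)] by simp
  have ms: "smooth_on ?O ?M" by (rule mult_smooth[OF V(1) unit_chart(1) V(1)])
  have mem: "(\<psi> y, \<phi> 0) \<in> ?O" if "y \<in> V" for y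
    using that unit_chart by (simp add: chart_inv_apply[OF V(1)])
  let ?m = "\<lambda>y v. fderiv ?M (\<psi> y, \<phi> 0) (0, v)"
  have der: "((\<lambda>q. f (y + chart_inv q)) has_derivative (\<lambda>v. fderiv ?f (\<psi> y) (?m y v))) (at (\<phi> 0))"
    if y: "y \<in> V" for y
  proof -
    have "((\<lambda>q. ?M (\<psi> y, q)) has_derivative ?m y) (at (\<phi> 0))"
      by (rule has_derivative_compose[where f="\<lambda>q. (\<psi> y, q)" and g="?M"])
        (use smooth_on_D(1)[OF ms mem[OF y]] in \<open>auto intro!: derivative_eq_intros\<close>)
    then have "((\<lambda>q. ?f (?M (\<psi> y, q))) has_derivative (\<lambda>v. fderiv ?f (\<psi> y) (?m y v))) (at (\<phi> 0))"
      by (rule has_derivative_compose)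
        (use smooth_on_D(1)[OF fs, of "\<psi> y"] y in \<open>simp add: chart_inv_apply[OF V(1)]\<close>)
    then show ?thesis
    proof (rule has_derivative_transform_within_open)
      show "open {q \<in> \<phi> ` U. y + chart_inv q \<in> V}"
        by (intro open_chart_preimage unit_chart openV continuous_intros)
    qed (use y unit_chart in \<open>auto simp: chart_inv_apply[OF V(1)]\<close>)
  qed
  have ld: "ldiff f y v = fderiv ?f (\<psi> y) (?m y v)" if "y \<in> V" for y v
    unfolding ldiff_def frechet_derivative_at[OF der[OF that], symmetric] ..
  show "((\<lambda>q. f (x + chart_inv q)) has_derivative ldiff f x) (at (\<phi> 0))"
  proof -
    have "ldiff f x = (\<lambda>v. fderiv ?f (\<psi> x) (?m x v))" by (rule ext) (rule ld[OF V(2)])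
    then show ?thesis using der[OF V(2)] by (simp only:)
  qed
  have c\<psi>: "isCont \<psi> x"
    using chart_continuous[OF V(1)] openV V(2) by (simp add: continuous_on_eq_continuous_at)
  have near: "\<forall>\<^sub>F y in at x. y \<in> V" by (rule eventually_at_in_open'[OF openV V(2)])
  have "isCont ?f (\<psi> x)"
    using has_derivative_continuous[OF smooth_on_D(1)[OF fs]] V(2) by blast
  from isCont_o2[OF c\<psi> this] have "((\<lambda>y. ?f (\<psi> y)) \<longlongrightarrow> ?f (\<psi> x)) (at x)" by (simp add: isCont_def)
  then have "(f \<longlongrightarrow> ?f (\<psi> x)) (at x)"
    by (rule Lim_transform_eventually) (use near in \<open>eventually_elim, simp add: chart_inv_apply[OF V(1)]\<close>)
  then show "isCont f x" by (simp add: isCont_def chart_inv_apply[OF V])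
  have "((\<lambda>y. fderiv ?f (\<psi> y) (?m y v)) \<longlongrightarrow> fderiv ?f (\<psi> x) (?m x v)) (at x)"
  proof (rule tendsto_linear_family)
    show "\<forall>\<^sub>F y in at x. linear (fderiv ?f (\<psi> y))"
      using near by eventually_elim (use smooth_on_D(1)[OF fs] in \<open>blast intro: has_derivative_linear\<close>)
    show "linear (fderiv ?f (\<psi> x))"
      using smooth_on_D(1)[OF fs] V(2) by (blast intro: has_derivative_linear)
    have "isCont (\<lambda>p. fderiv ?f p w) (\<psi> x)" for w
      by (rule smooth_on_isCont_derivative[OF fs]) (use V(2) in blast)
    from isCont_o2[OF c\<psi> this]
    show "((\<lambda>y. fderiv ?f (\<psi> y) w) \<longlongrightarrow> fderiv ?f (\<psi> x) w) (at x)" for w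
      by (simp add: isCont_def)
    have "isCont (\<lambda>z. fderiv ?M z (0, v)) (\<psi> x, \<phi> 0)"
      by (rule smooth_on_isCont_derivative[OF ms mem[OF V(2)]])
    moreover have "isCont (\<lambda>y. (\<psi> y, \<phi> 0)) x" using c\<psi> by (intro continuous_intros)
    ultimately have "isCont (\<lambda>y. ?m y v) x" using isCont_o2[of x "\<lambda>y. (\<psi> y, \<phi> 0)"] by blast
    then show "((\<lambda>y. ?m y v) \<longlongrightarrow> ?m x v) (at x)" by (simp add: isCont_def)
  qed
  then have "((\<lambda>y. ldiff f y v) \<longlongrightarrow> fderiv ?f (\<psi> x) (?m x v)) (at x)"
    by (rule Lim_transform_eventually) (use near in \<open>eventually_elim, simp add: ld\<close>)
  then show "isCont (\<lambda>x. ldiff f x v) x" by (simp add: isCont_def ld[OF V(2)])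
qed

end

context homogeneous_coordinates
begin

section \<open>The Euler field and the radial operator\<close>

definition euler :: "(real, 'n) vec \<Rightarrow> (real, 'n) vec" where
  "euler t = (\<chi> i. \<nu> i * t $ i)"

lemma dil_has_vector_derivative:
  assumes l: "l > 0"
  shows "((\<lambda>l. dil l t) has_vector_derivative euler (dil l t) /\<^sub>R l) (at l)"
proof -
  have "((\<lambda>l. dil l t $ i) has_derivative (\<lambda>h. h * (inverse l * euler (dil l t) $ i))) (at l)" for i
  proof -
    have "((\<lambda>l. dil l t $ i) has_real_derivative inverse l * euler (dil l t) $ i) (at l)"
      unfolding dil_def euler_def using l by (auto intro!: derivative_eq_intros simp: field_simps)
    from this[unfolded has_field_derivative_def] show ?thesis
      by (rule has_derivative_eq_rhs) (simp add: fun_eq_iff)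
  qed
  then have "((\<lambda>l. dil l t \<bullet> b) has_derivative (\<lambda>h. (h *\<^sub>R (euler (dil l t) /\<^sub>R l)) \<bullet> b)) (at l)"
    if "b \<in> Basis" for b
    using that by (auto simp: Basis_vec_def inner_axis mult.assoc)
  then show ?thesis
    unfolding has_vector_derivative_def by (subst has_derivative_componentwise_within) blast
qed

text \<open>The derivative of \<open>f\<close> along the generator of the dilations. It is defined
  without \<open>N\<close>, and for smooth \<open>f\<close> it is continuous also at the
  unit.\<close>

definition euler_deriv :: "('g \<Rightarrow> complex) \<Rightarrow> 'g \<Rightarrow> complex" where
  "euler_deriv f x = ldiff f x (Psi_deriv (clog x) (euler (clog x)))"

lemma gdil_has_vector_derivative:
  assumes f: "smooth_function \<A> f" and l: "l > 0"
  shows "((\<lambda>l. f (gdil l x)) has_vector_derivative euler_deriv f (gdil l x) /\<^sub>R l) (at l)"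
proof -
  let ?t = "clog x"
  have "has_log_deriv (\<lambda>l. Psi (dil l ?t)) (\<lambda>h. Psi_deriv (dil l ?t) (h *\<^sub>R (euler (dil l ?t) /\<^sub>R l))) l"
    by (rule has_log_deriv_chain[OF Psi_has_log_deriv])
      (use dil_has_vector_derivative[OF l] in \<open>simp add: has_vector_derivative_def\<close>)
  from has_log_deriv_compose[OF this, where F=f, OF smooth_function_has_ldiff[OF f]]
  have "((\<lambda>l. f (Psi (dil l ?t))) has_derivative
      (\<lambda>h. ldiff f (Psi (dil l ?t)) (Psi_deriv (dil l ?t) (h *\<^sub>R (euler (dil l ?t) /\<^sub>R l))))) (at l)" .
  moreover have "ldiff f y (Psi_deriv t (h *\<^sub>R (v /\<^sub>R l))) = h *\<^sub>R (ldiff f y (Psi_deriv t v) /\<^sub>R l)" for y t h v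
    by (simp only: linear_cmul[OF linear_Psi_deriv] linear_cmul[OF has_derivative_linear[OF smooth_function_has_ldiff[OF f]]])
  ultimately have "((\<lambda>l. f (Psi (dil l ?t))) has_vector_derivative euler_deriv f (Psi (dil l ?t)) /\<^sub>R l) (at l)"
    unfolding has_vector_derivative_def euler_deriv_def by simp
  moreover have eq: "Psi (dil m ?t) = gdil m x" if "m > 0" for m
    using gdil_Psi[OF that, of ?t] by simp
  ultimately have "((\<lambda>l. f (Psi (dil l ?t))) has_vector_derivative euler_deriv f (gdil l x) /\<^sub>R l) (at l)"
    using l by simp
  then show ?thesis
    by (rule has_vector_derivative_transform_within_open[of _ _ _ "{0<..}"]) (use l eq in auto)
qed

lemma isCont_euler_deriv:
  assumes f: "smooth_function \<A> f"
  shows "isCont (euler_deriv f) x"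
proof -
  let ?v = "\<lambda>x. Psi_deriv (clog x) (euler (clog x))"
  have "((\<lambda>t. Psi_deriv t (euler t)) \<longlongrightarrow> Psi_deriv s (euler s)) (at s)" for s
  proof (rule tendsto_linear_family[OF always_eventually[OF allI[OF linear_Psi_deriv]] linear_Psi_deriv Psi_deriv_tendsto])
    show "(euler \<longlongrightarrow> euler s) (at s)"
      unfolding euler_def[abs_def] by (intro tendsto_intros)
  qed
  then have "isCont (\<lambda>t. Psi_deriv t (euler t)) (clog x)" by (simp add: isCont_def)
  moreover have "isCont clog x" using continuous_clog by (simp add: continuous_on_eq_continuous_at)
  ultimately have v: "(?v \<longlongrightarrow> ?v x) (at x)" using isCont_o2[of x clog] by (simp add: isCont_def)
  have "((\<lambda>y. ldiff f y (?v y)) \<longlongrightarrow> ldiff f x (?v x)) (at x)"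
    by (rule tendsto_linear_family[OF _ _ _ v])
      (use smooth_function_ldiff_isCont[OF f] has_derivative_linear[OF smooth_function_has_ldiff[OF f]]
        in \<open>auto simp: isCont_def\<close>)
  then show ?thesis by (simp add: isCont_def euler_deriv_def[abs_def])
qed

lemma euler_deriv_eq_0:
  assumes f: "smooth_function \<A> f" and V: "open V" "x \<in> V" "\<And>y. y \<in> V \<Longrightarrow> f y = 0"
  shows "euler_deriv f x = 0"
proof -
  have "((\<lambda>q. f (x + chart_inv q)) has_derivative (\<lambda>v. 0)) (at (\<phi> 0))"
  proof (rule has_derivative_transform_within_open[OF has_derivative_const])
    show "open {q \<in> \<phi> ` U. x + chart_inv q \<in> V}"
      by (intro open_chart_preimage unit_chart V(1) continuous_intros)
  qed (use V unit_chart in auto)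
  from has_derivative_unique[OF this smooth_function_has_ldiff[OF f]]
  show ?thesis unfolding euler_deriv_def by metis
qed

lemma hardy_inequality:
  fixes \<mu> :: "'g measure" and f :: "'g \<Rightarrow> complex"
  assumes \<mu>: "haar_measure \<mu>" and N: "homogeneous_quasi_norm E A N" and Q: "homogeneous_dimension A > 2"
    and f: "smooth_function \<A> f" and K: "compact K" "0 \<notin> K" "\<And>x. x \<notin> K \<Longrightarrow> f x = 0"
  shows "(LINT x|\<mu>. (cmod (f x))\<^sup>2 / (N x)\<^sup>2)
      \<le> (2 / (homogeneous_dimension A - 2))\<^sup>2 * (LINT x|\<mu>. (cmod (euler_deriv f x))\<^sup>2 / (N x)\<^sup>2)"
proof -
  have sets: "sets \<mu> = sets borel" using \<mu> by (simp add: haar_measure_def)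
  have N_cont: "continuous_on UNIV N" and N_ge: "\<And>x. N x \<ge> 0" and N0: "\<And>x. N x = 0 \<longleftrightarrow> x = 0"
    and N_dil: "\<And>l x. l > 0 \<Longrightarrow> N (gdil l x) = l * N x"
    using N dilation_eq_gdil[OF N] unfolding homogeneous_quasi_norm_def by auto
  have closedK: "closed K" by (rule compact_imp_closed[OF K(1)])
  have Z0: "euler_deriv f x = 0" if "x \<notin> K" for x
    by (rule euler_deriv_eq_0[OF f, of "- K"]) (use closedK that K(3) in auto)
  have f_cont: "continuous_on UNIV f" and Z_cont: "continuous_on UNIV (euler_deriv f)"
    using smooth_function_isCont[OF f] isCont_euler_deriv[OF f] by (simp_all add: continuous_at_imp_continuous_on)
  have meas: "g \<in> borel_measurable \<mu>" if "continuous_on UNIV g" for g :: "'g \<Rightarrow> 'b::topological_space"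
    using borel_measurable_continuous_onI[OF that] by (simp add: sets cong: measurable_cong_sets)
  have bdd: "\<exists>b. \<forall>x. cmod (g x) \<le> b" if "continuous_on UNIV g" "\<And>x. x \<notin> K \<Longrightarrow> g x = 0" for g :: "'g \<Rightarrow> complex"
  proof -
    have "bounded (g ` K)"
      by (intro compact_imp_bounded compact_continuous_image K(1) continuous_on_subset[OF that(1)]) simp
    then obtain b where "b > 0" "\<And>x. x \<in> K \<Longrightarrow> cmod (g x) \<le> b" unfolding bounded_pos by auto
    then show ?thesis using that(2) by (metis less_imp_le norm_zero)
  qed
  obtain B1 B2 where "\<And>x. cmod (f x) \<le> B1" "\<And>x. cmod (euler_deriv f x) \<le> B2"
    using bdd[OF f_cont K(3)] bdd[OF Z_cont Z0] by blast
  then have B: "cmod (f x) \<le> max B1 B2" "cmod (euler_deriv f x) \<le> max B1 B2" for x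
    by (auto simp: le_max_iff_disj)
  \<comment> \<open>The points that some dilation with ratio in \<open>{1..2}\<close> carries into
    \<open>K\<close>, written as a continuous image of a compact set. It omits the unit, so
    \<open>N\<close> is bounded below on it by a positive constant.\<close>
  define K' where "K' = (\<lambda>(l, x). Psi (dil (1 / l) (clog x))) ` ({1..2} \<times> K)"
  have K'I: "x \<in> K'" if "l \<in> {1..2}" "gdil l x \<in> K" for l x
  proof -
    have "x = Psi (dil (1 / l) (clog (gdil l x)))"
      using that gdil_Psi[of "1 / l" "clog (gdil l x)"] gdil_inverse(2)[of l x] by simp
    then show ?thesis unfolding K'_def using that by force
  qed
  have compK': "compact K'"
    unfolding K'_def
  proof (rule compact_continuous_image)
    have "continuous_on ({1..2} \<times> K) (\<lambda>z. dil (1 / fst z) (clog (snd z)))"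
      unfolding dil_def
      by (intro continuous_intros continuous_on_compose2[OF continuous_clog]) auto
    then show "continuous_on ({1..2} \<times> K) (\<lambda>(l, x). Psi (dil (1 / l) (clog x)))"
      unfolding case_prod_beta by (rule continuous_on_compose2[OF continuous_Psi]) auto
  qed (intro compact_Times K(1) compact_Icc)
  have "N x \<noteq> 0" if xK': "x \<in> K'" for x
  proof
    assume "N x = 0"
    then have x: "x = 0" using N0 by blast
    obtain l y where ly: "l \<in> {1..2}" "y \<in> K" "x = Psi (dil (1 / l) (clog y))"
      using xK' unfolding K'_def by auto
    then have "x = gdil (1 / l) y" using gdil_Psi[of "1 / l" "clog y"] by simp
    then have "y = gdil l x" using gdil_inverse(1)[of l y] ly(1) by simp
    then show False using x ly K(2) by simp
  qed
  then have Npos: "N x > 0" if "x \<in> K'" for x using that N_ge[of x] by (simp add: less_le)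
  obtain c where c: "c > 0" "\<And>x. x \<in> K' \<Longrightarrow> c \<le> N x"
  proof (cases "K' = {}")
    case True
    then show thesis using that[of 1] by simp
  next
    case False
    obtain y where "y \<in> K'" "\<And>x. x \<in> K' \<Longrightarrow> N y \<le> N x"
      using continuous_attains_inf[OF compK' False continuous_on_subset[OF N_cont]] by auto
    then show thesis using that[of "N y"] Npos by blast
  qed
  have gm: "gdil l \<in> measurable \<mu> \<mu>" if "l > 0" for l
    using borel_measurable_continuous_onI[OF gdil_continuous[OF that]] by (simp add: sets cong: measurable_cong_sets)
  show ?thesis
  proof (rule hardy_scaling[where \<delta>=gdil and K=K' and B="max B1 B2" and c=c, OF Q])
    show "(\<integral>\<^sup>+x. g (gdil l x) \<partial>\<mu>) = ennreal (l powr - homogeneous_dimension A) * (\<integral>\<^sup>+x. g x \<partial>\<mu>)"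
      if "l > 0" "g \<in> borel_measurable \<mu>" for g l
      using that by (intro nn_integral_haar_gdil[OF \<mu>]) (simp_all add: sets cong: measurable_cong_sets)
    show "K' \<in> sets \<mu>" unfolding sets by (intro borel_closed compact_imp_closed compK')
    show "emeasure \<mu> K' < \<infinity>" using \<mu> compK' unfolding haar_measure_def by blast
    show "f (gdil l x) = 0 \<and> euler_deriv f (gdil l x) = 0" if "l \<in> {1..2}" "x \<notin> K'" for l x
      using K'I that K(3) Z0 by blast
  qed (use gm meas N_cont f_cont Z_cont N_ge N_dil B c gdil_has_vector_derivative[OF f] in auto)
qed

text \<open>For \<open>x \<noteq> 0\<close> the dilation orbit of \<open>gdil (1 / N x) x\<close>
  passes through \<open>x\<close> at ratio \<open>N x\<close>, by which the Euler derivative is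
  divided. At the unit both sides are 0.\<close>

lemma radial_derivative_eq:
  assumes N: "homogeneous_quasi_norm E A N" and f: "smooth_function \<A> f" and Z: "euler_deriv f 0 = 0"
  shows "radial_derivative E A N f x = euler_deriv f x / N x"
proof (cases "x = 0")
  case True
  \<comment> \<open>At the unit the ratio \<open>1 / N x\<close> is the default value
    \<open>0\<close>, and ratios \<open>r \<le> 0\<close> occur in the derivative. As
    \<open>alg_dilation A r\<close> depends on \<open>r\<close> through \<open>ln r\<close> only,
    \<open>r\<close> may be replaced by the positive number \<open>exp (ln r)\<close>; the
    differentiated function is constant.\<close>
  have "dilation E A r 0 = 0" for r
  proof -
    have "alg_dilation A r v = alg_dilation A (exp (ln r)) v" for v
      by (simp add: alg_dilation_def)
    then have "dilation E A r 0 = dilation E A (exp (ln r)) 0" by (simp add: dilation_def)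
    then show ?thesis by (simp add: dilation_eq_gdil[OF N])
  qed
  then show ?thesis using True Z by (simp add: radial_derivative_def)
next
  case False
  then have Nx: "N x > 0" using N unfolding homogeneous_quasi_norm_def by (metis less_le)
  let ?y = "gdil (1 / N x) x"
  have "((\<lambda>r. f (gdil r ?y)) has_vector_derivative euler_deriv f (gdil (N x) ?y) /\<^sub>R N x) (at (N x))"
    by (rule gdil_has_vector_derivative[OF f Nx])
  moreover have "gdil (N x) ?y = x" by (rule gdil_inverse(1)[OF Nx])
  ultimately have "((\<lambda>r. f (gdil r ?y)) has_vector_derivative euler_deriv f x /\<^sub>R N x) (at (N x))" by simp
  then have "((\<lambda>r. f (dilation E A r (dilation E A (1 / N x) x))) has_vector_derivative
      euler_deriv f x /\<^sub>R N x) (at (N x))"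
    by (rule has_vector_derivative_transform_within_open[of _ _ _ "{0<..}"])
      (use Nx in \<open>auto simp: dilation_eq_gdil[OF N]\<close>)
  from vector_derivative_at[OF this] show ?thesis
    using Nx by (simp add: radial_derivative_def scaleR_conv_of_real divide_inverse mult.commute)
qed

end

text \<open>An independent spanning set has as many elements as the index type and can be enumerated
  by it; its independence and spanning become injectivity and surjectivity of the combination
  map.\<close>

lemma eigenbasis_exists:
  fixes A :: "'a::euclidean_space \<Rightarrow> 'a"
  assumes "diagonalisable_pos A"
  obtains e :: "'a bidx \<Rightarrow> 'a" and \<nu> where "bij (\<lambda>t::real^'a bidx. \<Sum>i\<in>UNIV. t $ i *\<^sub>R e i)"
    "\<And>i. A (e i) = \<nu> i *\<^sub>R e i" "\<And>i. \<nu> i > 0"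
proof -
  obtain B where B: "independent B" "span B = UNIV" "\<And>b. b \<in> B \<Longrightarrow> \<exists>\<nu>>0. A b = \<nu> *\<^sub>R b"
    using assms unfolding diagonalisable_pos_def by blast
  have finB: "finite B" using B(1) by (rule independent_imp_finite)
  have "card B = DIM('a)" using dim_eq_card[of B UNIV] B(1,2) by simp
  then have "card (UNIV :: 'a bidx set) = card B" by (simp add: card_bidx)
  then obtain e :: "'a bidx \<Rightarrow> 'a" where e: "bij_betw e UNIV B"
    using finite_same_card_bij[OF finite finB] by blast
  have inj_e: "inj e" and range_e: "range e = B"
    using bij_betw_imp_inj_on[OF e] bij_betw_imp_surj_on[OF e] .
  have eB: "e i \<in> B" for i using range_e by blast
  define \<nu> where "\<nu> i = (SOME r. r > 0 \<and> A (e i) = r *\<^sub>R e i)" for i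
  have \<nu>: "\<nu> i > 0 \<and> A (e i) = \<nu> i *\<^sub>R e i" for i
    unfolding \<nu>_def by (rule someI_ex) (use B(3)[OF eB] in blast)
  let ?c = "\<lambda>t::real^'a bidx. \<Sum>i\<in>UNIV. t $ i *\<^sub>R e i"
  have sum_B: "?c t = (\<Sum>b\<in>B. t $ (inv e b) *\<^sub>R b)" for t
    using sum.reindex_bij_betw[OF e, of "\<lambda>b. t $ (inv e b) *\<^sub>R b"] unfolding inv_f_f[OF inj_e] .
  have bij: "bij ?c"
  proof (rule bijI)
    have lin: "linear ?c"
      by (rule linearI) (simp_all add: scaleR_left_distrib sum.distrib scaleR_sum_right)
    show "inj ?c"
      unfolding linear_injective_0[OF lin]
    proof (intro allI impI)
      fix t assume "?c t = 0"
      then have *: "(\<Sum>b\<in>B. t $ (inv e b) *\<^sub>R b) = 0" unfolding sum_B .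
      have "t $ i = 0" for i
        using independentD[OF B(1) finB order_refl * eB[of i]] unfolding inv_f_f[OF inj_e] .
      then show "t = 0" by (simp add: vec_eq_iff)
    qed
    have "x \<in> range ?c" for x
    proof -
      have "x \<in> range (\<lambda>u. \<Sum>b\<in>B. u b *\<^sub>R b)" using span_finite[OF finB] B(2) by blast
      then obtain u where u: "x = (\<Sum>b\<in>B. u b *\<^sub>R b)" by blast
      have "?c (\<chi> i. u (e i)) = x"
        unfolding sum_B u by (rule sum.cong) (use range_e in \<open>auto simp: f_inv_into_f\<close>)
      then show ?thesis by blast
    qed
    then show "surj ?c" by blast
  qed
  show thesis by (rule that[OF bij, of \<nu>]) (simp_all add: \<nu>)
qed

theorem theorem5p1:
  fixes \<A> :: "('g::{topological_group_add, t2_space, second_countable_topology},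
               'a::euclidean_space) chart set"
    and U :: "'g set" and \<phi> :: "'g \<Rightarrow> 'a" and E :: "'a \<Rightarrow> 'g" and A :: "'a \<Rightarrow> 'a"
    and N :: "'g \<Rightarrow> real" and \<mu> :: "'g measure" and Q R :: real and f :: "'g \<Rightarrow> complex"
  assumes "homogeneous_group \<A> U \<phi> E A"
    and "Q = homogeneous_dimension A" and "Q \<ge> 3"
    and "homogeneous_quasi_norm E A N"
    and "haar_measure \<mu>"
    and "R > 0"
    and "f \<in> test_functions \<A> (quasi_ball N R - {0})"
  shows "sqrt (LINT x:quasi_ball N R|\<mu>. 1 / (N x)\<^sup>2 * (cmod (f x - f (dilation E A (R / N x) x)))\<^sup>2)
           \<le> 2 / (Q - 2) * sqrt (LINT x:quasi_ball N R|\<mu>. (cmod (radial_derivative E A N f x))\<^sup>2)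
       \<and> sqrt (LINT x:quasi_ball N R|\<mu>. 1 / (N x)\<^sup>2 * (cmod (f x))\<^sup>2)
           \<le> sqrt (Q / (Q - 2)) * (1 / R) * sqrt (LINT x:quasi_ball N R|\<mu>. (cmod (f x))\<^sup>2)
             + 2 / (Q - 2) * (1 + sqrt (Q / (Q - 2)))
               * sqrt (LINT x:quasi_ball N R|\<mu>. (cmod (radial_derivative E A N f x))\<^sup>2)"
    (is "sqrt ?I1 \<le> _ * sqrt ?J \<and> sqrt ?I2 \<le> ?a * sqrt ?L + _")
proof -
  interpret homogeneous_group \<A> U \<phi> E A by (rule assms(1))
  obtain e :: "'a bidx \<Rightarrow> 'a" and \<nu> where "homogeneous_coordinates \<A> U \<phi> E A e \<nu>"
  proof (rule eigenbasis_exists[OF diagonalisable])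
    fix e :: "'a bidx \<Rightarrow> 'a" and \<nu>
    assume "bij (\<lambda>t::real^'a bidx. \<Sum>i\<in>UNIV. t $ i *\<^sub>R e i)"
      "\<And>i. A (e i) = \<nu> i *\<^sub>R e i" "\<And>i. \<nu> i > 0"
    then have "homogeneous_coordinates \<A> U \<phi> E A e \<nu>" by unfold_locales
    then show thesis by (rule that)
  qed
  then interpret homogeneous_coordinates \<A> U \<phi> E A e \<nu> .
  note Q = assms(2,3) and N = assms(4) and \<mu> = assms(5) and R = assms(6)
  let ?K = "closure {x. f x \<noteq> 0}"
  have sm: "smooth_function \<A> f" and K: "compact ?K" "?K \<subseteq> quasi_ball N R - {0}"
    using assms(7) by (auto simp: test_functions_def)
  have f0: "f x = 0" if "x \<notin> ?K" for x using that closure_subset[of "{x. f x \<noteq> 0}"] by blast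
  have Z0: "euler_deriv f x = 0" if "x \<notin> ?K" for x
  proof (rule euler_deriv_eq_0[OF sm])
    show "open (- ?K)" by (intro open_Compl closed_closure)
    show "x \<in> - ?K" using that by blast
    show "f y = 0" if "y \<in> - ?K" for y using that f0 by blast
  qed
  have K0: "0 \<notin> ?K" using K(2) by blast
  have out: "f x = 0" "euler_deriv f x = 0" if "x \<notin> quasi_ball N R" for x
    using that K(2) f0 Z0 by blast+
  let ?I = "LINT x|\<mu>. (cmod (f x))\<^sup>2 / (N x)\<^sup>2" and ?J' = "LINT x|\<mu>. (cmod (euler_deriv f x))\<^sup>2 / (N x)\<^sup>2"
  have N0: "N 0 = 0" using N unfolding homogeneous_quasi_norm_def by blast
  have far: "f (dilation E A (R / N x) x) = 0" if "x \<noteq> 0" for x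
  proof (rule out)
    have "N x \<noteq> 0" "N x \<ge> 0" using N that unfolding homogeneous_quasi_norm_def by blast+
    then have Nx: "N x > 0" by simp
    then have "N (dilation E A (R / N x) x) = R / N x * N x"
      using N R unfolding homogeneous_quasi_norm_def by simp
    then show "dilation E A (R / N x) x \<notin> quasi_ball N R" using Nx by (simp add: quasi_ball_def)
  qed
  \<comment> \<open>At the unit both integrands are 0, by division by \<open>N 0 = 0\<close>; at all
    other points of the ball the subtracted term vanishes.\<close>
  have I1: "?I1 = ?I"
    unfolding set_lebesgue_integral_def
  proof (rule Bochner_Integration.integral_cong[OF refl])
    fix x
    show "indicat_real (quasi_ball N R) x *\<^sub>R (1 / (N x)\<^sup>2 * (cmod (f x - f (dilation E A (R / N x) x)))\<^sup>2) = (cmod (f x))\<^sup>2 / (N x)\<^sup>2"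
      using far[of x] out[of x] N0 by (cases "x = 0"; cases "x \<in> quasi_ball N R") auto
  qed
  have I2: "?I2 = ?I"
    unfolding set_lebesgue_integral_def
    by (rule Bochner_Integration.integral_cong[OF refl]) (use out in \<open>auto simp: indicator_def\<close>)
  \<comment> \<open>The radial operator is the Euler derivative divided by \<open>N x\<close>, so
    its square already contains the weight on the right of Hardy's inequality.\<close>
  have J: "?J = ?J'"
    unfolding set_lebesgue_integral_def
    by (rule Bochner_Integration.integral_cong[OF refl])
      (use out in \<open>auto simp: indicator_def radial_derivative_eq[OF N sm Z0[OF K0]] norm_divide power_divide\<close>)
  have "?I \<le> (2 / (Q - 2))\<^sup>2 * ?J'"
    using hardy_inequality[OF \<mu> N _ sm K(1) K0 f0] Q by simp
  then have "sqrt ?I \<le> sqrt ((2 / (Q - 2))\<^sup>2 * ?J')" by (rule real_sqrt_le_mono)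
  also have "\<dots> = 2 / (Q - 2) * sqrt ?J'" using Q by (simp add: real_sqrt_mult)
  finally have main: "sqrt ?I \<le> 2 / (Q - 2) * sqrt ?J'" .
  have "?J \<ge> 0" "?L \<ge> 0"
    unfolding set_lebesgue_integral_def by (intro Bochner_Integration.integral_nonneg; simp)+
  then have "2 / (Q - 2) * sqrt ?J * sqrt (Q / (Q - 2)) \<ge> 0" "?a * sqrt ?L \<ge> 0"
    using Q R by (auto intro!: mult_nonneg_nonneg divide_nonneg_nonneg)
  \<comment> \<open>The Hardy bound is one summand on the right of the second inequality, once
    \<open>1 + sqrt (Q / (Q - 2))\<close> is multiplied out; the other summands are
    nonnegative.\<close>
  then have "2 / (Q - 2) * sqrt ?J \<le> ?a * sqrt ?L + 2 / (Q - 2) * (1 + sqrt (Q / (Q - 2))) * sqrt ?J"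
    by (simp add: algebra_simps)
  then show ?thesis
    using main unfolding I1 I2 J by auto
qed

end
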